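(* Let $P$ be a Noetherian left cancellative right LCM monoid with set of atoms $P_a$, let $\{X_p\}_{p\in P}$ be a compactly aligned product system of essential $C^*$-correspondences over $P$ with $X_e=A$, let $N:P\to(0,\infty)$ be a multiplicative homomorphism with $N(u)=1$ for every invertible $u\in P$, and let $\beta\in\mathbb{R}$. Suppose that the tree $(\lambda_\omega)$ of $\lambda$ is finite for every list $\lambda$. Then a tracial state $\tau$ on $A$ satisfies $$\tau(a)+\sum_{\emptyset\neq K\subset J}(-1)^{|K|}N(\vee K)^{-\beta}\,\mathrm{Tr}_\tau^{\vee K}(a)\ \geq\ 0\quad\text{for all } a\in A_+\text{ and all finite } J\subset P\setminus\{e\}$$ if and only if it satisfies $$\tau(a)+\sum_{\emptyset\neq K\subset J}(-1)^{|K|}N(\vee K)^{-\beta}\,\mathrm{Tr}_\tau^{\vee K}(a)\ \geq\ 0\quad\text{for all } a\in A_+\text{ and all finite } J\subset P_a .$$ Summands with $\vee K=\infty$ are zero.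
   Context: Monoids. A right LCM monoid is a left-cancellative monoid $P$ (identity $e$) such that any two elements having a common right multiple have a right LCM; $r$ is a right LCM of $U\subset P$ if $r\in\bigcap_{q\in U}qP$ and every element of $\bigcap_{q\in U}qP$ lies in $rP$. $P^*$ is the group of invertible elements. $P$ is Noetherian if there is no infinite descending sequence for the proper factor relation ($p$ is a proper factor of $q$ if $q=xpy$ with at least one of $x,y$ non-invertible). An atom is $s\in P\setminus P^*$ such that every decomposition of $s$ as a finite product contains at most one non-invertible factor. Write $p\le r$ if $r\in pP$, and then $p^{-1}r$ is the unique $q$ with $pq=r$. For finite nonempty $K\subset P$, $\vee K$ denotes a right LCM of $K$ (unique up to right multiplication by an element of $P^*$), and $\vee K=\infty$ if $K$ has none; $p\vee q=\vee\{p,q\}$, and $p\vee\infty=\infty$. Lists and the tree. Let $I_n=\{1,\dots,n\}$. A list is a function $\lambda:I_n\to P\cup\{\infty\}$. It is a leaf if $\lambda(I_n)\subset P_a\cup\{\infty\}$ or $\lambda(I_n)\cap P^*\ne\emptyset$. If $\lambda$ is not a leaf, let $i$ be the smallest index such that $\lambda(i)\in P$ and $\lambda(i)=pq$ with $p,q\in P\setminus P^*$, where $p$ is chosen in $P_a$, and define lists $\lambda_1,\lambda_2$ by $\lambda_1(i)=p$, $\lambda_1(j)=\lambda(j)$ for $j\ne i$; and $\lambda_2(j)=p^{-1}(p\vee\lambda(j))$ if $p\vee\lambda(j)<\infty$, $\lambda_2(j)=\infty$ otherwise ($p\vee\lambda(j)$ is any choice of right LCM; in particular one chooses $\lambda_2(i)=q$).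 The tree $(\lambda_\omega)$ of $\lambda$ is the binary tree with root $\lambda$ in which each non-leaf node $\lambda_\omega$ ($\omega$ a word in $1,2$) has the two children $\lambda_{\omega1}=(\lambda_\omega)_1$ and $\lambda_{\omega2}=(\lambda_\omega)_2$; branches end at the first leaf encountered, if any. Product systems. A $C^*$-correspondence over a $C^*$-algebra $A$ is a right Hilbert $A$-module $X$ with a left action $\varphi:A\to\mathcal{L}(X)$; it is essential if $\overline{\varphi(A)X}=X$. A product system over $P$ is a family $(X_p)_{p\in P}$ of $C^*$-correspondences over $A$ with a monoid structure on $\bigcup_pX_p$ such that $\xi\zeta\in X_{pq}$ for $\xi\in X_p,\zeta\in X_q$, the map $\xi\otimes\zeta\mapsto\xi\zeta$ extends to an isometric isomorphism $X_p\otimes_AX_q\simeq X_{pq}$ for all $p,q\in P$ with $p\ne e$, $X_e={}_AA_A$, and multiplication by $X_e$ gives the bimodule structure. For $p\le r$ let $\iota_p^r:\mathcal{L}(X_p)\to\mathcal{L}(X_r)$ be $S\mapsto S\otimes I_{p^{-1}r}$ under $X_r\simeq X_p\otimes_AX_{p^{-1}r}$. $X$ is compactly aligned if $\iota^r_p(\mathcal{K}(X_p))\iota^r_q(\mathcal{K}(X_q))\subset\mathcal{K}(X_r)$ whenever $pP\cap qP=rP$. Induced traces. For a finite positive trace $\tau$ on $A$ and a $C^*$-correspondence $Y$, $\mathrm{Tr}^Y_\tau(T)=\sup_H\sum_{\xi\in H}\tau(\langle\xi,T\xi\rangle)$ for $T\in\mathcal{L}(Y)_+$, the supremum over finite $H\subset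 Y$ with $\sum_{\xi\in H}\theta_{\xi,\xi}\le1$, where $\theta_{\xi,\zeta}\eta=\xi\langle\zeta,\eta\rangle$. $\mathrm{Tr}^p_\tau(a)$ means $\mathrm{Tr}^{X_p}_\tau(\varphi_p(a))$ for $a\in A_+$, a possibly infinite trace on $A$.
   Formalization: Added hypothesis: for every finite nonempty K in P\{e}, the trace Tr_τ^r on A_+ does not depend on which right LCM r of K is chosen. Without it the sums are ill-defined, and the claim can fail, when P has nontrivial invertible elements; it is automatic if P*={e}. *)

theory Defs
  imports "HOL-Analysis.Analysis"
begin

section \<open>C*-algebras\<close>

class complex_vec = real_vector +
  fixes scaleC :: "complex \<Rightarrow> 'a \<Rightarrow> 'a"  (infixr "*\<^sub>C" 75)
  assumes scaleC_add_right: "c *\<^sub>C (x + y) = c *\<^sub>C x + c *\<^sub>C y"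
    and scaleC_add_left: "(c + d) *\<^sub>C x = c *\<^sub>C x + d *\<^sub>C x"
    and scaleC_scaleC: "c *\<^sub>C (d *\<^sub>C x) = (c * d) *\<^sub>C x"
    and scaleC_of_real: "complex_of_real r *\<^sub>C x = r *\<^sub>R x"

text \<open>Not necessarily unital.\<close>

class cstar_algebra = complex_vec + real_normed_algebra + banach +
  fixes star :: "'a \<Rightarrow> 'a"
  assumes norm_scaleC: "norm (c *\<^sub>C x) = cmod c * norm x"
    and mult_scaleC_left: "(c *\<^sub>C x) * y = c *\<^sub>C (x * y)"
    and mult_scaleC_right: "x * (c *\<^sub>C y) = c *\<^sub>C (x * y)"
    and star_add: "star (x + y) = star x + star y"
    and star_scaleC: "star (c *\<^sub>C x) = cnj c *\<^sub>C star x"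
    and star_mult: "star (x * y) = star y * star x"
    and star_star: "star (star x) = x"
    and cstar_identity: "norm (star x * x) = (norm x)\<^sup>2"

definition pos_elements :: "'a::cstar_algebra set"  (\<open>A\<^sub>+\<close>) where
  "A\<^sub>+ = {star b * b | b. True}"

definition tracial_state :: "('a::cstar_algebra \<Rightarrow> complex) \<Rightarrow> bool" where
  "tracial_state \<tau> \<longleftrightarrow>
     bounded_linear \<tau> \<and> (\<forall>c a. \<tau> (c *\<^sub>C a) = c * \<tau> a) \<and>
     (\<forall>a\<in>A\<^sub>+. \<tau> a \<in> \<real> \<and> 0 \<le> Re (\<tau> a)) \<and>
     onorm \<tau> = 1 \<and>
     (\<forall>a b. \<tau> (a * b) = \<tau> (b * a))"


section \<open>C*-correspondences\<close>

text \<open>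
  The modules of a product system vary with the monoid element, so they are modelled as complex
  subspaces of an ambient complex vector space \<open>'x\<close>; any family of vector spaces is of this form,
  with their direct sum as ambient space. Only the values of the operations
  on the carrier matter. Inner products are linear in the second variable.
\<close>

record ('a, 'x) correspondence =
  hcarrier :: "'x set"
  hinner :: "'x \<Rightarrow> 'x \<Rightarrow> 'a"
  ract :: "'x \<Rightarrow> 'a \<Rightarrow> 'x"
  lact :: "'a \<Rightarrow> 'x \<Rightarrow> 'x"

definition hnorm :: "('a::cstar_algebra, 'x::complex_vec) correspondence \<Rightarrow> 'x \<Rightarrow> real" where
  "hnorm X \<xi> = sqrt (norm (hinner X \<xi> \<xi>))"

definition hilbert_module :: "('a::cstar_algebra, 'x::complex_vec) correspondence \<Rightarrow> bool" where
  "hilbert_module X \<longleftrightarrow>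
     (let C = hcarrier X in
       0 \<in> C \<and> (\<forall>\<xi>\<in>C. \<forall>\<eta>\<in>C. \<xi> + \<eta> \<in> C) \<and> (\<forall>\<xi>\<in>C. \<forall>c. c *\<^sub>C \<xi> \<in> C) \<and>
       (\<forall>\<xi>\<in>C. \<forall>a. ract X \<xi> a \<in> C) \<and>
       (\<forall>\<xi>\<in>C. \<forall>\<eta>\<in>C. \<forall>a. ract X (\<xi> + \<eta>) a = ract X \<xi> a + ract X \<eta> a) \<and>
       (\<forall>\<xi>\<in>C. \<forall>a b. ract X \<xi> (a + b) = ract X \<xi> a + ract X \<xi> b) \<and>
       (\<forall>\<xi>\<in>C. \<forall>a b. ract X (ract X \<xi> a) b = ract X \<xi> (a * b)) \<and>
       (\<forall>\<xi>\<in>C. \<forall>c a. ract X (c *\<^sub>C \<xi>) a = c *\<^sub>C ract X \<xi> a) \<and>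
       (\<forall>\<xi>\<in>C. \<forall>c a. ract X \<xi> (c *\<^sub>C a) = c *\<^sub>C ract X \<xi> a) \<and>
       (\<forall>\<xi>\<in>C. \<forall>\<eta>\<in>C. \<forall>\<zeta>\<in>C. hinner X \<xi> (\<eta> + \<zeta>) = hinner X \<xi> \<eta> + hinner X \<xi> \<zeta>) \<and>
       (\<forall>\<xi>\<in>C. \<forall>\<eta>\<in>C. \<forall>c. hinner X \<xi> (c *\<^sub>C \<eta>) = c *\<^sub>C hinner X \<xi> \<eta>) \<and>
       (\<forall>\<xi>\<in>C. \<forall>\<eta>\<in>C. \<forall>a. hinner X \<xi> (ract X \<eta> a) = hinner X \<xi> \<eta> * a) \<and>
       (\<forall>\<xi>\<in>C. \<forall>\<eta>\<in>C. star (hinner X \<xi> \<eta>) = hinner X \<eta> \<xi>) \<and>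
       (\<forall>\<xi>\<in>C. hinner X \<xi> \<xi> \<in> A\<^sub>+) \<and>
       (\<forall>\<xi>\<in>C. hinner X \<xi> \<xi> = 0 \<longrightarrow> \<xi> = 0) \<and>
       (\<forall>f::nat \<Rightarrow> 'x. (\<forall>n. f n \<in> C) \<and>
            (\<forall>\<epsilon>>0. \<exists>M. \<forall>m\<ge>M. \<forall>n\<ge>M. hnorm X (f m - f n) < \<epsilon>) \<longrightarrow>
            (\<exists>\<xi>\<in>C. (\<lambda>n. hnorm X (f n - \<xi>)) \<longlonglongrightarrow> 0)))"

definition is_adjoint ::
  "('a::cstar_algebra, 'x::complex_vec) correspondence \<Rightarrow> ('x \<Rightarrow> 'x) \<Rightarrow> ('x \<Rightarrow> 'x) \<Rightarrow> bool" where
  "is_adjoint X T S \<longleftrightarrow>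
     T \<in> hcarrier X \<rightarrow> hcarrier X \<and> S \<in> hcarrier X \<rightarrow> hcarrier X \<and>
     (\<forall>\<xi>\<in>hcarrier X. \<forall>\<eta>\<in>hcarrier X. hinner X (T \<xi>) \<eta> = hinner X \<xi> (S \<eta>))"

text \<open>
  Operators are total functions on \<open>'x\<close>, to be compared on the carrier only.
\<close>

definition adjointable_ops ::
  "('a::cstar_algebra, 'x::complex_vec) correspondence \<Rightarrow> ('x \<Rightarrow> 'x) set"  (\<open>\<L>\<close>) where
  "\<L> X = {T. \<exists>S. is_adjoint X T S}"

definition positive_op ::
  "('a::cstar_algebra, 'x::complex_vec) correspondence \<Rightarrow> ('x \<Rightarrow> 'x) \<Rightarrow> bool" where
  "positive_op X T \<longleftrightarrow>
     (\<exists>S S'. is_adjoint X S S' \<and> (\<forall>\<xi>\<in>hcarrier X. T \<xi> = S' (S \<xi>)))"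

definition op_le ::
  "('a::cstar_algebra, 'x::complex_vec) correspondence \<Rightarrow> ('x \<Rightarrow> 'x) \<Rightarrow> ('x \<Rightarrow> 'x) \<Rightarrow> bool" where
  "op_le X S T \<longleftrightarrow> positive_op X (\<lambda>\<xi>. T \<xi> - S \<xi>)"

definition rank_one ::
  "('a::cstar_algebra, 'x::complex_vec) correspondence \<Rightarrow> 'x \<Rightarrow> 'x \<Rightarrow> 'x \<Rightarrow> 'x"  (\<open>\<theta>\<close>) where
  "\<theta> X \<xi> \<zeta> \<eta> = ract X \<xi> (hinner X \<zeta> \<eta>)"

text \<open>
  The closed linear span of the \<open>\<theta>\<^sub>\<xi>\<^sub>,\<^sub>\<zeta>\<close> in the operator norm; scalar coefficients are
  absorbed into \<open>\<xi>\<close>.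
\<close>

definition compact_ops ::
  "('a::cstar_algebra, 'x::complex_vec) correspondence \<Rightarrow> ('x \<Rightarrow> 'x) set"  (\<open>\<K>\<close>) where
  "\<K> X = {T \<in> \<L> X. \<forall>\<epsilon>>0. \<exists>l. set l \<subseteq> hcarrier X \<times> hcarrier X \<and>
     (\<forall>\<eta>\<in>hcarrier X. hnorm X (T \<eta> - (\<Sum>(\<xi>, \<zeta>)\<leftarrow>l. \<theta> X \<xi> \<zeta> \<eta>)) \<le> \<epsilon> * hnorm X \<eta>)}"

definition cstar_correspondence ::
  "('a::cstar_algebra, 'x::complex_vec) correspondence \<Rightarrow> bool" where
  "cstar_correspondence X \<longleftrightarrow> hilbert_module X \<and>
     (\<forall>a. is_adjoint X (lact X a) (lact X (star a))) \<and>
     (\<forall>\<xi>\<in>hcarrier X. \<forall>a b. lact X (a + b) \<xi> = lact X a \<xi> + lact X b \<xi>) \<and>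
     (\<forall>\<xi>\<in>hcarrier X. \<forall>a b. lact X (a * b) \<xi> = lact X a (lact X b \<xi>)) \<and>
     (\<forall>\<xi>\<in>hcarrier X. \<forall>c a. lact X (c *\<^sub>C a) \<xi> = c *\<^sub>C lact X a \<xi>)"

definition essential :: "('a::cstar_algebra, 'x::complex_vec) correspondence \<Rightarrow> bool" where
  "essential X \<longleftrightarrow> (\<forall>\<xi>\<in>hcarrier X. \<forall>\<epsilon>>0. \<exists>l. set l \<subseteq> UNIV \<times> hcarrier X \<and>
     hnorm X (\<xi> - (\<Sum>(a, \<eta>)\<leftarrow>l. lact X a \<eta>)) < \<epsilon>)"

text \<open>
  The interior tensor product \<open>X \<otimes>\<^sub>A Y\<close> is the Hausdorff completion of the space of formal sums
  \<open>\<Sum>\<^sub>i \<xi>\<^sub>i \<otimes> \<zeta>\<^sub>i\<close>, represented here by lists of pairs, for the \<open>A\<close>-valued semi-inner product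
  \<open>tensor_inner\<close>. Hence \<open>\<xi> \<otimes> \<zeta> \<mapsto> t \<xi> \<zeta>\<close> extends to an isometric isomorphism onto the Hilbert
  module \<open>Z\<close> iff the induced map on formal sums preserves the inner products and has dense range
  (biadditivity and right linearity of \<open>t\<close> then follow, because the inner product of \<open>Z\<close> is
  definite).
\<close>

definition tensor_inner ::
  "('a::cstar_algebra, 'x::complex_vec) correspondence \<Rightarrow> ('a, 'x) correspondence \<Rightarrow>
   ('x \<times> 'x) list \<Rightarrow> ('x \<times> 'x) list \<Rightarrow> 'a" where
  "tensor_inner X Y l l' =
     (\<Sum>(\<xi>, \<zeta>)\<leftarrow>l. \<Sum>(\<xi>', \<zeta>')\<leftarrow>l'. hinner Y \<zeta> (lact Y (hinner X \<xi> \<xi>') \<zeta>'))"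

definition extends_to_tensor_iso ::
  "('a::cstar_algebra, 'x::complex_vec) correspondence \<Rightarrow> ('a, 'x) correspondence \<Rightarrow>
   ('a, 'x) correspondence \<Rightarrow> ('x \<Rightarrow> 'x \<Rightarrow> 'x) \<Rightarrow> bool" where
  "extends_to_tensor_iso X Y Z t \<longleftrightarrow>
     (\<forall>\<xi>\<in>hcarrier X. \<forall>\<zeta>\<in>hcarrier Y. t \<xi> \<zeta> \<in> hcarrier Z) \<and>
     (\<forall>l l'. set l \<subseteq> hcarrier X \<times> hcarrier Y \<longrightarrow> set l' \<subseteq> hcarrier X \<times> hcarrier Y \<longrightarrow>
        hinner Z (\<Sum>(\<xi>, \<zeta>)\<leftarrow>l. t \<xi> \<zeta>) (\<Sum>(\<xi>, \<zeta>)\<leftarrow>l'. t \<xi> \<zeta>) = tensor_inner X Y l l') \<and>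
     (\<forall>\<eta>\<in>hcarrier Z. \<forall>\<epsilon>>0. \<exists>l. set l \<subseteq> hcarrier X \<times> hcarrier Y \<and>
        hnorm Z (\<eta> - (\<Sum>(\<xi>, \<zeta>)\<leftarrow>l. t \<xi> \<zeta>)) < \<epsilon>) \<and>
     (\<forall>\<xi>\<in>hcarrier X. \<forall>\<zeta>\<in>hcarrier Y. \<forall>a. lact Z a (t \<xi> \<zeta>) = t (lact X a \<xi>) \<zeta>)"

definition induced_trace ::
  "('a::cstar_algebra, 'x::complex_vec) correspondence \<Rightarrow> ('a \<Rightarrow> complex) \<Rightarrow> ('x \<Rightarrow> 'x) \<Rightarrow> ereal"
  where
  "induced_trace Y \<tau> T =
     (SUP H \<in> {H. finite H \<and> H \<subseteq> hcarrier Y \<and> op_le Y (\<lambda>\<eta>. \<Sum>\<xi>\<in>H. \<theta> Y \<xi> \<xi> \<eta>) (\<lambda>\<eta>. \<eta>)}.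
        ereal (\<Sum>\<xi>\<in>H. Re (\<tau> (hinner Y \<xi> (T \<xi>)))))"


section \<open>Right LCM monoids\<close>

definition invertibles :: "'p::monoid_mult set" where
  "invertibles = {u. \<exists>v. u * v = 1 \<and> v * u = 1}"

definition right_multiples :: "'p::monoid_mult \<Rightarrow> 'p set" where
  "right_multiples p = range ((*) p)"

definition left_cancellative :: "'p::monoid_mult itself \<Rightarrow> bool" where
  "left_cancellative _ \<longleftrightarrow> (\<forall>p q r::'p. p * q = p * r \<longrightarrow> q = r)"

definition is_right_lcm :: "'p::monoid_mult \<Rightarrow> 'p set \<Rightarrow> bool" where
  "is_right_lcm r U \<longleftrightarrow>
     r \<in> (\<Inter>q\<in>U. right_multiples q) \<and> (\<Inter>q\<in>U. right_multiples q) \<subseteq> right_multiples r"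

definition right_LCM_monoid :: "'p::monoid_mult itself \<Rightarrow> bool" where
  "right_LCM_monoid T \<longleftrightarrow> left_cancellative T \<and>
     (\<forall>p q::'p. right_multiples p \<inter> right_multiples q \<noteq> {} \<longrightarrow> (\<exists>r. is_right_lcm r {p, q}))"

definition proper_factor :: "'p::monoid_mult \<Rightarrow> 'p \<Rightarrow> bool" where
  "proper_factor p q \<longleftrightarrow> (\<exists>x y. q = x * p * y \<and> (x \<notin> invertibles \<or> y \<notin> invertibles))"

definition noetherian_monoid :: "'p::monoid_mult itself \<Rightarrow> bool" where
  "noetherian_monoid _ \<longleftrightarrow> \<not> (\<exists>f::nat \<Rightarrow> 'p. \<forall>n. proper_factor (f (Suc n)) (f n))"

definition atoms :: "'p::monoid_mult set" where
  "atoms = {s. s \<notin> invertibles \<and>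
     (\<forall>ps. prod_list ps = s \<longrightarrow> length (filter (\<lambda>p. p \<notin> invertibles) ps) \<le> 1)}"

definition left_quotient :: "'p::monoid_mult \<Rightarrow> 'p \<Rightarrow> 'p" where
  "left_quotient p r = (THE q. p * q = r)"

text \<open>\<open>None\<close> stands for \<open>\<infinity>\<close>. Right LCMs are only unique up to right multiplication by an
  invertible element; \<open>right_lcm\<close> picks one.\<close>

definition right_lcm :: "'p::monoid_mult set \<Rightarrow> 'p option"  (\<open>\<Or>\<close>) where
  "\<Or> K = (if \<exists>r. is_right_lcm r K then Some (SOME r. is_right_lcm r K) else None)"


section \<open>Lists and their trees\<close>

text \<open>A list \<open>I\<^sub>n \<rightarrow> P \<union> {\<infinity>}\<close> is an element of type \<open>'p option list\<close>, with indices
  starting from 0.\<close>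

definition leaf :: "'p::monoid_mult option list \<Rightarrow> bool" where
  "leaf \<Lambda> \<longleftrightarrow> set \<Lambda> \<subseteq> Some ` atoms \<union> {None} \<or> set \<Lambda> \<inter> Some ` invertibles \<noteq> {}"

definition splittable :: "'p::monoid_mult option list \<Rightarrow> nat \<Rightarrow> bool" where
  "splittable \<Lambda> i \<longleftrightarrow>
     i < length \<Lambda> \<and> (\<exists>p q. p \<notin> invertibles \<and> q \<notin> invertibles \<and> \<Lambda> ! i = Some (p * q))"

text \<open>\<open>\<Lambda>1\<close>, \<open>\<Lambda>2\<close> arise from \<open>\<Lambda>\<close> by some admissible choice of the factorization \<open>pq\<close> and of
  the right LCMs; \<open>s = p\<^sup>-\<^sup>1(p \<or> r)\<close> is expressed by \<open>ps\<close> being a right LCM of \<open>p\<close> and \<open>r\<close>.\<close>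

definition children ::
  "'p::monoid_mult option list \<Rightarrow> 'p option list \<Rightarrow> 'p option list \<Rightarrow> bool" where
  "children \<Lambda> \<Lambda>1 \<Lambda>2 \<longleftrightarrow>
     (\<exists>i p q. splittable \<Lambda> i \<and> (\<forall>j<i. \<not> splittable \<Lambda> j) \<and>
        p \<in> atoms \<and> q \<notin> invertibles \<and> \<Lambda> ! i = Some (p * q) \<and>
        \<Lambda>1 = \<Lambda>[i := Some p] \<and>
        length \<Lambda>2 = length \<Lambda> \<and> \<Lambda>2 ! i = Some q \<and>
        (\<forall>j<length \<Lambda>. j \<noteq> i \<longrightarrow>
           (case \<Lambda> ! j of
              None \<Rightarrow> \<Lambda>2 ! j = None
            | Some r \<Rightarrow>
                (if \<exists>m. is_right_lcm m {p, r}
                 then \<exists>s. \<Lambda>2 ! j = Some s \<and> is_right_lcm (p * s) {p, r}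
                 else \<Lambda>2 ! j = None))))"

text \<open>A tree of \<open>\<Lambda>\<close> is a partial map from words in 1, 2 (the nodes) to lists.\<close>

definition is_tree_of ::
  "'p::monoid_mult option list \<Rightarrow> (nat list \<rightharpoonup> 'p option list) \<Rightarrow> bool" where
  "is_tree_of \<Lambda> T \<longleftrightarrow>
     T [] = Some \<Lambda> \<and>
     (\<forall>\<omega> k. \<omega> @ [k] \<in> dom T \<longrightarrow> \<omega> \<in> dom T \<and> k \<in> {1, 2}) \<and>
     (\<forall>\<omega> M. T \<omega> = Some M \<longrightarrow>
        (if leaf M then T (\<omega> @ [1]) = None \<and> T (\<omega> @ [2]) = None
         else \<exists>M1 M2. children M M1 M2 \<and> T (\<omega> @ [1]) = Some M1 \<and> T (\<omega> @ [2]) = Some M2))"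

text \<open>The choices entering the construction are existentially quantified.\<close>

definition has_finite_tree :: "'p::monoid_mult option list \<Rightarrow> bool" where
  "has_finite_tree \<Lambda> \<longleftrightarrow> (\<exists>T. is_tree_of \<Lambda> T \<and> finite (dom T))"


section \<open>Product systems\<close>

text \<open>
  The fibres may overlap as subsets of \<open>'x\<close>. Their union is meant to be disjoint, so the
  multiplication \<open>X\<^sub>p \<times> X\<^sub>q \<rightarrow> X\<^sub>p\<^sub>q\<close> is indexed by \<open>p\<close> and \<open>q\<close>. The map \<open>unit_map\<close> is the
  identification of \<open>A\<close> with \<open>X\<^sub>e\<close>.
\<close>

record ('p, 'a, 'x) product_system =
  fibre :: "'p \<Rightarrow> ('a, 'x) correspondence"
  pmul :: "'p \<Rightarrow> 'p \<Rightarrow> 'x \<Rightarrow> 'x \<Rightarrow> 'x"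
  unit_map :: "'a \<Rightarrow> 'x"

text \<open>
  No identity element is required of the multiplication on \<open>\<Union>\<^sub>p X\<^sub>p\<close>: it would be an identity
  of \<open>X\<^sub>e = A\<close>. If \<open>A\<close> is unital and the fibres are essential, \<open>unit_map 1\<close> is an identity.
\<close>

definition is_product_system ::
  "('p::monoid_mult, 'a::cstar_algebra, 'x::complex_vec) product_system \<Rightarrow> bool" where
  "is_product_system X \<longleftrightarrow>
     (\<forall>p. cstar_correspondence (fibre X p)) \<and>
     (\<forall>p q. \<forall>\<xi>\<in>hcarrier (fibre X p). \<forall>\<zeta>\<in>hcarrier (fibre X q).
        pmul X p q \<xi> \<zeta> \<in> hcarrier (fibre X (p * q))) \<and>
     (\<forall>p q r. \<forall>\<xi>\<in>hcarrier (fibre X p). \<forall>\<eta>\<in>hcarrier (fibre X q). \<forall>\<zeta>\<in>hcarrier (fibre X r).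
        pmul X (p * q) r (pmul X p q \<xi> \<eta>) \<zeta> = pmul X p (q * r) \<xi> (pmul X q r \<eta> \<zeta>)) \<and>
     (\<forall>p q. p \<noteq> 1 \<longrightarrow>
        extends_to_tensor_iso (fibre X p) (fibre X q) (fibre X (p * q)) (pmul X p q)) \<and>
     bij_betw (unit_map X) UNIV (hcarrier (fibre X 1)) \<and>
     (\<forall>a b. unit_map X (a + b) = unit_map X a + unit_map X b) \<and>
     (\<forall>c a. unit_map X (c *\<^sub>C a) = c *\<^sub>C unit_map X a) \<and>
     (\<forall>a b. hinner (fibre X 1) (unit_map X a) (unit_map X b) = star a * b) \<and>
     (\<forall>a b. ract (fibre X 1) (unit_map X a) b = unit_map X (a * b)) \<and>
     (\<forall>a b. lact (fibre X 1) a (unit_map X b) = unit_map X (a * b)) \<and>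
     (\<forall>p. \<forall>\<xi>\<in>hcarrier (fibre X p). \<forall>a. pmul X 1 p (unit_map X a) \<xi> = lact (fibre X p) a \<xi>) \<and>
     (\<forall>p. \<forall>\<xi>\<in>hcarrier (fibre X p). \<forall>a. pmul X p 1 \<xi> (unit_map X a) = ract (fibre X p) \<xi> a)"

text \<open>
  \<open>S \<otimes> I\<close>, transported to \<open>X\<^sub>r\<close>. The products \<open>\<xi>\<zeta>\<close> span a dense subspace of \<open>X\<^sub>r\<close>, so the chosen
  operator is unique on the carrier.
\<close>

definition iota ::
  "('p::monoid_mult, 'a::cstar_algebra, 'x::complex_vec) product_system \<Rightarrow>
   'p \<Rightarrow> 'p \<Rightarrow> ('x \<Rightarrow> 'x) \<Rightarrow> ('x \<Rightarrow> 'x)" where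
  "iota X p r S =
     (let q = left_quotient p r in
      SOME T. T \<in> \<L> (fibre X r) \<and>
        (\<forall>\<xi>\<in>hcarrier (fibre X p). \<forall>\<zeta>\<in>hcarrier (fibre X q).
           T (pmul X p q \<xi> \<zeta>) = pmul X p q (S \<xi>) \<zeta>))"

definition compactly_aligned ::
  "('p::monoid_mult, 'a::cstar_algebra, 'x::complex_vec) product_system \<Rightarrow> bool" where
  "compactly_aligned X \<longleftrightarrow>
     (\<forall>p q r. right_multiples p \<inter> right_multiples q = right_multiples r \<longrightarrow>
        (\<forall>S\<in>\<K> (fibre X p). \<forall>T\<in>\<K> (fibre X q). iota X p r S \<circ> iota X q r T \<in> \<K> (fibre X r)))"

definition Tr ::
  "('p::monoid_mult, 'a::cstar_algebra, 'x::complex_vec) product_system \<Rightarrow>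
   ('a \<Rightarrow> complex) \<Rightarrow> 'p \<Rightarrow> 'a \<Rightarrow> ereal" where
  "Tr X \<tau> p a = induced_trace (fibre X p) \<tau> (lact (fibre X p) a)"

text \<open>
  The traces may be infinite, so the alternating sum is taken in \<^typ>\<open>ereal\<close>. When it is required
  to be nonnegative for all finite subsets of a given set, the singletons already
  force \<open>Tr X \<tau> p\<close> to be finite for the right LCM \<open>p\<close> chosen for each of them.
\<close>

definition trace_sum ::
  "('p::monoid_mult, 'a::cstar_algebra, 'x::complex_vec) product_system \<Rightarrow>
   ('p \<Rightarrow> real) \<Rightarrow> real \<Rightarrow> ('a \<Rightarrow> complex) \<Rightarrow> 'p set \<Rightarrow> 'a \<Rightarrow> ereal" where
  "trace_sum X N \<beta> \<tau> J a =
     ereal (Re (\<tau> a)) +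
     (\<Sum>K \<in> {K. K \<subseteq> J \<and> K \<noteq> {}}.
        case \<Or> K of
          None \<Rightarrow> 0
        | Some r \<Rightarrow> ereal ((- 1) ^ card K * N r powr (- \<beta>)) * Tr X \<tau> r a)"

text \<open>
  Independence of \<open>Tr\<^sub>\<tau>\<^sup>r\<close> of the choice of the right LCM \<open>r\<close> of \<open>K\<close>, for every \<open>K\<close> that can occur in
  \<open>trace_sum\<close>. This is what makes the notation with \<open>\<Or>K\<close> meaningful; it is vacuous if 1 is the
  only invertible element. It does not hold automatically: for the integers acting on
  \<open>\<complex>\<^sup>2\<close> by the flip and \<open>X\<^sub>n = \<complex>\<^sup>2\<close> with left action twisted by the \<open>n\<close>-th power of the flip,
  \<open>Tr\<^sub>\<tau>\<^sup>1\<close> is \<open>\<tau>\<close> composed with the flip, whereas \<open>Tr\<^sub>\<tau>\<^sup>0 = \<tau>\<close>, and both 0 and 1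
  are right LCMs of \<open>{1}\<close>.
\<close>

definition lcm_traces_well_defined ::
  "('p::monoid_mult, 'a::cstar_algebra, 'x::complex_vec) product_system \<Rightarrow>
   ('a \<Rightarrow> complex) \<Rightarrow> bool" where
  "lcm_traces_well_defined X \<tau> \<longleftrightarrow>
     (\<forall>K r r'. finite K \<and> K \<noteq> {} \<and> K \<subseteq> UNIV - {1} \<and> is_right_lcm r K \<and> is_right_lcm r' K \<longrightarrow>
        (\<forall>a\<in>A\<^sub>+. Tr X \<tau> r a = Tr X \<tau> r' a))"

end

theory Submission
  imports Defs
begin

text \<open>
  For a monoid element p let F_p be the map \<open>\<tau> \<mapsto> N(p)\<^sup>-\<^sup>\<beta> Tr\<^sub>\<tau>\<^sup>p\<close> on traces. The alternating sum attached to
  \<open>J\<close> is the inclusion-exclusion expansion of the product of the factors 1 - F_q over q in \<open>J\<close>, where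
  F_p F_q is read as F_r for a right LCM r of p and q. So F_p behaves like the indicator
  function of the right ideal \<open>pP\<close>, and the sum depends only on the ideals \<open>qP\<close> and on the function
  \<open>weight\<close>, which sends the ideal \<open>rP\<close> to the value of F_r. For a list \<open>\<Lambda>\<close> write f(\<open>\<Lambda>\<close>) for its
  alternating sum. If the entry pq of \<open>\<Lambda>\<close> is split, then from
  1 - F_pq = (1 - F_p) + F_p (1 - F_q) and \<open>pP \<inter> rP = p(sP)\<close>, where ps is a right LCM of p and r, one gets
  f(\<open>\<Lambda>\<close>) = f(\<open>\<Lambda>1\<close>) + F_p f(\<open>\<Lambda>2\<close>) for the two children (\<open>alt_sum_children\<close>). Hence positivity climbs from the
  leaves of a finite tree to its root. It holds at the leaves: a list with an invertible entry has a
  factor 1 - F_u = 0, and a list of atoms is covered by the positivity assumed for sets of atoms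
  (\<open>alt_sum_nonneg\<close>).

  This needs that F_p maps positive combinations of traces to positive ones, and that F_p F_r is
  F_pr. Both follow from one approximation statement: for a = b* b and finitely many r at once,
  Tr^pr(a) is the limit of the sums of Tr^r(\<open>\<langle>b\<xi>, b\<xi>\<rangle>\<close>) over the vectors \<open>\<xi>\<close> of suitable finite sets
  H in \<open>X\<^sub>p\<close> (\<open>trace_in_stages_le\<close>, \<open>trace_in_stages_ge\<close>, \<open>stage_frame\<close>). The sets that count are those for
  which 1 - \<open>\<Sum>\<theta>\<^sub>\<xi>\<^sub>,\<^sub>\<xi>\<close> has the form S* S; they are called frames here. Two facts about frames carry the
  analysis. They exhaust the module: S can be made small on any finite set of vectors, in the
  seminorms coming from positive functionals (\<open>frame_small_on_vectors\<close>). And the order of two frames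
  can be exchanged under a trace (\<open>frame_exchange\<close>), which is the identity Tr(V* V) = Tr(V V*) for an
  operator V between two modules.

  Frames are built from the Cayley transform S = (1 - T)(1 + T)^{-1} of a rank one operator
  \<open>T = \<theta>\<^sub>z\<^sub>,\<^sub>z\<close> with z short, for which 1 - \<open>S\<^sup>2\<close> is again of rank one. The inverse is a geometric series
  in A, so the argument involves neither square roots nor spectra of elements of A.

  Finally, all the traces are finite on positive elements: this is so for atoms because the singletons
  of atoms give nonnegative sums, and it passes to products of atoms by stages (\<open>Tr_dominated\<close>).
\<close>

section \<open>Positive functionals on a C*-algebra\<close>

lemma scaleC_zero_left [simp]: "0 *\<^sub>C x = (0::'a::complex_vec)"
  using scaleC_of_real[of 0 x] by simp

lemma scaleC_minus_one: "(-1) *\<^sub>C x = - (x::'a::complex_vec)"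
  using scaleC_of_real[of "-1" x] by simp

lemma scaleC_one [simp]: "1 *\<^sub>C x = (x::'a::complex_vec)"
  using scaleC_of_real[of 1 x] by simp

lemma scaleC_zero_right [simp]: "c *\<^sub>C 0 = (0::'a::complex_vec)"
  using scaleC_add_right[of c 0 0] by simp

lemma norm_star: "norm (star x) = norm (x::'a::cstar_algebra)"
proof -
  have *: "norm y \<le> norm (star y)" for y :: 'a
  proof (cases "y = 0")
    case False
    have "(norm y)\<^sup>2 \<le> norm (star y) * norm y"
      using norm_mult_ineq[of "star y" y] by (simp add: cstar_identity)
    then show ?thesis using False by (simp add: power2_eq_square)
  qed simp
  show ?thesis using *[of x] *[of "star x"] by (simp add: star_star)
qed

lemma star_minus: "star (- x) = - star (x::'a::cstar_algebra)"
  using star_scaleC[of "-1" x] by (simp add: scaleC_minus_one)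

lemma star_diff: "star (x - y) = star x - star (y::'a::cstar_algebra)"
  using star_add[of x "-y"] by (simp add: star_minus)

lemma form_Cauchy_Schwarz:
  fixes B :: "'v::complex_vec \<Rightarrow> 'v \<Rightarrow> complex"
  assumes addC: "\<And>x y. x \<in> C \<Longrightarrow> y \<in> C \<Longrightarrow> x + y \<in> C"
    and scaleC: "\<And>c x. x \<in> C \<Longrightarrow> c *\<^sub>C x \<in> C"
    and add_l: "\<And>x y z. x \<in> C \<Longrightarrow> y \<in> C \<Longrightarrow> z \<in> C \<Longrightarrow> B (x + y) z = B x z + B y z"
    and add_r: "\<And>x y z. x \<in> C \<Longrightarrow> y \<in> C \<Longrightarrow> z \<in> C \<Longrightarrow> B x (y + z) = B x y + B x z"
    and scale_l: "\<And>c x y. x \<in> C \<Longrightarrow> y \<in> C \<Longrightarrow> B (c *\<^sub>C x) y = cnj c * B x y"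
    and scale_r: "\<And>c x y. x \<in> C \<Longrightarrow> y \<in> C \<Longrightarrow> B x (c *\<^sub>C y) = c * B x y"
    and pos: "\<And>x. x \<in> C \<Longrightarrow> B x x \<in> \<real> \<and> 0 \<le> Re (B x x)"
    and x: "x \<in> C" and y: "y \<in> C"
  shows "(cmod (B x y))\<^sup>2 \<le> Re (B x x) * Re (B y y)"
proof -
  have expand: "B (x + c *\<^sub>C y) (x + c *\<^sub>C y)
      = B x x + c * B x y + cnj c * B y x + cnj c * c * B y y" for c
    using x y by (simp add: add_l add_r scale_l scale_r addC scaleC algebra_simps)
  have re: "B (x + c *\<^sub>C y) (x + c *\<^sub>C y) \<in> \<real>" "0 \<le> Re (B (x + c *\<^sub>C y) (x + c *\<^sub>C y))" for c
    using pos[OF addC[OF x scaleC[OF y]]] by auto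
  have Imx: "Im (B x x) = 0" and Imy: "Im (B y y) = 0"
    using pos[OF x] pos[OF y] by (auto simp: complex_is_Real_iff)
  have herm: "B y x = cnj (B x y)"
  proof (rule complex_eqI)
    show "Im (B y x) = Im (cnj (B x y))"
      using re(1)[of 1] unfolding expand complex_is_Real_iff by (simp add: Imx Imy)
    show "Re (B y x) = Re (cnj (B x y))"
      using re(1)[of \<i>] unfolding expand complex_is_Real_iff by (simp add: Imx Imy)
  qed
  have quad: "0 \<le> Re (B x x) - 2 * t * (cmod (B x y))\<^sup>2 + t\<^sup>2 * (cmod (B x y))\<^sup>2 * Re (B y y)" for t
    using re(2)[of "- of_real t * cnj (B x y)"] unfolding expand herm
    by (simp add: cmod_power2 Imy) (simp add: algebra_simps power2_eq_square)
  show ?thesis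
  proof (cases "Re (B y y) = 0")
    case True
    have "(cmod (B x y))\<^sup>2 = 0"
    proof (rule ccontr)
      assume "(cmod (B x y))\<^sup>2 \<noteq> 0"
      then have "((Re (B x x) + 1) / (cmod (B x y))\<^sup>2) * (cmod (B x y))\<^sup>2 = Re (B x x) + 1" by simp
      then show False
        using quad[of "(Re (B x x) + 1) / (cmod (B x y))\<^sup>2"] pos[OF x] True
        by (simp only: mult.assoc) auto
    qed
    with True show ?thesis by simp
  next
    case False
    then have "0 < Re (B y y)" using pos[OF y] by auto
    with quad[of "1 / Re (B y y)"] show ?thesis
      by (simp add: field_simps power2_eq_square)
  qed
qed

definition positive_functional :: "('a::cstar_algebra \<Rightarrow> complex) \<Rightarrow> bool" where
  "positive_functional \<sigma> \<longleftrightarrow>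
     (\<forall>a b. \<sigma> (a + b) = \<sigma> a + \<sigma> b) \<and> (\<forall>c a. \<sigma> (c *\<^sub>C a) = c * \<sigma> a) \<and>
     (\<forall>x. \<sigma> (star x * x) \<in> \<real> \<and> 0 \<le> Re (\<sigma> (star x * x)))"

text \<open>
  The algebra may lack a unit, so the Cauchy-Schwarz estimate of \<open>\<sigma>\<close> against the unit, in the form
  \<open>|\<sigma>(h)|\<^sup>2 \<le> K \<sigma>(h\<^sup>2)\<close>, is made part of the definition. The two sources of such functionals are tracial
  states and vector functionals \<open>a \<mapsto> \<tau>\<langle>\<eta>, a\<eta>\<rangle>\<close>.
\<close>

definition schwarz_functional :: "('a::cstar_algebra \<Rightarrow> complex) \<Rightarrow> bool" where
  "schwarz_functional \<sigma> \<longleftrightarrow> positive_functional \<sigma> \<and>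
     (\<exists>K\<ge>0. \<forall>h. star h = h \<longrightarrow> (cmod (\<sigma> h))\<^sup>2 \<le> K * Re (\<sigma> (h * h)))"

lemma positive_functional_add: "positive_functional \<sigma> \<Longrightarrow> \<sigma> (a + b) = \<sigma> a + \<sigma> b"
  and positive_functional_scaleC: "positive_functional \<sigma> \<Longrightarrow> \<sigma> (c *\<^sub>C a) = c * \<sigma> a"
  and positive_functional_Reals: "positive_functional \<sigma> \<Longrightarrow> \<sigma> (star x * x) \<in> \<real>"
  and positive_functional_nonneg: "positive_functional \<sigma> \<Longrightarrow> 0 \<le> Re (\<sigma> (star x * x))"
  by (auto simp: positive_functional_def)

lemma positive_functional_minus: "positive_functional \<sigma> \<Longrightarrow> \<sigma> (- a) = - \<sigma> a"
  using positive_functional_scaleC[of \<sigma> "-1" a] by (simp add: scaleC_minus_one)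

lemma positive_functional_diff: "positive_functional \<sigma> \<Longrightarrow> \<sigma> (a - b) = \<sigma> a - \<sigma> b"
  using positive_functional_add[of \<sigma> a "-b"] by (simp add: positive_functional_minus)

lemma positive_functional_zero: "positive_functional \<sigma> \<Longrightarrow> \<sigma> 0 = 0"
  using positive_functional_scaleC[of \<sigma> 0 0] by simp

lemma positive_functional_sum_list:
  "positive_functional \<sigma> \<Longrightarrow> \<sigma> (\<Sum>x\<leftarrow>xs. f x) = (\<Sum>x\<leftarrow>xs. \<sigma> (f x))"
  by (induction xs) (auto simp: positive_functional_add positive_functional_zero)

lemma functional_Cauchy_Schwarz:
  assumes "positive_functional \<sigma>"
  shows "(cmod (\<sigma> (star x * y)))\<^sup>2 \<le> Re (\<sigma> (star x * x)) * Re (\<sigma> (star y * y))"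
  by (rule form_Cauchy_Schwarz[where B = "\<lambda>x y. \<sigma> (star x * y)" and C = UNIV])
    (use assms in \<open>auto simp: positive_functional_def algebra_simps star_add star_scaleC
        mult_scaleC_left mult_scaleC_right\<close>)

lemma affine_fixpoint:
  fixes d c :: "'a::cstar_algebra"
  assumes "norm d < 1"
  obtains x where "x = c + d * x" "\<And>y. y = c + d * y \<Longrightarrow> y = x"
proof -
  have "\<exists>!x. c + d * x = x"
  proof (rule banach_fix_type[of "norm d"])
    show "\<forall>x y. dist (c + d * x) (c + d * y) \<le> norm d * dist x y"
      using norm_mult_ineq by (auto simp: dist_norm simp flip: right_diff_distrib)
  qed (use assms in auto)
  then show ?thesis using that by metis
qed

text \<open>
  For \<open>\<parallel>h\<parallel> < 1\<close> the element 1 + 2p is the Cayley transform (1 + ih)(1 - ih)^{-1} in the unitization;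
  the second equation says that it is an isometry.
\<close>

lemma cayley_generator:
  fixes h :: "'a::cstar_algebra"
  assumes h: "star h = h" and n: "norm h < 1"
  obtains p where "p = \<i> *\<^sub>C h + \<i> *\<^sub>C (h * p)" "p + star p + 2 *\<^sub>R (star p * p) = 0"
proof -
  have nd: "norm (\<i> *\<^sub>C h) < 1" using n by (simp add: norm_scaleC)
  obtain p where p0: "p = \<i> *\<^sub>C h + (\<i> *\<^sub>C h) * p"
    using affine_fixpoint[OF nd, of "\<i> *\<^sub>C h"] by metis
  then have p: "p = \<i> *\<^sub>C h + \<i> *\<^sub>C (h * p)" by (simp add: mult_scaleC_left)
  have sp: "star p = (-\<i>) *\<^sub>C h + (-\<i>) *\<^sub>C (star p * h)"
    by (subst p) (simp add: star_add star_scaleC star_mult h)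
  have A: "star p * p = \<i> *\<^sub>C (star p * h) + \<i> *\<^sub>C (star p * h * p)"
    by (subst p) (simp add: distrib_left mult_scaleC_right mult.assoc)
  have B: "star p * p = (-\<i>) *\<^sub>C (h * p) + (-\<i>) *\<^sub>C (star p * h * p)"
    by (subst sp) (simp add: distrib_right mult_scaleC_left mult.assoc)
  have m: "(-\<i>) *\<^sub>C x = - (\<i> *\<^sub>C x)" for x :: 'a
    using scaleC_scaleC[of "-1" \<i> x] by (simp add: scaleC_minus_one)
  have "p + star p + (star p * p + star p * p) = 0"
  proof -
    have "p + star p = \<i> *\<^sub>C (h * p) - \<i> *\<^sub>C (star p * h)"
      by (subst (1) p, subst sp) (simp add: m)
    moreover have "star p * p + star p * p = \<i> *\<^sub>C (star p * h) - \<i> *\<^sub>C (h * p)"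
      by (subst (1) A, subst B) (simp add: m)
    ultimately show ?thesis by simp
  qed
  then have "p + star p + 2 *\<^sub>R (star p * p) = 0"
    by (simp add: scaleR_2)
  with p show ?thesis using that by blast
qed

text \<open>
  Let U be the Cayley transform of h. The averages of 1, U, ..., U^m multiply h to something of norm
  O(1/m), because h is a multiple of U - 1 and the sum telescopes (the mean ergodic theorem). So e, the
  difference between 1 and the average, is an approximate unit for h of norm at most 2, and it lies in A.
\<close>

lemma small_selfadjoint_approx_unit:
  fixes h :: "'a::cstar_algebra"
  assumes h: "star h = h" and n: "norm h < 1"
  shows "\<exists>e. norm e \<le> 2 \<and> norm (h - h * e) \<le> 2 / real (Suc m)"
proof -
  obtain p where p: "p = \<i> *\<^sub>C h + \<i> *\<^sub>C (h * p)" and u: "p + star p + 2 *\<^sub>R (star p * p) = 0"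
    using cayley_generator[OF h n] by metis
  have iso: "norm (y + 2 *\<^sub>R (p * y)) = norm y" for y
  proof -
    have "star (y + 2 *\<^sub>R (p * y)) * (y + 2 *\<^sub>R (p * y))
      = star y * y + 2 *\<^sub>R (star y * ((p + star p + 2 *\<^sub>R (star p * p)) * y))"
    proof -
      have "star (2 *\<^sub>R z) = 2 *\<^sub>R star z" for z :: 'a
        using star_scaleC[of 2 z] scaleC_of_real[of 2 z] scaleC_of_real[of 2 "star z"] by simp
      then show ?thesis
        by (simp add: star_add star_mult algebra_simps scaleR_2)
    qed
    then have "star (y + 2 *\<^sub>R (p * y)) * (y + 2 *\<^sub>R (p * y)) = star y * y" using u by simp
    then have "(norm (y + 2 *\<^sub>R (p * y)))\<^sup>2 = (norm y)\<^sup>2" by (metis cstar_identity)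
    then show ?thesis by simp
  qed
  \<comment> \<open>1 + s j is the j-th power of the isometry 1 + 2p.\<close>
  define s where "s = rec_nat 0 (\<lambda>_ x. x + 2 *\<^sub>R p + 2 *\<^sub>R (p * x))"
  have s0: "s 0 = 0" and sS: "\<And>j. s (Suc j) = s j + 2 *\<^sub>R p + 2 *\<^sub>R (p * s j)"
    by (simp_all add: s_def)
  have isos: "norm (z + s j * z) = norm z" for j z
  proof (induction j)
    case 0 then show ?case by (simp add: s0)
  next
    case (Suc j)
    have "z + s (Suc j) * z = (z + s j * z) + 2 *\<^sub>R (p * (z + s j * z))"
      by (simp add: sS algebra_simps)
    then show ?case using Suc by (simp only: iso)
  qed
  have ns: "norm (s j) \<le> 2" for j
  proof -
    have "(norm (s j))\<^sup>2 = norm (s j * star (s j))"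
      using cstar_identity[of "star (s j)"] by (simp add: star_star norm_star)
    also have "\<dots> \<le> norm (star (s j) + s j * star (s j)) + norm (star (s j))"
      by (use norm_triangle_ineq4[of "star (s j) + s j * star (s j)" "star (s j)"] in simp)
    also have "\<dots> = 2 * norm (s j)" by (simp add: isos norm_star)
    finally show ?thesis by (cases "s j = 0") (auto simp: power2_eq_square)
  qed
  have tel: "2 *\<^sub>C (\<i> *\<^sub>C (\<Sum>j<k. h + h * s j)) = s k - \<i> *\<^sub>C (h * s k)" for k
  proof (induction k)
    case 0 show ?case by (simp add: s0)
  next
    case (Suc k)
    have pp: "p - \<i> *\<^sub>C (h * p) = \<i> *\<^sub>C h" using p by (metis add_diff_cancel_right')
    have "s (Suc k) - \<i> *\<^sub>C (h * s (Suc k)) = s k - \<i> *\<^sub>C (h * s k)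
        + 2 *\<^sub>R (p - \<i> *\<^sub>C (h * p)) + 2 *\<^sub>R ((p - \<i> *\<^sub>C (h * p)) * s k)"
      by (simp add: sS scaleR_2 scaleC_add_right mult_scaleC_left algebra_simps)
    also have "\<dots> = s k - \<i> *\<^sub>C (h * s k) + 2 *\<^sub>C (\<i> *\<^sub>C (h + h * s k))"
      unfolding pp using scaleC_of_real[of 2 "\<i> *\<^sub>C h"] scaleC_of_real[of 2 "\<i> *\<^sub>C (h * s k)"]
      by (simp add: mult_scaleC_left scaleC_add_right)
    finally show ?case using Suc by (simp add: scaleC_add_right)
  qed
  define e where "e = - ((1 / real (Suc m)) *\<^sub>R (\<Sum>j<Suc m. s j))"
  have "norm (\<Sum>j<Suc m. s j) \<le> (\<Sum>j<Suc m. 2)"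
    by (rule order.trans[OF norm_sum]) (intro sum_mono ns)
  then have "norm e \<le> 2" by (simp add: e_def field_simps del: sum.lessThan_Suc)
  moreover have "norm (h - h * e) \<le> 2 / real (Suc m)"
  proof -
    have sum_eq: "(\<Sum>j<Suc m. h + h * s j) = real (Suc m) *\<^sub>R (h - h * e)"
      unfolding sum.distrib e_def sum_distrib_left[symmetric] sum_constant_scaleR
      by (simp add: algebra_simps del: sum.lessThan_Suc of_nat_Suc)
    have "2 * norm (\<Sum>j<Suc m. h + h * s j) = norm (s (Suc m) - \<i> *\<^sub>C (h * s (Suc m)))"
      unfolding tel[symmetric] by (simp add: norm_scaleC)
    also have "\<dots> \<le> norm (s (Suc m)) + norm h * norm (s (Suc m))"
      using norm_triangle_ineq4[of "s (Suc m)" "\<i> *\<^sub>C (h * s (Suc m))"] norm_mult_ineq[of h "s (Suc m)"]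
      by (simp add: norm_scaleC)
    also have "\<dots> \<le> 2 + 1 * 2"
      by (intro add_mono mult_mono ns) (use n in auto)
    finally have "norm (\<Sum>j<Suc m. h + h * s j) \<le> 2" by simp
    then show ?thesis unfolding sum_eq
      by (simp add: pos_le_divide_eq mult.commute del: of_nat_Suc)
  qed
  ultimately show ?thesis by blast
qed

lemma tracial_state_positive_functional:
  assumes "tracial_state \<tau>"
  shows "positive_functional \<tau>"
proof -
  have "bounded_linear \<tau>" and sc: "\<forall>c a. \<tau> (c *\<^sub>C a) = c * \<tau> a"
    and pos: "\<forall>a\<in>A\<^sub>+. \<tau> a \<in> \<real> \<and> 0 \<le> Re (\<tau> a)"
    using assms unfolding tracial_state_def by blast+
  then have "linear \<tau>" by (simp add: bounded_linear.linear)
  moreover have "star x * x \<in> A\<^sub>+" for x :: 'a unfolding pos_elements_def by blast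
  ultimately show ?thesis
    using sc pos unfolding positive_functional_def by (simp add: linear_add)
qed

lemma tracial_state_norm_le:
  assumes "tracial_state \<tau>"
  shows "cmod (\<tau> a) \<le> norm a"
proof -
  have "bounded_linear \<tau>" "onorm \<tau> = 1" using assms unfolding tracial_state_def by blast+
  then show ?thesis using onorm[of \<tau> a] by simp
qed

text \<open>
  Compare \<open>\<tau>(h)\<close> with \<open>\<tau>(he)\<close> for an approximate unit e of h that is bounded by 2, and apply
  Cauchy-Schwarz to the latter. This gives the constant 4.
\<close>

lemma tracial_state_schwarz:
  assumes \<tau>: "tracial_state \<tau>"
  shows "schwarz_functional \<tau>"
proof -
  have pf: "positive_functional \<tau>" by (rule tracial_state_positive_functional[OF \<tau>])
  note bnd = tracial_state_norm_le[OF \<tau>]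
  have small: "(cmod (\<tau> h))\<^sup>2 \<le> 4 * Re (\<tau> (h * h))" if h: "star h = h" "norm h < 1" for h
  proof -
    define R where "R = sqrt (4 * Re (\<tau> (h * h)))"
    have hh: "0 \<le> Re (\<tau> (h * h))" using positive_functional_nonneg[OF pf, of h] h by simp
    have "cmod (\<tau> h) \<le> R + 2 / real (Suc m)" for m
    proof -
      obtain e where e: "norm e \<le> 2" "norm (h - h * e) \<le> 2 / real (Suc m)"
        using small_selfadjoint_approx_unit[OF h] by blast
      have "(cmod (\<tau> (h * e)))\<^sup>2 \<le> Re (\<tau> (h * h)) * Re (\<tau> (star e * e))"
        using functional_Cauchy_Schwarz[OF pf, of h e] h by simp
      also have "\<dots> \<le> Re (\<tau> (h * h)) * 4"
      proof (rule mult_left_mono[OF _ hh])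
        have "Re (\<tau> (star e * e)) \<le> norm (star e * e)"
          using bnd[of "star e * e"] complex_Re_le_cmod[of "\<tau> (star e * e)"] by linarith
        also have "\<dots> \<le> 4"
          using power_mono[OF e(1), of 2] by (simp add: cstar_identity)
        finally show "Re (\<tau> (star e * e)) \<le> 4" .
      qed
      finally have "cmod (\<tau> (h * e)) \<le> R" unfolding R_def
        by (intro real_le_rsqrt) simp
      moreover have "cmod (\<tau> (h - h * e)) \<le> 2 / real (Suc m)" using bnd e(2) order.trans by blast
      moreover have "\<tau> h = \<tau> (h * e) + \<tau> (h - h * e)"
        using positive_functional_add[OF pf, of "h * e" "h - h * e"] by simp
      ultimately show ?thesis using norm_triangle_ineq[of "\<tau> (h * e)" "\<tau> (h - h * e)"] by simp
    qed
    then have "cmod (\<tau> h) \<le> R + \<epsilon>" if "0 < \<epsilon>" for \<epsilon>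
    proof -
      obtain m where "2 / \<epsilon> < real m" using reals_Archimedean2 by blast
      then have "2 / real (Suc m) \<le> \<epsilon>" using that by (simp add: field_simps)
      with \<open>\<And>m. cmod (\<tau> h) \<le> R + 2 / real (Suc m)\<close>[of m] show ?thesis by linarith
    qed
    then have "cmod (\<tau> h) \<le> R" by (rule field_le_epsilon)
    then have "(cmod (\<tau> h))\<^sup>2 \<le> R\<^sup>2" by (intro power_mono) auto
    then show ?thesis using hh by (simp add: R_def)
  qed
  have "(cmod (\<tau> h))\<^sup>2 \<le> 4 * Re (\<tau> (h * h))" if h: "star h = h" for h
  proof -
    define c where "c = 1 / (norm h + 1)"
    have pos: "0 < norm h + 1" using norm_ge_zero[of h] by linarith
    then have c0: "c > 0" unfolding c_def by simp
    have "norm (of_real c *\<^sub>C h) = c * norm h"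
      using c0 unfolding norm_scaleC norm_of_real by simp
    then have "norm (of_real c *\<^sub>C h) < 1" using pos by (simp add: c_def)
    note c = c0 this
    have "(cmod (\<tau> (of_real c *\<^sub>C h)))\<^sup>2 \<le> 4 * Re (\<tau> ((of_real c *\<^sub>C h) * (of_real c *\<^sub>C h)))"
      by (rule small) (auto simp: star_scaleC h c)
    also have "\<tau> ((of_real c *\<^sub>C h) * (of_real c *\<^sub>C h)) = of_real (c\<^sup>2) * \<tau> (h * h)"
      by (simp add: positive_functional_scaleC[OF pf] mult_scaleC_left mult_scaleC_right
          power2_eq_square)
    also have "(cmod (\<tau> (of_real c *\<^sub>C h)))\<^sup>2 = c\<^sup>2 * (cmod (\<tau> h))\<^sup>2"
      by (simp add: positive_functional_scaleC[OF pf] norm_mult power_mult_distrib)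
    finally have "c\<^sup>2 * (cmod (\<tau> h))\<^sup>2 \<le> c\<^sup>2 * (4 * Re (\<tau> (h * h)))"
      by (simp add: mult.left_commute)
    then show ?thesis using c(1) by simp
  qed
  then have "0 \<le> (4::real) \<and> (\<forall>h. star h = h \<longrightarrow> (cmod (\<tau> h))\<^sup>2 \<le> 4 * Re (\<tau> (h * h)))"
    by simp
  then show ?thesis unfolding schwarz_functional_def using pf by blast
qed

section \<open>Hilbert modules and frames\<close>

locale hilbert_mod =
  fixes Y :: "('a::cstar_algebra, 'x::complex_vec) correspondence"
  assumes hm: "hilbert_module Y"
begin

abbreviation "C \<equiv> hcarrier Y"
abbreviation "ip \<equiv> hinner Y"
abbreviation "act \<equiv> ract Y"

lemma zero_mem: "0 \<in> C"
  and add_mem: "x \<in> C \<Longrightarrow> y \<in> C \<Longrightarrow> x + y \<in> C"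
  and scale_mem: "x \<in> C \<Longrightarrow> c *\<^sub>C x \<in> C"
  and act_mem: "x \<in> C \<Longrightarrow> act x a \<in> C"
  and act_add_l: "x \<in> C \<Longrightarrow> y \<in> C \<Longrightarrow> act (x + y) a = act x a + act y a"
  and act_add_r: "x \<in> C \<Longrightarrow> act x (a + b) = act x a + act x b"
  and act_act: "x \<in> C \<Longrightarrow> act (act x a) b = act x (a * b)"
  and act_scale_l: "x \<in> C \<Longrightarrow> act (c *\<^sub>C x) a = c *\<^sub>C act x a"
  and act_scale_r: "x \<in> C \<Longrightarrow> act x (c *\<^sub>C a) = c *\<^sub>C act x a"
  and ip_add_r: "x \<in> C \<Longrightarrow> y \<in> C \<Longrightarrow> z \<in> C \<Longrightarrow> ip x (y + z) = ip x y + ip x z"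
  and ip_scale_r: "x \<in> C \<Longrightarrow> y \<in> C \<Longrightarrow> ip x (c *\<^sub>C y) = c *\<^sub>C ip x y"
  and ip_act_r: "x \<in> C \<Longrightarrow> y \<in> C \<Longrightarrow> ip x (act y a) = ip x y * a"
  and star_ip: "x \<in> C \<Longrightarrow> y \<in> C \<Longrightarrow> star (ip x y) = ip y x"
  and ip_pos: "x \<in> C \<Longrightarrow> ip x x \<in> A\<^sub>+"
  and ip_definite: "x \<in> C \<Longrightarrow> ip x x = 0 \<Longrightarrow> x = 0"
  using hm unfolding hilbert_module_def Let_def by (elim conjE; simp)+

lemma minus_mem: "x \<in> C \<Longrightarrow> - x \<in> C"
  using scale_mem[of x "-1"] by (simp add: scaleC_minus_one)

lemma diff_mem: "x \<in> C \<Longrightarrow> y \<in> C \<Longrightarrow> x - y \<in> C"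
  using add_mem[of x "-y"] minus_mem by simp

lemma sum_list_mem: "(\<And>x. x \<in> set xs \<Longrightarrow> f x \<in> C) \<Longrightarrow> (\<Sum>x\<leftarrow>xs. f x) \<in> C"
  by (induction xs) (auto intro: zero_mem add_mem)

lemma ip_add_l: "x \<in> C \<Longrightarrow> y \<in> C \<Longrightarrow> z \<in> C \<Longrightarrow> ip (x + y) z = ip x z + ip y z"
  using star_ip[of z "x + y"] add_mem by (simp add: ip_add_r star_add star_ip)

lemma ip_scale_l: "x \<in> C \<Longrightarrow> y \<in> C \<Longrightarrow> ip (c *\<^sub>C x) y = cnj c *\<^sub>C ip x y"
  using star_ip[of y "c *\<^sub>C x"] scale_mem by (simp add: ip_scale_r star_scaleC star_ip)

lemma ip_act_l: "x \<in> C \<Longrightarrow> y \<in> C \<Longrightarrow> ip (act x a) y = star a * ip x y"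
  using star_ip[of y "act x a"] act_mem by (simp add: ip_act_r star_mult star_ip)

lemma ip_minus_r: "x \<in> C \<Longrightarrow> y \<in> C \<Longrightarrow> ip x (- y) = - ip x y"
  using ip_scale_r[of x y "-1"] by (simp add: scaleC_minus_one)

lemma ip_minus_l: "x \<in> C \<Longrightarrow> y \<in> C \<Longrightarrow> ip (- x) y = - ip x y"
  using ip_scale_l[of x y "-1"] by (simp add: scaleC_minus_one)

lemma ip_diff_r: "x \<in> C \<Longrightarrow> y \<in> C \<Longrightarrow> z \<in> C \<Longrightarrow> ip x (y - z) = ip x y - ip x z"
  using ip_add_r[of x y "-z"] minus_mem by (simp add: ip_minus_r)

lemma ip_diff_l: "x \<in> C \<Longrightarrow> y \<in> C \<Longrightarrow> z \<in> C \<Longrightarrow> ip (x - y) z = ip x z - ip y z"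
  using ip_add_l[of x "-y" z] minus_mem by (simp add: ip_minus_l)

lemma ip_zero_r: "x \<in> C \<Longrightarrow> ip x 0 = 0"
  using ip_scale_r[of x 0 0] by (simp add: zero_mem)

lemma ip_zero_l: "x \<in> C \<Longrightarrow> ip 0 x = 0"
  using ip_scale_l[of 0 x 0] by (simp add: zero_mem)

lemma ip_sum_list_r:
  "x \<in> C \<Longrightarrow> (\<And>y. y \<in> set ys \<Longrightarrow> f y \<in> C) \<Longrightarrow> ip x (\<Sum>y\<leftarrow>ys. f y) = (\<Sum>y\<leftarrow>ys. ip x (f y))"
  by (induction ys) (auto simp: ip_zero_r ip_add_r sum_list_mem)

lemma ip_sum_list_l:
  "x \<in> C \<Longrightarrow> (\<And>y. y \<in> set ys \<Longrightarrow> f y \<in> C) \<Longrightarrow> ip (\<Sum>y\<leftarrow>ys. f y) x = (\<Sum>y\<leftarrow>ys. ip (f y) x)"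
  by (induction ys) (auto simp: ip_zero_l ip_add_l sum_list_mem)

lemma act_diff_r: "x \<in> C \<Longrightarrow> act x (a - b) = act x a - act x b"
  using act_add_r[of x a "-b"] act_scale_r[of x "-1" b] by (simp add: scaleC_minus_one)

lemma vec_eqI:
  assumes "x \<in> C" "y \<in> C" "\<And>w. w \<in> C \<Longrightarrow> ip w x = ip w y"
  shows "x = y"
proof -
  have "ip (x - y) (x - y) = 0"
    using assms diff_mem by (simp add: ip_diff_r)
  then show ?thesis using ip_definite diff_mem assms by force
qed

lemma adjoint_mem: "is_adjoint Y T S \<Longrightarrow> x \<in> C \<Longrightarrow> T x \<in> C"
  and adjoint_ip: "is_adjoint Y T S \<Longrightarrow> x \<in> C \<Longrightarrow> y \<in> C \<Longrightarrow> ip (T x) y = ip x (S y)"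
  unfolding is_adjoint_def by auto

lemma adjoint_sym: "is_adjoint Y T S \<Longrightarrow> is_adjoint Y S T"
  unfolding is_adjoint_def
proof (elim conjE, intro conjI ballI)
  fix x y
  assume T: "T \<in> C \<rightarrow> C" and S: "S \<in> C \<rightarrow> C"
    and *: "\<forall>x\<in>C. \<forall>y\<in>C. ip (T x) y = ip x (S y)" and xy: "x \<in> C" "y \<in> C"
  have m: "S x \<in> C" "T y \<in> C" using T S xy by auto
  have "ip (S x) y = star (ip y (S x))" using star_ip m xy by simp
  also have "\<dots> = star (ip (T y) x)" using * xy by simp
  also have "\<dots> = ip x (T y)" using star_ip m xy by simp
  finally show "ip (S x) y = ip x (T y)" .
qed

lemma adjoint_mem': "is_adjoint Y T S \<Longrightarrow> x \<in> C \<Longrightarrow> S x \<in> C"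
  using adjoint_sym adjoint_mem by blast

lemma adjoint_ip': "is_adjoint Y T S \<Longrightarrow> x \<in> C \<Longrightarrow> y \<in> C \<Longrightarrow> ip x (T y) = ip (S x) y"
  using adjoint_sym adjoint_ip by metis

lemma adjoint_add: "is_adjoint Y T S \<Longrightarrow> x \<in> C \<Longrightarrow> y \<in> C \<Longrightarrow> T (x + y) = T x + T y"
  by (rule vec_eqI) (auto simp: adjoint_ip' ip_add_r adjoint_mem adjoint_mem' add_mem)

lemma adjoint_act: "is_adjoint Y T S \<Longrightarrow> x \<in> C \<Longrightarrow> T (act x a) = act (T x) a"
  by (rule vec_eqI) (auto simp: adjoint_ip' ip_act_r adjoint_mem adjoint_mem' act_mem)

lemma adjoint_zero: "is_adjoint Y T S \<Longrightarrow> T 0 = 0"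
  by (rule vec_eqI) (auto simp: adjoint_ip' ip_zero_r adjoint_mem adjoint_mem' zero_mem)

lemma adjoint_diff: "is_adjoint Y T S \<Longrightarrow> x \<in> C \<Longrightarrow> y \<in> C \<Longrightarrow> T (x - y) = T x - T y"
  by (rule vec_eqI) (auto simp: adjoint_ip' ip_diff_r adjoint_mem adjoint_mem' diff_mem)

lemma adjoint_scale: "is_adjoint Y T S \<Longrightarrow> x \<in> C \<Longrightarrow> T (c *\<^sub>C x) = c *\<^sub>C T x"
  by (rule vec_eqI) (auto simp: adjoint_ip' ip_scale_r adjoint_mem adjoint_mem' scale_mem)

lemma adjoint_sum_list:
  "is_adjoint Y T S \<Longrightarrow> (\<And>y. y \<in> set ys \<Longrightarrow> f y \<in> C) \<Longrightarrow> T (\<Sum>y\<leftarrow>ys. f y) = (\<Sum>y\<leftarrow>ys. T (f y))"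
  by (induction ys) (auto simp: adjoint_zero adjoint_add sum_list_mem)

lemma adjoint_comp:
  "is_adjoint Y T S \<Longrightarrow> is_adjoint Y T' S' \<Longrightarrow> is_adjoint Y (T \<circ> T') (S' \<circ> S)"
  unfolding is_adjoint_def by (auto simp: Pi_iff)

end

text \<open>
  The square of the seminorm that \<open>\<sigma>\<close> induces on the module.
\<close>

definition sq_norm ::
  "('a::cstar_algebra \<Rightarrow> complex) \<Rightarrow> ('a, 'x::complex_vec) correspondence \<Rightarrow> 'x \<Rightarrow> real" where
  "sq_norm \<sigma> Y x = Re (\<sigma> (hinner Y x x))"

text \<open>
  The finite sets H in the definition of the induced trace, together with an operator S that witnesses
  \<open>\<Sum>\<theta>\<^sub>\<eta>\<^sub>,\<^sub>\<eta> \<le> 1\<close>. Lists are used because frames are composed by concatenation, where vectors may repeat.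
\<close>

definition frame ::
  "('a::cstar_algebra, 'x::complex_vec) correspondence \<Rightarrow> 'x list \<Rightarrow> ('x \<Rightarrow> 'x) \<Rightarrow> ('x \<Rightarrow> 'x) \<Rightarrow> bool"
  where
  "frame Y H S S' \<longleftrightarrow> set H \<subseteq> hcarrier Y \<and> is_adjoint Y S S' \<and>
     (\<forall>x\<in>hcarrier Y. S' (S x) = x - (\<Sum>\<eta>\<leftarrow>H. \<theta> Y \<eta> \<eta> x))"

definition submodule ::
  "('a::cstar_algebra, 'x::complex_vec) correspondence \<Rightarrow> 'x set \<Rightarrow> bool" where
  "submodule Y D \<longleftrightarrow> D \<subseteq> hcarrier Y \<and> (\<forall>x\<in>D. \<forall>y\<in>D. x + y \<in> D) \<and>
     (\<forall>x\<in>D. \<forall>c. c *\<^sub>C x \<in> D) \<and> (\<forall>x\<in>D. \<forall>a. ract Y x a \<in> D)"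

context hilbert_mod
begin

lemma sq_norm_nonneg: "positive_functional \<sigma> \<Longrightarrow> x \<in> C \<Longrightarrow> 0 \<le> sq_norm \<sigma> Y x"
  using ip_pos[of x] unfolding sq_norm_def pos_elements_def
  by (auto simp: positive_functional_nonneg)

lemma ip_Reals: "positive_functional \<sigma> \<Longrightarrow> x \<in> C \<Longrightarrow> \<sigma> (ip x x) \<in> \<real>"
  using ip_pos[of x] unfolding pos_elements_def
  by (auto simp: positive_functional_Reals)

lemma frame_coeff_nonneg:
  "positive_functional \<sigma> \<Longrightarrow> x \<in> C \<Longrightarrow> \<eta> \<in> C \<Longrightarrow> 0 \<le> Re (\<sigma> (ip x \<eta> * ip \<eta> x))"
  using positive_functional_nonneg[of \<sigma> "ip \<eta> x"] by (simp add: star_ip)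

lemma sq_norm_add_le:
  assumes "positive_functional \<sigma>" "x \<in> C" "y \<in> C"
  shows "sq_norm \<sigma> Y (x + y) \<le> 2 * sq_norm \<sigma> Y x + 2 * sq_norm \<sigma> Y y"
proof -
  have "sq_norm \<sigma> Y (x + y) + sq_norm \<sigma> Y (x - y) = 2 * sq_norm \<sigma> Y x + 2 * sq_norm \<sigma> Y y"
    using assms unfolding sq_norm_def
    by (simp add: ip_add_l ip_add_r ip_diff_l ip_diff_r add_mem diff_mem
        positive_functional_add positive_functional_diff)
  moreover have "0 \<le> sq_norm \<sigma> Y (x - y)" using assms by (intro sq_norm_nonneg diff_mem)
  ultimately show ?thesis by linarith
qed

lemma frame_mem: "frame Y H S S' \<Longrightarrow> \<eta> \<in> set H \<Longrightarrow> \<eta> \<in> C"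
  and frame_adjoint: "frame Y H S S' \<Longrightarrow> is_adjoint Y S S'"
  unfolding frame_def by auto

lemma frame_ip:
  assumes "frame Y H S S'" "x \<in> C" "y \<in> C"
  shows "ip (S x) (S y) = ip x y - (\<Sum>\<eta>\<leftarrow>H. ip x \<eta> * ip \<eta> y)"
proof -
  have H: "\<And>\<eta>. \<eta> \<in> set H \<Longrightarrow> \<eta> \<in> C" and a: "is_adjoint Y S S'"
    using assms(1) unfolding frame_def by auto
  have m: "(\<Sum>\<eta>\<leftarrow>H. act \<eta> (ip \<eta> y)) \<in> C" using H by (intro sum_list_mem act_mem)
  have "ip (S x) (S y) = ip x (S' (S y))"
    using a assms adjoint_ip adjoint_mem by blast
  also have "S' (S y) = y - (\<Sum>\<eta>\<leftarrow>H. act \<eta> (ip \<eta> y))"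
    using assms unfolding frame_def rank_one_def by auto
  also have "ip x \<dots> = ip x y - (\<Sum>\<eta>\<leftarrow>H. ip x (act \<eta> (ip \<eta> y)))"
    using assms H m by (simp add: ip_diff_r ip_sum_list_r act_mem)
  also have "(\<Sum>\<eta>\<leftarrow>H. ip x (act \<eta> (ip \<eta> y))) = (\<Sum>\<eta>\<leftarrow>H. ip x \<eta> * ip \<eta> y)"
    using assms H by (intro arg_cong[where f = sum_list] map_cong) (auto simp: ip_act_r)
  finally show ?thesis .
qed

lemma Re_sum_list: "Re (\<Sum>x\<leftarrow>xs. f x) = (\<Sum>x\<leftarrow>xs. Re (f x))"
  by (induction xs) auto

text \<open>
  S measures how far the frame is from resolving the vector x.
\<close>

lemma frame_sq_norm:
  assumes "frame Y H S S'" "x \<in> C" "positive_functional \<sigma>"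
  shows "sq_norm \<sigma> Y (S x) = sq_norm \<sigma> Y x - (\<Sum>\<eta>\<leftarrow>H. Re (\<sigma> (ip x \<eta> * ip \<eta> x)))"
  unfolding sq_norm_def frame_ip[OF assms(1,2,2)]
  using assms(3) by (simp add: positive_functional_diff positive_functional_sum_list Re_sum_list)

lemma frame_coeff_sum_nonneg:
  assumes "positive_functional \<sigma>" "set H \<subseteq> C" "x \<in> C"
  shows "0 \<le> (\<Sum>\<eta>\<leftarrow>H. Re (\<sigma> (ip x \<eta> * ip \<eta> x)))"
  using assms by (intro sum_list_nonneg) (auto intro!: frame_coeff_nonneg)

lemma frame_contraction:
  assumes "frame Y H S S'" "x \<in> C" "positive_functional \<sigma>"
  shows "sq_norm \<sigma> Y (S x) \<le> sq_norm \<sigma> Y x"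
  using frame_sq_norm[OF assms] frame_coeff_sum_nonneg[of \<sigma> H x] assms
  by (auto simp: frame_def)

lemma frame_bessel:
  assumes "frame Y H S S'" "x \<in> C" "positive_functional \<sigma>"
  shows "(\<Sum>\<eta>\<leftarrow>H. Re (\<sigma> (ip x \<eta> * ip \<eta> x))) \<le> sq_norm \<sigma> Y x"
  using frame_sq_norm[OF assms] sq_norm_nonneg[of \<sigma> "S x"] adjoint_mem frame_adjoint assms by force

lemma frame_id: "frame Y [] id id"
  unfolding frame_def is_adjoint_def by auto

text \<open>
  (S2 S1)* (S2 S1) = S1* (1 - \<open>\<Sum>\<theta>\<^sub>\<eta>\<^sub>,\<^sub>\<eta>\<close>) S1, with \<open>\<eta>\<close> running through H2. This is what allows vectors to be
  treated one after the other: S2 does not undo the smallness achieved by S1.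
\<close>

lemma frame_comp:
  assumes 1: "frame Y H1 S1 S1'" and 2: "frame Y H2 S2 S2'"
  shows "frame Y (H1 @ map S1' H2) (S2 \<circ> S1) (S1' \<circ> S2')"
  unfolding frame_def
proof (intro conjI ballI)
  note a1 = frame_adjoint[OF 1] and a2 = frame_adjoint[OF 2]
  have H1: "\<And>\<eta>. \<eta> \<in> set H1 \<Longrightarrow> \<eta> \<in> C" and H2: "\<And>\<eta>. \<eta> \<in> set H2 \<Longrightarrow> \<eta> \<in> C"
    using frame_mem 1 2 by auto
  show "set (H1 @ map S1' H2) \<subseteq> C" using H1 H2 adjoint_mem'[OF a1] by auto
  show "is_adjoint Y (S2 \<circ> S1) (S1' \<circ> S2')" using adjoint_comp a1 a2 by blast
  fix x assume x: "x \<in> C"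
  have S1x: "S1 x \<in> C" using a1 x adjoint_mem by blast
  have a1': "is_adjoint Y S1' S1" using a1 adjoint_sym by blast
  have "(S1' \<circ> S2') ((S2 \<circ> S1) x) = S1' (S1 x - (\<Sum>\<eta>\<leftarrow>H2. act \<eta> (ip \<eta> (S1 x))))"
    using 2 S1x unfolding frame_def rank_one_def by auto
  also have "\<dots> = S1' (S1 x) - (\<Sum>\<eta>\<leftarrow>H2. S1' (act \<eta> (ip \<eta> (S1 x))))"
    using a1' S1x H2 by (simp add: adjoint_diff adjoint_sum_list sum_list_mem act_mem)
  also have "(\<Sum>\<eta>\<leftarrow>H2. S1' (act \<eta> (ip \<eta> (S1 x)))) = (\<Sum>\<eta>\<leftarrow>H2. act (S1' \<eta>) (ip (S1' \<eta>) x))"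
    using a1' H2 x by (intro arg_cong[where f = sum_list] map_cong)
      (auto simp: adjoint_act adjoint_ip)
  also have "S1' (S1 x) = x - (\<Sum>\<eta>\<leftarrow>H1. act \<eta> (ip \<eta> x))"
    using 1 x unfolding frame_def rank_one_def by auto
  finally show "(S1' \<circ> S2') ((S2 \<circ> S1) x) = x - (\<Sum>\<eta>\<leftarrow>H1 @ map S1' H2. \<theta> Y \<eta> \<eta> x)"
    by (simp add: rank_one_def comp_def algebra_simps)
qed

text \<open>
  Put \<open>T = \<theta>\<^sub>z\<^sub>,\<^sub>z\<close>, \<open>h = \<langle>z, z\<rangle>\<close> and S = (1 - T)(1 + T)^{-1}. Then 1 - \<open>S\<^sup>2\<close> = 4T(1 + T)^{-2} = \<open>\<theta>\<^sub>e\<^sub>,\<^sub>e\<close>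
  for e = 2z(1 + h)^{-1}. The vector v = z(1 + h) is chosen to cancel the factor (1 + h)^{-1} of e, so
  that the coefficients of the orbit of v with respect to e are twice those of the orbit of z with
  respect to z.
\<close>

lemma cayley_frame:
  assumes D: "submodule Y D" and z: "z \<in> D" and small: "norm (ip z z) < 1"
  obtains S e v where "frame Y [e] S S" "e \<in> D" "S ` D \<subseteq> D" "v \<in> C"
    "\<And>k. ip e ((S ^^ k) v) = ip z ((S ^^ k) z) + ip z ((S ^^ k) z)"
proof -
  have DC: "D \<subseteq> C" and Dadd: "\<And>x y. x \<in> D \<Longrightarrow> y \<in> D \<Longrightarrow> x + y \<in> D"
    and Dsc: "\<And>c x. x \<in> D \<Longrightarrow> c *\<^sub>C x \<in> D" and Dact: "\<And>x a. x \<in> D \<Longrightarrow> act x a \<in> D"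
    using D unfolding submodule_def by auto
  have Ddiff: "x - y \<in> D" if "x \<in> D" "y \<in> D" for x y
    using Dadd[OF that(1) Dsc[OF that(2), of "-1"]] by (simp add: scaleC_minus_one)
  have zC: "z \<in> C" using z DC by auto
  define h where "h = ip z z"
  have hs: "star h = h" unfolding h_def using zC star_ip by blast
  have nh: "norm (-h) < 1" using small by (simp add: h_def)
  \<comment> \<open>q is h(1 + h)^{-1}, so that (1 + h)^{-1} is 1 - q in the unitization.\<close>
  obtain q where q: "q = h + (-h) * q" and qu: "\<And>y. y = h + (-h) * y \<Longrightarrow> y = q"
    using affine_fixpoint[OF nh, of h] by metis
  \<comment> \<open>An auxiliary equation solved by both qh and hq: its only solution shows that they agree.\<close>
  obtain q2 where q2u: "\<And>y. y = h * h + (-h) * y \<Longrightarrow> y = q2"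
    using affine_fixpoint[OF nh, of "h * h"] by metis
  have hq: "h * q = h - q" using q by (simp add: algebra_simps)
  have "h * q = h * h + (-h) * (h * q)"
    by (subst q) (simp add: algebra_simps)
  moreover have "q * h = h * h + (-h) * (q * h)"
    by (subst q) (simp add: algebra_simps)
  ultimately have qh: "q * h = h * q" using q2u by metis
  have qs: "star q = q"
  proof (rule qu)
    have "star q = h - star q * h"
      using arg_cong[OF hq, of star] by (simp add: star_mult star_diff hs)
    moreover have "star q * h = h * star q"
      using arg_cong[OF qh, of star] by (simp add: star_mult hs)
    ultimately show "star q = h + - h * star q" by simp
  qed
  define w where "w = (\<lambda>x. ip z x - q * ip z x)"
  define S where "S = (\<lambda>x. x - act z (w x + w x))"
  define e where "e = z + z - act z (q + q)"
  have eD: "e \<in> D" unfolding e_def using z by (intro Ddiff Dadd Dact)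
  then have eC: "e \<in> C" using DC by auto
  have SD: "S ` D \<subseteq> D" unfolding S_def using Ddiff Dact z by auto
  have SC: "S x \<in> C" if "x \<in> C" for x
    unfolding S_def using that zC by (intro diff_mem act_mem)
  have w_apply: "w x = ip z x - q * ip z x" for x by (simp add: w_def)
  have S_apply: "S x = x - act z (w x + w x)" for x by (simp add: S_def)
  have wS: "w (S x) = w x - (q * w x + q * w x)" if "x \<in> C" for x
  proof -
    have "w (S x) = w x - (h * (w x + w x) - q * (h * (w x + w x)))"
    proof -
      have "ip z (S x) = ip z x - h * (w x + w x)"
        unfolding S_apply using that zC by (simp add: ip_diff_r act_mem ip_act_r h_def)
      moreover have "a - b - q * (a - b) = a - q * a - (b - q * b)" for a b
        by (simp add: algebra_simps)
      ultimately show ?thesis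
        using w_apply[of "S x"] w_apply[of x] by simp
    qed
    also have "h * (w x + w x) - q * (h * (w x + w x)) = (h - q * h) * (w x + w x)"
      by (simp add: algebra_simps)
    also have "h - q * h = q" using hq qh by simp
    finally show ?thesis by (simp add: algebra_simps)
  qed
  have "is_adjoint Y S S"
    unfolding is_adjoint_def
  proof (intro conjI ballI funcsetI SC)
    fix x y assume xy: "x \<in> C" "y \<in> C"
    have "star (w x) * ip z y = ip x z * w y"
      using xy zC by (simp add: w_def star_diff star_mult star_ip qs algebra_simps)
    then have "star (w x + w x) * ip z y = ip x z * (w y + w y)"
      by (simp add: star_add algebra_simps)
    then show "ip (S x) y = ip x (S y)"
      using xy zC unfolding S_def by (simp add: ip_diff_l ip_diff_r act_mem ip_act_l ip_act_r)
  qed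
  moreover have "S (S x) = x - act e (ip e x)" if x: "x \<in> C" for x
  proof -
    have "ip e x = w x + w x"
      using x zC unfolding e_def w_def
      by (simp add: ip_diff_l ip_add_l add_mem act_mem ip_act_l star_add qs algebra_simps)
    moreover have "act e a = act z (a + a - (q * a + q * a))" for a
    proof -
      have "act e a = act (z + z) a - act (act z (q + q)) a"
      proof -
        have "act (e + act z (q + q)) a = act e a + act (act z (q + q)) a"
          using eC zC by (simp add: act_add_l act_mem)
        moreover have "e + act z (q + q) = z + z" by (simp add: e_def)
        ultimately show ?thesis by simp
      qed
      then show ?thesis using zC
        by (simp add: act_add_l act_mem act_act act_diff_r act_add_r algebra_simps)
    qed
    moreover have "S (S x) = x - act z ((w x + w x) + (w (S x) + w (S x)))"
      unfolding S_apply[of "S x"] using S_apply[of x] x zC by (simp add: act_add_r algebra_simps)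
    ultimately show ?thesis
      using wS[OF x] by (simp add: algebra_simps)
  qed
  ultimately have fr: "frame Y [e] S S"
    unfolding frame_def rank_one_def using eC by simp
  note aS = frame_adjoint[OF fr]
  define v where "v = z + act z h"
  have vC: "v \<in> C" unfolding v_def using zC by (intro add_mem act_mem)
  have SkC: "(S ^^ k) x \<in> C" if "x \<in> C" for x k
    by (induction k) (use that SC in auto)
  \<comment> \<open>The orbit of z stays in zA, and 1 + x is the k-th power of 1 - 2q = (1 - h)(1 + h)^{-1}.\<close>
  have Skz: "\<exists>x. (S ^^ k) z = z + act z x \<and> q * x = x * q \<and> h * x = x * h" for k
  proof (induction k)
    case 0
    have "act z 0 = 0" using act_scale_r[OF zC, of 0 0] by simp
    then show ?case by (intro exI[of _ 0]) simp
  next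
    case (Suc k)
    then obtain x where x: "(S ^^ k) z = z + act z x" "q * x = x * q" "h * x = x * h" by blast
    define x' where "x' = x - (q + q * x + (q + q * x))"
    have "w (z + act z x) = (h - q * h) + (h - q * h) * x"
      using zC unfolding w_def by (simp add: ip_add_r act_mem ip_act_r h_def[symmetric] algebra_simps)
    also have "h - q * h = q" using hq qh by simp
    finally have ws: "w (z + act z x) = q + q * x" .
    have "(S ^^ Suc k) z = S (z + act z x)" by (simp add: x(1))
    also have "\<dots> = z + act z x'"
      unfolding S_apply ws using zC by (simp add: x'_def act_diff_r act_add_r)
    finally have "(S ^^ Suc k) z = z + act z x'" .
    moreover have "q * x' = x' * q"
    proof -
      have "q * (q * x) = (q * x) * q" using x(2) by (metis mult.assoc)
      then show ?thesis unfolding x'_def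
        by (simp only: right_diff_distrib left_diff_distrib distrib_left distrib_right)
          (simp only: x(2))
    qed
    moreover have "h * x' = x' * h"
    proof -
      have "h * (q * x) = (h * q) * x" by (simp only: mult.assoc)
      also have "\<dots> = q * (h * x)" by (simp only: qh[symmetric] mult.assoc)
      also have "\<dots> = (q * x) * h" by (simp only: x(3) mult.assoc)
      finally show ?thesis unfolding x'_def
        by (simp only: right_diff_distrib left_diff_distrib distrib_left distrib_right)
          (simp only: x(3) qh)
    qed
    ultimately show ?case by blast
  qed
  have "ip e ((S ^^ k) v) = ip z ((S ^^ k) z) + ip z ((S ^^ k) z)" for k
  proof -
    define d where "d = ip z ((S ^^ k) z)"
    obtain x where x: "(S ^^ k) z = z + act z x" "q * x = x * q" "h * x = x * h"
      using Skz by blast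
    have d: "d = h + h * x" unfolding d_def x(1)
      using zC by (simp add: ip_add_r act_mem ip_act_r h_def)
    have qd: "q * d = d * q"
    proof -
      have "q * (h * x) = (q * h) * x" by (simp only: mult.assoc)
      also have "\<dots> = h * (q * x)" by (simp only: qh mult.assoc)
      also have "\<dots> = (h * x) * q" by (simp only: x(2) mult.assoc)
      finally show ?thesis unfolding d by (simp only: distrib_left distrib_right qh)
    qed
    have "(S ^^ k) v = (S ^^ k) z + act ((S ^^ k) z) h"
    proof (induction k)
      case (Suc k)
      then show ?case using SkC[OF zC] aS by (simp add: adjoint_add adjoint_act act_mem)
    qed (simp add: v_def)
    then have "ip z ((S ^^ k) v) = d + d * h"
      using zC SkC[OF zC] by (simp add: ip_add_r act_mem ip_act_r d_def)
    moreover have "ip e u = (ip z u - q * ip z u) + (ip z u - q * ip z u)" if "u \<in> C" for u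
      using that zC unfolding e_def
      by (simp add: ip_diff_l ip_add_l add_mem act_mem ip_act_l star_add qs algebra_simps)
    moreover have "d + d * h - q * (d + d * h) = d"
    proof -
      have "d + d * h - q * (d + d * h) = d + d * (h - q - q * h)"
      proof -
        have "q * (d * h) = (q * d) * h" by (simp only: mult.assoc)
        also have "\<dots> = d * (q * h)" by (simp only: qd mult.assoc)
        finally show ?thesis
          by (simp only: distrib_left right_diff_distrib qd) (simp add: algebra_simps)
      qed
      also have "h - q - q * h = 0" using hq qh by simp
      finally show ?thesis by simp
    qed
    ultimately show ?thesis using SkC[OF vC] by (simp add: d_def)
  qed
  then show ?thesis using that fr eD SD vC by blast
qed

text \<open>
  The powers of S again come from frames. Let \<open>d k = \<langle>z, S^k z\<rangle>\<close>. What S^k v loses in each step is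
  \<open>4 \<sigma>(d k* d k)\<close>, and the total loss is bounded, so \<open>\<sigma>(d k* d k)\<close> becomes small for some even k = 2j. As
  \<open>d (2j) = \<langle>S^j z, S^j z\<rangle>\<close> is self-adjoint, the Schwarz estimate makes \<open>\<sigma>\<langle>S^j z, S^j z\<rangle>\<close> small as well.
\<close>

lemma frame_small_on_short_vector:
  assumes D: "submodule Y D" and z: "z \<in> D" and small: "norm (ip z z) < 1"
    and \<sigma>: "schwarz_functional \<sigma>" and \<epsilon>: "0 < \<epsilon>"
  shows "\<exists>H S. frame Y H S S \<and> set H \<subseteq> D \<and> S ` D \<subseteq> D \<and> sq_norm \<sigma> Y (S z) < \<epsilon>"
proof -
  have DC: "D \<subseteq> C" using D unfolding submodule_def by auto
  obtain S e v where fr: "frame Y [e] S S" and eD: "e \<in> D" and SD: "S ` D \<subseteq> D" and v: "v \<in> C"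
    and ev: "\<And>k. ip e ((S ^^ k) v) = ip z ((S ^^ k) z) + ip z ((S ^^ k) z)"
    using cayley_frame[OF D z small] by metis
  note aS = frame_adjoint[OF fr]
  have pf: "positive_functional \<sigma>" using \<sigma> unfolding schwarz_functional_def by blast
  obtain K where K: "0 \<le> K" "\<And>h. star h = h \<Longrightarrow> (cmod (\<sigma> h))\<^sup>2 \<le> K * Re (\<sigma> (h * h))"
    using \<sigma> unfolding schwarz_functional_def by blast
  have SkD: "(S ^^ k) ` D \<subseteq> D" for k
    by (induction k) (use SD in \<open>auto simp: image_subset_iff\<close>)
  have pow: "\<exists>H. frame Y H (S ^^ k) (S ^^ k) \<and> set H \<subseteq> D" for k
  proof (induction k)
    case 0 then show ?case using frame_id by (intro exI[of _ "[]"]) (simp add: id_def)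
  next
    case (Suc k)
    then obtain H where H: "frame Y H (S ^^ k) (S ^^ k)" "set H \<subseteq> D" by blast
    have "frame Y (H @ map (S ^^ k) [e]) (S \<circ> S ^^ k) (S ^^ k \<circ> S)"
      using frame_comp[OF H(1) fr] .
    moreover have "S ^^ k \<circ> S = S ^^ Suc k" by (simp only: funpow_Suc_right)
    moreover have "set (H @ map (S ^^ k) [e]) \<subseteq> D" using H(2) eD SkD by auto
    ultimately show ?case by (metis funpow.simps(2))
  qed
  have zC: "z \<in> C" and eC: "e \<in> C" using z eD DC by auto
  have SkC: "(S ^^ k) x \<in> C" if "x \<in> C" for x k
    by (induction k) (use that adjoint_mem[OF aS] in auto)
  define d where "d = (\<lambda>k. ip z ((S ^^ k) z))"
  define f where "f = (\<lambda>k. Re (\<sigma> (ip ((S ^^ k) v) e * ip e ((S ^^ k) v))))"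
  have f0: "0 \<le> f k" for k unfolding f_def using frame_coeff_nonneg[OF pf SkC[OF v] eC] .
  have tel: "(\<Sum>k<n. f k) = sq_norm \<sigma> Y v - sq_norm \<sigma> Y ((S ^^ n) v)" for n
  proof (induction n)
    case (Suc n)
    then show ?case using frame_sq_norm[OF fr SkC[OF v] pf, of n] by (simp add: f_def)
  qed simp
  have sumf: "(\<Sum>k<n. f k) \<le> sq_norm \<sigma> Y v" for n
    unfolding tel using sq_norm_nonneg[OF pf SkC[OF v]] by simp
  have dsa: "ip ((S ^^ j) z) ((S ^^ j) z) = d (j + j)" for j
  proof -
    have "ip ((S ^^ j) x) y = ip x ((S ^^ j) y)" if "x \<in> C" "y \<in> C" for x y
      using that
    proof (induction j arbitrary: x y)
      case (Suc j)
      have "ip ((S ^^ Suc j) x) y = ip ((S ^^ j) x) (S y)"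
        using Suc.prems SkC adjoint_ip[OF aS] by simp
      also have "\<dots> = ip x ((S ^^ j) (S y))"
        using Suc adjoint_mem[OF aS] by simp
      finally show ?case by (simp add: funpow_swap1)
    qed simp
    then show ?thesis unfolding d_def using zC SkC by (simp add: funpow_add)
  qed
  have "\<exists>j. sq_norm \<sigma> Y ((S ^^ j) z) < \<epsilon>"
  proof (rule ccontr)
    assume "\<not> ?thesis"
    then have big: "\<epsilon> \<le> sq_norm \<sigma> Y ((S ^^ j) z)" for j by (simp add: not_less)
    have fj: "\<epsilon>\<^sup>2 \<le> (K + 1) * f (j + j)" for j
    proof -
      have s: "star (d (j + j)) = d (j + j)"
        unfolding dsa[symmetric] using star_ip SkC[OF zC] by blast
      have "\<epsilon> \<le> cmod (\<sigma> (d (j + j)))"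
        using big[of j] complex_Re_le_cmod[of "\<sigma> (d (j + j))"]
        unfolding sq_norm_def dsa by linarith
      then have "\<epsilon>\<^sup>2 \<le> (cmod (\<sigma> (d (j + j))))\<^sup>2" using \<epsilon> by (intro power_mono) auto
      also have "\<dots> \<le> K * Re (\<sigma> (d (j + j) * d (j + j)))" using K(2)[OF s] .
      also have "\<dots> \<le> (K + 1) * f (j + j)"
      proof (intro mult_mono)
        have "ip e ((S ^^ (j + j)) v) = d (j + j) + d (j + j)" using ev by (simp add: d_def)
        moreover have "ip ((S ^^ (j + j)) v) e = star (ip e ((S ^^ (j + j)) v))"
          using star_ip[OF eC SkC[OF v]] by simp
        ultimately have "f (j + j) = 4 * Re (\<sigma> (d (j + j) * d (j + j)))"
          unfolding f_def using s by (simp add: star_add algebra_simps positive_functional_add[OF pf])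
        moreover have "0 \<le> Re (\<sigma> (d (j + j) * d (j + j)))"
          using positive_functional_nonneg[OF pf, of "d (j + j)"] s by simp
        ultimately show "Re (\<sigma> (d (j + j) * d (j + j))) \<le> f (j + j)"
          "0 \<le> Re (\<sigma> (d (j + j) * d (j + j)))" by simp_all
      qed (use K in auto)
      finally show ?thesis .
    qed
    have "real n * \<epsilon>\<^sup>2 \<le> (K + 1) * sq_norm \<sigma> Y v" for n
    proof -
      have "(\<Sum>j<n. f (j + j)) \<le> (\<Sum>k<n + n. f k)"
      proof (induction n)
        case (Suc n)
        then show ?case using f0[of "Suc (n + n)"] by simp
      qed simp
      then have "(K + 1) * (\<Sum>j<n. f (j + j)) \<le> (K + 1) * sq_norm \<sigma> Y v"
        using sumf[of "n + n"] K(1) by (intro mult_left_mono) auto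
      moreover have "(\<Sum>j<n. \<epsilon>\<^sup>2) \<le> (\<Sum>j<n. (K + 1) * f (j + j))" by (intro sum_mono fj)
      ultimately show ?thesis by (simp add: sum_distrib_left)
    qed
    moreover obtain n where "(K + 1) * sq_norm \<sigma> Y v / \<epsilon>\<^sup>2 < real n"
      using reals_Archimedean2 by blast
    ultimately show False using \<epsilon> by (simp add: field_simps not_le[symmetric])
  qed
  then obtain j where "sq_norm \<sigma> Y ((S ^^ j) z) < \<epsilon>" by blast
  with pow[of j] SkD[of j] show ?thesis by blast
qed

lemma frame_small_on_vector:
  assumes D: "submodule Y D" and z: "z \<in> D"
    and \<sigma>: "schwarz_functional \<sigma>" and \<epsilon>: "0 < \<epsilon>"
  shows "\<exists>H S. frame Y H S S \<and> set H \<subseteq> D \<and> S ` D \<subseteq> D \<and> sq_norm \<sigma> Y (S z) < \<epsilon>"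
proof -
  have zC: "z \<in> C" using z D unfolding submodule_def by auto
  have pf: "positive_functional \<sigma>" using \<sigma> unfolding schwarz_functional_def by blast
  define c where "c = 1 / (norm (ip z z) + 1)"
  have pos: "0 < norm (ip z z) + 1" using norm_ge_zero[of "ip z z"] by linarith
  have c: "0 < c" "c \<le> 1" using pos by (simp_all add: c_def)
  have "norm (ip (of_real c *\<^sub>C z) (of_real c *\<^sub>C z)) = c * (c * norm (ip z z))"
    using zC c by (simp add: ip_scale_l ip_scale_r scale_mem norm_scaleC)
  also have "\<dots> \<le> 1 * (c * norm (ip z z))" using c by (intro mult_right_mono) auto
  also have "\<dots> < 1" using pos by (simp add: c_def)
  finally have n: "norm (ip (of_real c *\<^sub>C z) (of_real c *\<^sub>C z)) < 1" .
  have cz: "of_real c *\<^sub>C z \<in> D" using z D unfolding submodule_def by auto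
  have "0 < c\<^sup>2 * \<epsilon>" using c \<epsilon> by simp
  from frame_small_on_short_vector[OF D cz n \<sigma> this] obtain H S
    where HS: "frame Y H S S" "set H \<subseteq> D" "S ` D \<subseteq> D" "sq_norm \<sigma> Y (S (of_real c *\<^sub>C z)) < c\<^sup>2 * \<epsilon>"
    by blast
  have "sq_norm \<sigma> Y (S (of_real c *\<^sub>C z)) = c\<^sup>2 * sq_norm \<sigma> Y (S z)"
    using adjoint_scale[OF frame_adjoint[OF HS(1)] zC, of "of_real c"] adjoint_mem[OF frame_adjoint[OF HS(1)] zC]
    unfolding sq_norm_def
    by (simp add: ip_scale_l ip_scale_r scale_mem positive_functional_scaleC[OF pf] power2_eq_square)
  then have "sq_norm \<sigma> Y (S z) < \<epsilon>" using HS(4) c by simp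
  then show ?thesis using HS by blast
qed

text \<open>
  A frame can be found inside any submodule D that contains the given vectors. Each vector comes with its
  own functional, which is needed to approximate in tensor products.
\<close>

lemma frame_small_on_vectors:
  assumes D: "submodule Y D" and \<epsilon>: "0 < \<epsilon>"
    and ps: "\<And>\<sigma> z. (\<sigma>, z) \<in> set ps \<Longrightarrow> schwarz_functional \<sigma> \<and> z \<in> D"
  shows "\<exists>H S S'. frame Y H S S' \<and> set H \<subseteq> D \<and> S ` D \<subseteq> D \<and> S' ` D \<subseteq> D \<and>
     (\<forall>(\<sigma>, z)\<in>set ps. sq_norm \<sigma> Y (S z) < \<epsilon>)"
  using ps
proof (induction ps)
  case Nil
  show ?case using frame_id[unfolded id_def]
    by (intro exI[of _ "[]"] exI[of _ "\<lambda>x. x"]) simp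
next
  case (Cons p ps)
  obtain \<sigma> z where p: "p = (\<sigma>, z)" by (cases p)
  obtain H S S' where I: "frame Y H S S'" "set H \<subseteq> D" "S ` D \<subseteq> D" "S' ` D \<subseteq> D"
    "\<forall>(\<sigma>, z)\<in>set ps. sq_norm \<sigma> Y (S z) < \<epsilon>"
    using Cons by (metis (no_types, lifting) list.set_intros(2))
  have \<sigma>: "schwarz_functional \<sigma>" and z: "S z \<in> D" using Cons.prems p I(3) by auto
  obtain H2 S2 where J: "frame Y H2 S2 S2" "set H2 \<subseteq> D" "S2 ` D \<subseteq> D" "sq_norm \<sigma> Y (S2 (S z)) < \<epsilon>"
    using frame_small_on_vector[OF D z \<sigma> \<epsilon>] by blast
  have "frame Y (H @ map S' H2) (S2 \<circ> S) (S' \<circ> S2)" using frame_comp I(1) J(1) by blast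
  moreover have "set (H @ map S' H2) \<subseteq> D"
    using I(2) order.trans[OF image_mono[OF J(2)] I(4)] by simp
  moreover have "(S2 \<circ> S) ` D \<subseteq> D" "(S' \<circ> S2) ` D \<subseteq> D"
    using order.trans[OF image_mono[OF I(3)] J(3)] order.trans[OF image_mono[OF J(3)] I(4)]
    by (simp_all only: image_comp)
  moreover have small: "sq_norm \<rho> Y ((S2 \<circ> S) y) < \<epsilon>" if "(\<rho>, y) \<in> set (p # ps)" for \<rho> y
  proof (cases "(\<rho>, y) \<in> set ps")
    case True
    then have "y \<in> C" "positive_functional \<rho>" using Cons.prems that D
      unfolding submodule_def schwarz_functional_def by auto
    then have "sq_norm \<rho> Y (S2 (S y)) \<le> sq_norm \<rho> Y (S y)"
      using frame_contraction[OF J(1)] adjoint_mem frame_adjoint[OF I(1)] by blast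
    then show ?thesis using I(5) True by fastforce
  next
    case False
    then show ?thesis using that p J(4) by auto
  qed
  moreover have "\<forall>(\<rho>, y)\<in>set (p # ps). sq_norm \<rho> Y ((S2 \<circ> S) y) < \<epsilon>"
  proof (intro ballI)
    fix r assume "r \<in> set (p # ps)"
    then show "case r of (\<rho>, y) \<Rightarrow> sq_norm \<rho> Y ((S2 \<circ> S) y) < \<epsilon>"
      using small[of "fst r" "snd r"] by (simp only: case_prod_beta prod.collapse)
  qed
  ultimately show ?case by (intro exI conjI)
qed

end

section \<open>Induced traces through frames\<close>

lemma sum_list_commute:
  "(\<Sum>x\<leftarrow>xs. \<Sum>y\<leftarrow>ys. f x y) = (\<Sum>y\<leftarrow>ys. \<Sum>x\<leftarrow>xs. (f x y :: 'b::comm_monoid_add))"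
  by (induction xs) (simp_all add: sum_list_addf)

text \<open>
  Two copies of a vector x contribute the same to quadratic expressions as one copy of \<open>\<surd>2 x\<close>. Merging
  shortens the list, so it ends with a list without repetitions, that is, with a finite set.
\<close>

lemma merge_repetitions:
  fixes xs :: "'v::real_vector list"
  assumes "set xs \<subseteq> D" and D: "\<And>x. x \<in> D \<Longrightarrow> sqrt 2 *\<^sub>R x \<in> D"
  shows "\<exists>H. finite H \<and> H \<subseteq> D \<and>
     (\<forall>F::'v \<Rightarrow> 'v. (\<forall>x\<in>D. F (sqrt 2 *\<^sub>R x) = 2 *\<^sub>R F x) \<longrightarrow> (\<Sum>x\<in>H. F x) = (\<Sum>x\<leftarrow>xs. F x)) \<and>
     (\<forall>F::'v \<Rightarrow> real. (\<forall>x\<in>D. F (sqrt 2 *\<^sub>R x) = 2 *\<^sub>R F x) \<longrightarrow> (\<Sum>x\<in>H. F x) = (\<Sum>x\<leftarrow>xs. F x))"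
  using assms(1)
proof (induction xs rule: length_induct)
  case (1 xs)
  show ?case
  proof (cases "distinct xs")
    case True
    then show ?thesis using 1(2)
      by (intro exI[of _ "set xs"]) (auto simp: sum_list_distinct_conv_sum_set)
  next
    case False
    then obtain as y bs cs where xs: "xs = as @ [y] @ bs @ [y] @ cs"
      using not_distinct_decomp[OF False] by metis
    define xs' where "xs' = (sqrt 2 *\<^sub>R y) # as @ bs @ cs"
    have y: "y \<in> D" using 1(2) xs by auto
    have "length xs' < length xs" "set xs' \<subseteq> D"
      using 1(2) D[OF y] unfolding xs xs'_def by simp_all
    then obtain H where H: "finite H" "H \<subseteq> D"
      "\<And>F::'v \<Rightarrow> 'v. (\<forall>x\<in>D. F (sqrt 2 *\<^sub>R x) = 2 *\<^sub>R F x) \<Longrightarrow> (\<Sum>x\<in>H. F x) = (\<Sum>x\<leftarrow>xs'. F x)"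
      "\<And>F::'v \<Rightarrow> real. (\<forall>x\<in>D. F (sqrt 2 *\<^sub>R x) = 2 *\<^sub>R F x) \<Longrightarrow> (\<Sum>x\<in>H. F x) = (\<Sum>x\<leftarrow>xs'. F x)"
      using 1(1)[rule_format, of xs'] by metis
    have "(\<Sum>x\<leftarrow>xs'. F x) = (\<Sum>x\<leftarrow>xs. F x)" if "\<forall>x\<in>D. F (sqrt 2 *\<^sub>R x) = 2 *\<^sub>R F x" for F :: "'v \<Rightarrow> 'v"
    proof -
      have "F (sqrt 2 *\<^sub>R y) = F y + F y" using bspec[OF that y] by (simp only: scaleR_2)
      then show ?thesis unfolding xs xs'_def by (simp add: add_ac)
    qed
    moreover have "(\<Sum>x\<leftarrow>xs'. F x) = (\<Sum>x\<leftarrow>xs. F x)" if "\<forall>x\<in>D. F (sqrt 2 *\<^sub>R x) = 2 *\<^sub>R F x"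
      for F :: "'v \<Rightarrow> real"
    proof -
      have "F (sqrt 2 *\<^sub>R y) = F y + F y" using bspec[OF that y] by simp
      then show ?thesis unfolding xs xs'_def by simp
    qed
    ultimately show ?thesis using H by (intro exI[of _ H]) simp
  qed
qed

text \<open>
  D contains enough vectors for frames from D to resolve finitely many vectors of the module at a time.
\<close>

definition exhausting ::
  "('a::cstar_algebra \<Rightarrow> complex) \<Rightarrow> ('a, 'x::complex_vec) correspondence \<Rightarrow> 'x set \<Rightarrow> bool" where
  "exhausting \<tau> Y D \<longleftrightarrow> D \<subseteq> hcarrier Y \<and>
     (\<forall>vs \<epsilon>. set vs \<subseteq> hcarrier Y \<longrightarrow> 0 < \<epsilon> \<longrightarrow>
        (\<exists>H S S'. frame Y H S S' \<and> set H \<subseteq> D \<and> (\<forall>v\<in>set vs. sq_norm \<tau> Y (S v) < \<epsilon>)))"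

context hilbert_mod
begin

lemma submodule_carrier: "submodule Y C"
  unfolding submodule_def using add_mem scale_mem act_mem by auto

lemma exhausting_dense:
  assumes D: "submodule Y D" and \<sigma>: "schwarz_functional \<sigma>"
    and dense: "\<And>v \<epsilon>. v \<in> C \<Longrightarrow> 0 < \<epsilon> \<Longrightarrow> \<exists>d\<in>D. sq_norm \<sigma> Y (v - d) < \<epsilon>"
  shows "exhausting \<sigma> Y D"
  unfolding exhausting_def
proof (intro conjI allI impI)
  show DC: "D \<subseteq> C" using D unfolding submodule_def by blast
  fix vs :: "'x list" and \<epsilon> :: real
  assume vs: "set vs \<subseteq> C" and \<epsilon>: "0 < \<epsilon>"
  have pf: "positive_functional \<sigma>" using \<sigma> unfolding schwarz_functional_def by blast
  have e4: "0 < \<epsilon> / 4" using \<epsilon> by simp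
  have "\<forall>v\<in>set vs. \<exists>d\<in>D. sq_norm \<sigma> Y (v - d) < \<epsilon> / 4" using dense[OF _ e4] vs by blast
  then obtain d where d: "\<And>v. v \<in> set vs \<Longrightarrow> d v \<in> D" "\<And>v. v \<in> set vs \<Longrightarrow> sq_norm \<sigma> Y (v - d v) < \<epsilon> / 4"
    by metis
  have "\<exists>H S S'. frame Y H S S' \<and> set H \<subseteq> D \<and> S ` D \<subseteq> D \<and> S' ` D \<subseteq> D \<and>
     (\<forall>(\<rho>, z)\<in>set (map (\<lambda>v. (\<sigma>, d v)) vs). sq_norm \<rho> Y (S z) < \<epsilon> / 4)"
    by (rule frame_small_on_vectors[OF D e4]) (use \<sigma> d(1) in auto)
  then obtain H S S' where H: "frame Y H S S'" "set H \<subseteq> D" "\<And>v. v \<in> set vs \<Longrightarrow> sq_norm \<sigma> Y (S (d v)) < \<epsilon> / 4"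
    by auto
  have "sq_norm \<sigma> Y (S v) < \<epsilon>" if v: "v \<in> set vs" for v
  proof -
    have m: "v \<in> C" "d v \<in> C" using v vs d(1) DC by auto
    note aS = frame_adjoint[OF H(1)]
    have "S v = S (v - d v) + S (d v)"
      using adjoint_add[OF aS, of "v - d v" "d v"] m diff_mem by simp
    then have "sq_norm \<sigma> Y (S v) \<le> 2 * sq_norm \<sigma> Y (S (v - d v)) + 2 * sq_norm \<sigma> Y (S (d v))"
      using sq_norm_add_le[OF pf] adjoint_mem[OF aS] m diff_mem by simp
    moreover have "sq_norm \<sigma> Y (S (v - d v)) \<le> sq_norm \<sigma> Y (v - d v)"
      using frame_contraction[OF H(1) _ pf] m diff_mem by blast
    ultimately show ?thesis using d(2)[OF v] H(3)[OF v] by linarith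
  qed
  then show "\<exists>H S S'. frame Y H S S' \<and> set H \<subseteq> D \<and> (\<forall>v\<in>set vs. sq_norm \<sigma> Y (S v) < \<epsilon>)"
    using H(1,2) by blast
qed

lemma exhausting_carrier:
  assumes "schwarz_functional \<sigma>"
  shows "exhausting \<sigma> Y C"
proof (rule exhausting_dense[OF submodule_carrier assms])
  fix v :: 'x and \<epsilon> :: real
  assume v: "v \<in> C" and "0 < \<epsilon>"
  have "sq_norm \<sigma> Y (v - v) = 0"
    using assms unfolding schwarz_functional_def
    by (simp add: sq_norm_def ip_zero_r zero_mem positive_functional_zero)
  then show "\<exists>d\<in>C. sq_norm \<sigma> Y (v - d) < \<epsilon>" using v \<open>0 < \<epsilon>\<close> by (intro bexI[of _ v]) auto
qed

lemma induced_trace_ge: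
  assumes fr: "frame Y H S S'" and pf: "positive_functional \<tau>" and T: "is_adjoint Y T T'"
  shows "ereal (\<Sum>\<eta>\<leftarrow>H. Re (\<tau> (ip \<eta> (T \<eta>)))) \<le> induced_trace Y \<tau> T"
proof -
  have HC: "set H \<subseteq> C" using fr unfolding frame_def by blast
  have sc: "r *\<^sub>R x = of_real r *\<^sub>C x" for r and x :: 'x by (simp add: scaleC_of_real)
  have sq2: "of_real (sqrt 2) *\<^sub>C (of_real (sqrt 2) *\<^sub>C y) = 2 *\<^sub>R y" for y :: 'x
    using sc[of 2 y] by (simp add: scaleC_scaleC flip: of_real_mult)
  have sq2a: "of_real (sqrt 2) *\<^sub>C (of_real (sqrt 2) *\<^sub>C y) = 2 *\<^sub>C y" for y :: 'a
    by (simp add: scaleC_scaleC flip: of_real_mult)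
  have "sqrt 2 *\<^sub>R x \<in> C" if "x \<in> C" for x using that by (simp add: sc scale_mem)
  from merge_repetitions[OF HC this] obtain H' where H': "finite H'" "H' \<subseteq> C"
    "\<And>F::'x \<Rightarrow> 'x. (\<forall>x\<in>C. F (sqrt 2 *\<^sub>R x) = 2 *\<^sub>R F x) \<Longrightarrow> (\<Sum>x\<in>H'. F x) = (\<Sum>x\<leftarrow>H. F x)"
    "\<And>F::'x \<Rightarrow> real. (\<forall>x\<in>C. F (sqrt 2 *\<^sub>R x) = 2 *\<^sub>R F x) \<Longrightarrow> (\<Sum>x\<in>H'. F x) = (\<Sum>x\<leftarrow>H. F x)"
    by blast
  have \<theta>: "(\<Sum>\<eta>\<in>H'. \<theta> Y \<eta> \<eta> x) = (\<Sum>\<eta>\<leftarrow>H. \<theta> Y \<eta> \<eta> x)" if x: "x \<in> C" for x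
    by (rule H'(3)) (use x in \<open>auto simp: rank_one_def sc ip_scale_l scale_mem act_scale_l act_scale_r sq2
        simp del: of_real_mult\<close>)
  have "op_le Y (\<lambda>\<eta>. \<Sum>\<xi>\<in>H'. \<theta> Y \<xi> \<xi> \<eta>) (\<lambda>\<eta>. \<eta>)"
    unfolding op_le_def positive_op_def
    using fr \<theta> by (intro exI[of _ S] exI[of _ S']) (auto simp: frame_def)
  then have "ereal (\<Sum>\<xi>\<in>H'. Re (\<tau> (ip \<xi> (T \<xi>)))) \<le> induced_trace Y \<tau> T"
    unfolding induced_trace_def using H'(1,2) by (intro SUP_upper) auto
  moreover have "(\<Sum>\<xi>\<in>H'. Re (\<tau> (ip \<xi> (T \<xi>)))) = (\<Sum>\<eta>\<leftarrow>H. Re (\<tau> (ip \<eta> (T \<eta>))))"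
    by (rule H'(4)) (use T pf in \<open>auto simp: sc ip_scale_l ip_scale_r scale_mem adjoint_scale
        adjoint_mem sq2a positive_functional_scaleC simp del: of_real_mult\<close>)
  ultimately show ?thesis by simp
qed

lemma induced_trace_le:
  assumes "\<And>H S S'. frame Y H S S' \<Longrightarrow> ereal (\<Sum>\<eta>\<leftarrow>H. Re (\<tau> (ip \<eta> (T \<eta>)))) \<le> B"
  shows "induced_trace Y \<tau> T \<le> B"
  unfolding induced_trace_def
proof (rule SUP_least)
  fix H assume "H \<in> {H. finite H \<and> H \<subseteq> C \<and> op_le Y (\<lambda>\<eta>. \<Sum>\<xi>\<in>H. \<theta> Y \<xi> \<xi> \<eta>) (\<lambda>\<eta>. \<eta>)}"
  then have H: "finite H" "H \<subseteq> C" "op_le Y (\<lambda>\<eta>. \<Sum>\<xi>\<in>H. \<theta> Y \<xi> \<xi> \<eta>) (\<lambda>\<eta>. \<eta>)" by auto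
  obtain xs where xs: "set xs = H" "distinct xs" using finite_distinct_list[OF H(1)] by blast
  then have sum: "(\<Sum>\<xi>\<in>H. f \<xi>) = (\<Sum>\<xi>\<leftarrow>xs. f \<xi>)" for f :: "'x \<Rightarrow> 'c::comm_monoid_add"
    by (simp add: sum_list_distinct_conv_sum_set)
  obtain S S' where "is_adjoint Y S S'" "\<forall>\<eta>\<in>C. \<eta> - (\<Sum>\<xi>\<in>H. \<theta> Y \<xi> \<xi> \<eta>) = S' (S \<eta>)"
    using H(3) unfolding op_le_def positive_op_def by blast
  then have "frame Y xs S S'"
    unfolding frame_def using xs(1) H(2) sum[of "\<lambda>\<xi>. \<theta> Y \<xi> \<xi> _"] by auto
  then show "ereal (\<Sum>\<xi>\<in>H. Re (\<tau> (ip \<xi> (T \<xi>)))) \<le> B"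
    unfolding sum by (rule assms)
qed

end

text \<open>
  The identity Tr(V* V) = Tr(V V*) for operators V i from Y i to a common module Z, in the form of an
  upper bound. Resolve the vectors \<open>V i \<eta>\<close> by a frame L of Z; for each \<open>\<zeta>\<close> in L and \<open>\<eta>\<close> in M i the trace
  property gives \<open>\<tau>(\<langle>V\<eta>, \<zeta>\<rangle>\<langle>\<zeta>, V\<eta>\<rangle>) = \<tau>(\<langle>V'\<zeta>, \<eta>\<rangle>\<langle>\<eta>, V'\<zeta>\<rangle>)\<close>, and the sum of the latter over M i is at most
  \<open>\<tau>\<langle>V'\<zeta>, V'\<zeta>\<rangle>\<close>. Both V and its adjoint V' are only used on subsets, since the adjoint
  of multiplication by a vector will only be available on finite sums of products.
\<close>

lemma frame_exchange:
  fixes \<tau> :: "'a::cstar_algebra \<Rightarrow> complex" and Z :: "('a, 'x::complex_vec) correspondence"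
    and Y :: "'i \<Rightarrow> ('a, 'x::complex_vec) correspondence"
  assumes Z: "hilbert_module Z" and Y: "\<And>i. i \<in> set I \<Longrightarrow> hilbert_module (Y i)"
    and pf: "positive_functional \<tau>" and tr: "\<And>a b. \<tau> (a * b) = \<tau> (b * a)"
    and D: "exhausting \<tau> Z D"
    and M: "\<And>i. i \<in> set I \<Longrightarrow> frame (Y i) (M i) (R i) (R' i)"
    and V: "\<And>i \<eta>. i \<in> set I \<Longrightarrow> \<eta> \<in> set (M i) \<Longrightarrow> V i \<eta> \<in> hcarrier Z"
    and V': "\<And>i \<zeta>. i \<in> set I \<Longrightarrow> \<zeta> \<in> D \<Longrightarrow> V' i \<zeta> \<in> hcarrier (Y i)"
    and adj: "\<And>i \<eta> \<zeta>. i \<in> set I \<Longrightarrow> \<eta> \<in> set (M i) \<Longrightarrow> \<zeta> \<in> D \<Longrightarrow>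
      hinner Z (V i \<eta>) \<zeta> = hinner (Y i) \<eta> (V' i \<zeta>)"
    and bound: "\<And>L S S'. frame Z L S S' \<Longrightarrow> set L \<subseteq> D \<Longrightarrow>
      (\<Sum>\<zeta>\<leftarrow>L. \<Sum>i\<leftarrow>I. sq_norm \<tau> (Y i) (V' i \<zeta>)) \<le> B"
  shows "(\<Sum>i\<leftarrow>I. \<Sum>\<eta>\<leftarrow>M i. sq_norm \<tau> Z (V i \<eta>)) \<le> B"
proof -
  interpret Z: hilbert_mod Z by unfold_locales (rule Z)
  define vs where "vs = concat (map (\<lambda>i. map (V i) (M i)) I)"
  have vsC: "set vs \<subseteq> hcarrier Z" using V by (auto simp: vs_def)
  have DC: "D \<subseteq> hcarrier Z" using D unfolding exhausting_def by blast
  have flat: "(\<Sum>i\<leftarrow>I. \<Sum>\<eta>\<leftarrow>M i. f (V i \<eta>)) = (\<Sum>v\<leftarrow>vs. f v)" for f :: "'x \<Rightarrow> real"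
    unfolding vs_def by (induction I) (simp_all add: comp_def)
  have "(\<Sum>v\<leftarrow>vs. sq_norm \<tau> Z v) \<le> B + real (length vs) * \<epsilon>" if \<epsilon>: "0 < \<epsilon>" for \<epsilon>
  proof -
    obtain L S S' where L: "frame Z L S S'" "set L \<subseteq> D" "\<And>v. v \<in> set vs \<Longrightarrow> sq_norm \<tau> Z (S v) < \<epsilon>"
      using D vsC \<epsilon> unfolding exhausting_def by blast
    have "(\<Sum>v\<leftarrow>vs. sq_norm \<tau> Z v) \<le> (\<Sum>v\<leftarrow>vs. (\<Sum>\<zeta>\<leftarrow>L. Re (\<tau> (hinner Z v \<zeta> * hinner Z \<zeta> v))) + \<epsilon>)"
    proof (rule sum_list_mono)
      fix v assume v: "v \<in> set vs"
      then show "sq_norm \<tau> Z v \<le> (\<Sum>\<zeta>\<leftarrow>L. Re (\<tau> (hinner Z v \<zeta> * hinner Z \<zeta> v))) + \<epsilon>"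
        using Z.frame_sq_norm[OF L(1) _ pf, of v] vsC L(3)[OF v] by auto
    qed
    also have "\<dots> = (\<Sum>v\<leftarrow>vs. \<Sum>\<zeta>\<leftarrow>L. Re (\<tau> (hinner Z v \<zeta> * hinner Z \<zeta> v))) + real (length vs) * \<epsilon>"
      by (simp add: sum_list_addf sum_list_triv)
    also have "(\<Sum>v\<leftarrow>vs. \<Sum>\<zeta>\<leftarrow>L. Re (\<tau> (hinner Z v \<zeta> * hinner Z \<zeta> v)))
        = (\<Sum>i\<leftarrow>I. \<Sum>\<eta>\<leftarrow>M i. \<Sum>\<zeta>\<leftarrow>L. Re (\<tau> (hinner Z (V i \<eta>) \<zeta> * hinner Z \<zeta> (V i \<eta>))))"
      by (rule flat[symmetric])
    also have "\<dots> = (\<Sum>i\<leftarrow>I. \<Sum>\<zeta>\<leftarrow>L. \<Sum>\<eta>\<leftarrow>M i. Re (\<tau> (hinner Z (V i \<eta>) \<zeta> * hinner Z \<zeta> (V i \<eta>))))"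
      by (intro arg_cong[where f = sum_list] map_cong refl sum_list_commute)
    also have "\<dots> = (\<Sum>\<zeta>\<leftarrow>L. \<Sum>i\<leftarrow>I. \<Sum>\<eta>\<leftarrow>M i. Re (\<tau> (hinner Z (V i \<eta>) \<zeta> * hinner Z \<zeta> (V i \<eta>))))"
      by (rule sum_list_commute)
    also have "\<dots> \<le> (\<Sum>\<zeta>\<leftarrow>L. \<Sum>i\<leftarrow>I. sq_norm \<tau> (Y i) (V' i \<zeta>))"
    proof (intro sum_list_mono)
      fix \<zeta> i assume \<zeta>: "\<zeta> \<in> set L" and i: "i \<in> set I"
      interpret Yi: hilbert_mod "Y i" by unfold_locales (rule Y[OF i])
      have \<zeta>D: "\<zeta> \<in> D" using \<zeta> L(2) by auto
      have "(\<Sum>\<eta>\<leftarrow>M i. Re (\<tau> (hinner Z (V i \<eta>) \<zeta> * hinner Z \<zeta> (V i \<eta>))))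
          = (\<Sum>\<eta>\<leftarrow>M i. Re (\<tau> (hinner (Y i) (V' i \<zeta>) \<eta> * hinner (Y i) \<eta> (V' i \<zeta>))))"
      proof (intro arg_cong[where f = sum_list] map_cong refl)
        fix \<eta> assume \<eta>: "\<eta> \<in> set (M i)"
        have 1: "hinner Z (V i \<eta>) \<zeta> = hinner (Y i) \<eta> (V' i \<zeta>)" using adj i \<eta> \<zeta>D by blast
        have "hinner Z \<zeta> (V i \<eta>) = star (hinner Z (V i \<eta>) \<zeta>)"
          using Z.star_ip V[OF i \<eta>] \<zeta>D DC by force
        also have "\<dots> = hinner (Y i) (V' i \<zeta>) \<eta>"
          unfolding 1 using Yi.star_ip V'[OF i \<zeta>D] Yi.frame_mem[OF M[OF i] \<eta>] by simp
        finally have 2: "hinner Z \<zeta> (V i \<eta>) = hinner (Y i) (V' i \<zeta>) \<eta>" .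
        show "Re (\<tau> (hinner Z (V i \<eta>) \<zeta> * hinner Z \<zeta> (V i \<eta>)))
          = Re (\<tau> (hinner (Y i) (V' i \<zeta>) \<eta> * hinner (Y i) \<eta> (V' i \<zeta>)))"
          unfolding 1 2 by (subst tr) simp
      qed
      also have "\<dots> \<le> sq_norm \<tau> (Y i) (V' i \<zeta>)"
        using Yi.frame_bessel[OF M[OF i] V'[OF i \<zeta>D] pf] .
      finally show "(\<Sum>\<eta>\<leftarrow>M i. Re (\<tau> (hinner Z (V i \<eta>) \<zeta> * hinner Z \<zeta> (V i \<eta>))))
        \<le> sq_norm \<tau> (Y i) (V' i \<zeta>)" .
    qed
    also have "\<dots> \<le> B" using bound[OF L(1,2)] .
    finally show ?thesis by simp
  qed
  note * = this
  have "(\<Sum>v\<leftarrow>vs. sq_norm \<tau> Z v) \<le> B + \<epsilon>" if \<epsilon>: "0 < \<epsilon>" for \<epsilon>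
  proof -
    have "(\<Sum>v\<leftarrow>vs. sq_norm \<tau> Z v) \<le> B + real (length vs) * (\<epsilon> / (real (length vs) + 1))"
      by (rule *) (use \<epsilon> in simp)
    also have "real (length vs) * (\<epsilon> / (real (length vs) + 1)) \<le> \<epsilon>"
      using \<epsilon> by (simp add: field_simps)
    finally show ?thesis by simp
  qed
  then show ?thesis unfolding flat by (rule field_le_epsilon)
qed

section \<open>Induced traces in stages\<close>

locale correspondence_mod = hilbert_mod +
  assumes cc: "cstar_correspondence Y"
begin

lemma lact_adjoint: "is_adjoint Y (lact Y a) (lact Y (star a))"
  and lact_add: "x \<in> C \<Longrightarrow> lact Y (a + b) x = lact Y a x + lact Y b x"
  and lact_mult: "x \<in> C \<Longrightarrow> lact Y (a * b) x = lact Y a (lact Y b x)"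
  and lact_scale: "x \<in> C \<Longrightarrow> lact Y (c *\<^sub>C a) x = c *\<^sub>C lact Y a x"
  using cc unfolding cstar_correspondence_def by blast+

lemma lact_mem: "x \<in> C \<Longrightarrow> lact Y a x \<in> C"
  using adjoint_mem[OF lact_adjoint] .

lemma lact_ip: "x \<in> C \<Longrightarrow> y \<in> C \<Longrightarrow> ip (lact Y a x) y = ip x (lact Y (star a) y)"
  using adjoint_ip[OF lact_adjoint] .

lemma lact_zero: "x \<in> C \<Longrightarrow> lact Y 0 x = 0"
  using lact_scale[of x 0 0] by simp

lemma lact_diff: "x \<in> C \<Longrightarrow> lact Y (a - b) x = lact Y a x - lact Y b x"
  using lact_add[of x a "-b"] lact_scale[of x "-1" b] by (simp add: scaleC_minus_one)

lemma lact_sum_list: "x \<in> C \<Longrightarrow> lact Y (\<Sum>i\<leftarrow>is. f i) x = (\<Sum>i\<leftarrow>is. lact Y (f i) x)"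
  by (induction "is") (simp_all add: lact_zero lact_add)

lemma sq_norm_lact: "x \<in> C \<Longrightarrow> sq_norm \<tau> Y (lact Y b x) = Re (\<tau> (ip x (lact Y (star b * b) x)))"
  by (simp add: sq_norm_def lact_ip lact_mem lact_mult)

text \<open>
  Here the Schwarz estimate is Cauchy-Schwarz for \<open>\<eta>\<close> and \<open>h\<eta>\<close>.
\<close>

lemma vector_functional_schwarz:
  assumes pf: "positive_functional \<tau>" and \<eta>: "\<eta> \<in> C"
  shows "schwarz_functional (\<lambda>a. \<tau> (ip \<eta> (lact Y a \<eta>)))"
proof -
  have sq: "ip \<eta> (lact Y (star a * a) \<eta>) = ip (lact Y a \<eta>) (lact Y a \<eta>)" for a
    using \<eta> by (simp add: lact_ip lact_mem lact_mult)
  have "positive_functional (\<lambda>a. \<tau> (ip \<eta> (lact Y a \<eta>)))"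
    unfolding positive_functional_def sq
    using \<eta> pf sq_norm_nonneg[OF pf lact_mem[OF \<eta>]] ip_Reals[OF pf lact_mem[OF \<eta>]]
    by (auto simp: lact_add lact_scale ip_add_r ip_scale_r lact_mem positive_functional_add
        positive_functional_scaleC sq_norm_def)
  moreover have "(cmod (\<tau> (ip \<eta> (lact Y h \<eta>))))\<^sup>2
      \<le> Re (\<tau> (ip \<eta> \<eta>)) * Re (\<tau> (ip \<eta> (lact Y (h * h) \<eta>)))" if h: "star h = h" for h
  proof -
    have "(cmod (\<tau> (ip \<eta> (lact Y h \<eta>))))\<^sup>2
        \<le> Re (\<tau> (ip \<eta> \<eta>)) * Re (\<tau> (ip (lact Y h \<eta>) (lact Y h \<eta>)))"
      by (rule form_Cauchy_Schwarz[where B = "\<lambda>x y. \<tau> (ip x y)" and C = C])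
        (use \<eta> pf sq_norm_nonneg[OF pf] ip_Reals[OF pf] in
          \<open>auto simp: add_mem scale_mem ip_add_l ip_add_r ip_scale_l ip_scale_r lact_mem
            positive_functional_add positive_functional_scaleC sq_norm_def\<close>)
    then show ?thesis using sq[of h] h by simp
  qed
  moreover have "0 \<le> Re (\<tau> (ip \<eta> \<eta>))" using sq_norm_nonneg[OF pf \<eta>] by (simp add: sq_norm_def)
  ultimately show ?thesis unfolding schwarz_functional_def by blast
qed

lemma lact_trace_ge:
  assumes "frame Y H S S'" and "positive_functional \<tau>"
  shows "ereal (\<Sum>\<eta>\<leftarrow>H. Re (\<tau> (ip \<eta> (lact Y a \<eta>)))) \<le> induced_trace Y \<tau> (lact Y a)"
  using induced_trace_ge[OF assms lact_adjoint] .

lemma frame_above: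
  assumes "ereal y < induced_trace Y \<tau> T"
  obtains H S S' where "frame Y H S S'" "y < (\<Sum>\<eta>\<leftarrow>H. Re (\<tau> (ip \<eta> (T \<eta>))))"
proof -
  have "\<not> (\<forall>H S S'. frame Y H S S' \<longrightarrow> ereal (\<Sum>\<eta>\<leftarrow>H. Re (\<tau> (ip \<eta> (T \<eta>)))) \<le> ereal y)"
    using induced_trace_le[of \<tau> T "ereal y"] assms by (metis leD)
  then show ?thesis using that by (auto simp: not_le)
qed

lemma frame_sum_eq:
  assumes "frame Y H S S'"
  shows "(\<Sum>\<eta>\<leftarrow>H. Re (\<tau> (ip \<eta> (lact Y (star b * b) \<eta>)))) = (\<Sum>\<eta>\<leftarrow>H. sq_norm \<tau> Y (lact Y b \<eta>))"
  using frame_mem[OF assms] by (intro arg_cong[where f = sum_list] map_cong) (auto simp: sq_norm_lact)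

text \<open>
  The case V = b, that is, Tr(b* b) = Tr(b b*).
\<close>

lemma trace_exchange:
  assumes pf: "positive_functional \<tau>" and tr: "\<And>a b. \<tau> (a * b) = \<tau> (b * a)"
    and D: "exhausting \<tau> Y D" and M: "frame Y M R R'"
    and bound: "\<And>L S S'. frame Y L S S' \<Longrightarrow> set L \<subseteq> D \<Longrightarrow>
      (\<Sum>\<zeta>\<leftarrow>L. sq_norm \<tau> Y (lact Y (star b) \<zeta>)) \<le> B"
  shows "(\<Sum>\<eta>\<leftarrow>M. sq_norm \<tau> Y (lact Y b \<eta>)) \<le> B"
proof -
  have DC: "D \<subseteq> C" using D unfolding exhausting_def by blast
  have "(\<Sum>i\<leftarrow>[()]. \<Sum>\<eta>\<leftarrow>M. sq_norm \<tau> Y (lact Y b \<eta>)) \<le> B"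
    by (rule frame_exchange[where V' = "\<lambda>_. lact Y (star b)" and Y = "\<lambda>_. Y" and M = "\<lambda>_. M" and D = D])
      (use hm pf tr D M bound DC frame_mem[OF M] in \<open>auto simp: lact_mem lact_ip subset_iff\<close>)
  then show ?thesis by simp
qed

end

locale tensor_mod = P: correspondence_mod P + Q: correspondence_mod Q + Z: correspondence_mod Z
  for P Q Z :: "('a::cstar_algebra, 'x::complex_vec) correspondence" +
  fixes t :: "'x \<Rightarrow> 'x \<Rightarrow> 'x"
  assumes iso: "extends_to_tensor_iso P Q Z t"
begin

abbreviation "pairs \<equiv> hcarrier P \<times> hcarrier Q"

definition tsum :: "('x \<times> 'x) list \<Rightarrow> 'x" where
  "tsum l = (\<Sum>u\<leftarrow>l. t (fst u) (snd u))"

text \<open>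
  The adjoint of \<open>\<eta> \<mapsto> \<xi>\<eta>\<close>, applied to the finite sum of products given by the list. It is defined on
  lists so that it need not be shown to depend only on the sum, nor to extend to the completion.
\<close>

definition annihilate :: "('x \<times> 'x) list \<Rightarrow> 'x \<Rightarrow> 'x" where
  "annihilate l \<xi> = (\<Sum>u\<leftarrow>l. lact Q (hinner P \<xi> (fst u)) (snd u))"

definition products :: "'x set" where
  "products = {tsum l | l. set l \<subseteq> pairs}"

lemma pairs_mem:
  "set l \<subseteq> pairs \<Longrightarrow> u \<in> set l \<Longrightarrow> fst u \<in> hcarrier P"
  "set l \<subseteq> pairs \<Longrightarrow> u \<in> set l \<Longrightarrow> snd u \<in> hcarrier Q"
  by auto

lemma t_mem: "\<xi> \<in> hcarrier P \<Longrightarrow> \<eta> \<in> hcarrier Q \<Longrightarrow> t \<xi> \<eta> \<in> hcarrier Z"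
  and t_lact: "\<xi> \<in> hcarrier P \<Longrightarrow> \<eta> \<in> hcarrier Q \<Longrightarrow> lact Z a (t \<xi> \<eta>) = t (lact P a \<xi>) \<eta>"
  using iso unfolding extends_to_tensor_iso_def by auto

lemma tsum_mem: "set l \<subseteq> pairs \<Longrightarrow> tsum l \<in> hcarrier Z"
  unfolding tsum_def by (intro Z.sum_list_mem t_mem pairs_mem)

lemma tsum_ip:
  assumes "set l \<subseteq> pairs" "set l' \<subseteq> pairs"
  shows "hinner Z (tsum l) (tsum l')
    = (\<Sum>u\<leftarrow>l. \<Sum>v\<leftarrow>l'. hinner Q (snd u) (lact Q (hinner P (fst u) (fst v)) (snd v)))"
  using iso assms unfolding extends_to_tensor_iso_def tensor_inner_def tsum_def
  by (simp add: case_prod_beta')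

lemma tsum_single: "tsum [(\<xi>, \<eta>)] = t \<xi> \<eta>"
  by (simp add: tsum_def)

lemma t_ip:
  assumes "\<xi> \<in> hcarrier P" "\<eta> \<in> hcarrier Q" "\<xi>' \<in> hcarrier P" "\<eta>' \<in> hcarrier Q"
  shows "hinner Z (t \<xi> \<eta>) (t \<xi>' \<eta>') = hinner Q \<eta> (lact Q (hinner P \<xi> \<xi>') \<eta>')"
  using tsum_ip[of "[(\<xi>, \<eta>)]" "[(\<xi>', \<eta>')]"] assms by (simp add: tsum_single)

lemma annihilate_mem: "set l \<subseteq> pairs \<Longrightarrow> annihilate l \<xi> \<in> hcarrier Q"
  unfolding annihilate_def by (intro Q.sum_list_mem Q.lact_mem pairs_mem)

lemma annihilate_ip:
  assumes "set l \<subseteq> pairs" "\<xi> \<in> hcarrier P" "\<eta> \<in> hcarrier Q"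
  shows "hinner Z (t \<xi> \<eta>) (tsum l) = hinner Q \<eta> (annihilate l \<xi>)"
proof -
  have "hinner Z (t \<xi> \<eta>) (tsum l) = (\<Sum>v\<leftarrow>l. hinner Q \<eta> (lact Q (hinner P \<xi> (fst v)) (snd v)))"
    using tsum_ip[of "[(\<xi>, \<eta>)]" l] assms by (simp add: tsum_single)
  then show ?thesis unfolding annihilate_def
    using assms by (subst Q.ip_sum_list_r) (auto intro!: Q.lact_mem pairs_mem(2))
qed

lemma t_scale:
  assumes "\<xi> \<in> hcarrier P" "\<eta> \<in> hcarrier Q"
  shows "t \<xi> (c *\<^sub>C \<eta>) = c *\<^sub>C t \<xi> \<eta>"
proof -
  have c: "c *\<^sub>C \<eta> \<in> hcarrier Q" using assms Q.scale_mem by blast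
  have m: "t \<xi> (c *\<^sub>C \<eta>) \<in> hcarrier Z" "c *\<^sub>C t \<xi> \<eta> \<in> hcarrier Z"
    using assms c t_mem Z.scale_mem by auto
  have "hinner Z (t \<xi> (c *\<^sub>C \<eta>) - c *\<^sub>C t \<xi> \<eta>) (t \<xi> (c *\<^sub>C \<eta>) - c *\<^sub>C t \<xi> \<eta>) = 0"
    using assms m c by (simp add: Z.ip_diff_l Z.ip_diff_r Z.diff_mem Z.ip_scale_l Z.ip_scale_r t_mem
        t_ip Q.ip_scale_l Q.lact_mem)
  then show ?thesis using Z.ip_definite Z.diff_mem m by force
qed

lemma t_act:
  assumes "\<xi> \<in> hcarrier P" "\<eta> \<in> hcarrier Q"
  shows "t \<xi> (ract Q \<eta> a) = ract Z (t \<xi> \<eta>) a"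
proof -
  have c: "ract Q \<eta> a \<in> hcarrier Q" using assms Q.act_mem by blast
  have m: "t \<xi> (ract Q \<eta> a) \<in> hcarrier Z" "ract Z (t \<xi> \<eta>) a \<in> hcarrier Z"
    using assms c t_mem Z.act_mem by auto
  have "hinner Z (t \<xi> (ract Q \<eta> a) - ract Z (t \<xi> \<eta>) a) (t \<xi> (ract Q \<eta> a) - ract Z (t \<xi> \<eta>) a) = 0"
    using assms m c by (simp add: Z.ip_diff_l Z.ip_diff_r Z.diff_mem Z.ip_act_l Z.ip_act_r t_mem
        t_ip Q.ip_act_l Q.lact_mem)
  then show ?thesis using Z.ip_definite Z.diff_mem m by force
qed

lemma products_submodule: "submodule Z products"
  unfolding submodule_def
proof (intro conjI ballI allI)
  show "products \<subseteq> hcarrier Z" using tsum_mem by (auto simp: products_def)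
next
  fix x y assume "x \<in> products" "y \<in> products"
  then obtain l l' where "x = tsum l" "y = tsum l'" "set l \<subseteq> pairs" "set l' \<subseteq> pairs"
    by (auto simp: products_def)
  then have "x + y = tsum (l @ l')" "set (l @ l') \<subseteq> pairs" by (auto simp: tsum_def)
  then show "x + y \<in> products" unfolding products_def by blast
next
  fix x c assume "x \<in> products"
  then obtain l where l: "x = tsum l" "set l \<subseteq> pairs" by (auto simp: products_def)
  have "c *\<^sub>C tsum l = tsum (map (\<lambda>u. (fst u, c *\<^sub>C snd u)) l)" using l(2)
    by (induction l) (auto simp: tsum_def t_scale scaleC_add_right)
  moreover have "set (map (\<lambda>u. (fst u, c *\<^sub>C snd u)) l) \<subseteq> pairs" using l(2) Q.scale_mem by auto
  ultimately show "c *\<^sub>C x \<in> products" unfolding products_def l(1) by blast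
next
  fix x a assume "x \<in> products"
  then obtain l where l: "x = tsum l" "set l \<subseteq> pairs" by (auto simp: products_def)
  have z: "ract Z 0 a = 0" using Z.act_scale_l[OF Z.zero_mem, of 0 a] by simp
  have "ract Z (tsum l) a = tsum (map (\<lambda>u. (fst u, ract Q (snd u) a)) l)" using l(2)
  proof (induction l)
    case Nil then show ?case by (simp add: tsum_def z)
  next
    case (Cons u l)
    have "tsum (u # l) = t (fst u) (snd u) + tsum l" by (simp add: tsum_def)
    then show ?case using Cons tsum_mem[of l] t_mem[of "fst u" "snd u"]
      by (auto simp: Z.act_add_l t_act) (simp add: tsum_def t_act)
  qed
  moreover have "set (map (\<lambda>u. (fst u, ract Q (snd u) a)) l) \<subseteq> pairs" using l(2) Q.act_mem by auto
  ultimately show "ract Z x a \<in> products" unfolding products_def l(1) by blast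
qed

lemma products_exhausting:
  assumes \<tau>: "schwarz_functional \<tau>" and bnd: "\<And>a. cmod (\<tau> a) \<le> norm a"
  shows "exhausting \<tau> Z products"
proof (rule Z.exhausting_dense[OF products_submodule \<tau>])
  fix v and \<epsilon> :: real
  assume v: "v \<in> hcarrier Z" and \<epsilon>: "0 < \<epsilon>"
  have e: "0 < sqrt \<epsilon>" using \<epsilon> by simp
  obtain l where l: "set l \<subseteq> pairs" "hnorm Z (v - (\<Sum>(\<xi>, \<zeta>)\<leftarrow>l. t \<xi> \<zeta>)) < sqrt \<epsilon>"
    using iso v e unfolding extends_to_tensor_iso_def by blast
  have "hnorm Z (v - tsum l) < sqrt \<epsilon>" using l(2) by (simp add: tsum_def case_prod_beta')
  then have "norm (hinner Z (v - tsum l) (v - tsum l)) < \<epsilon>"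
    unfolding hnorm_def by simp
  then have "sq_norm \<tau> Z (v - tsum l) < \<epsilon>" unfolding sq_norm_def
    using bnd complex_Re_le_cmod order.trans le_less_trans by metis
  then show "\<exists>d\<in>products. sq_norm \<tau> Z (v - d) < \<epsilon>" using l(1) unfolding products_def by blast
qed

text \<open>
  For a frame of P the operator \<open>S \<otimes> 1\<close> on finite sums of products satisfies
  (S \<open>\<otimes>\<close> 1)* (S \<open>\<otimes>\<close> 1) = 1 - \<open>\<Sum>\<close> t \<open>\<xi>\<close> (t \<open>\<xi>\<close>)*, where t \<open>\<xi>\<close> is multiplication by \<open>\<xi>\<close>. The proof only
  expands the tensor inner product, so that boundedness of \<open>S \<otimes> 1\<close> is not an issue.
\<close>

lemma frame_tsum:
  assumes fr: "frame P H S S'" and l: "set l \<subseteq> pairs"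
  shows "hinner Z (tsum (map (\<lambda>u. (S (fst u), snd u)) l)) (tsum (map (\<lambda>u. (S (fst u), snd u)) l))
    = hinner Z (tsum l) (tsum l) - (\<Sum>\<xi>\<leftarrow>H. hinner Q (annihilate l \<xi>) (annihilate l \<xi>))"
proof -
  have H: "\<And>\<xi>. \<xi> \<in> set H \<Longrightarrow> \<xi> \<in> hcarrier P" using P.frame_mem[OF fr] .
  let ?l = "map (\<lambda>u. (S (fst u), snd u)) l"
  have l': "set ?l \<subseteq> pairs" using l P.adjoint_mem[OF P.frame_adjoint[OF fr]] by auto
  have entry: "hinner Q (snd u) (lact Q (hinner P (S (fst u)) (S (fst v))) (snd v))
     = hinner Q (snd u) (lact Q (hinner P (fst u) (fst v)) (snd v))
       - (\<Sum>\<xi>\<leftarrow>H. hinner Q (lact Q (hinner P \<xi> (fst u)) (snd u)) (lact Q (hinner P \<xi> (fst v)) (snd v)))"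
    if uv: "u \<in> set l" "v \<in> set l" for u v
  proof -
    have m: "fst u \<in> hcarrier P" "snd u \<in> hcarrier Q" "fst v \<in> hcarrier P" "snd v \<in> hcarrier Q"
      using uv l by auto
    have "hinner Q (snd u) (lact Q (hinner P (S (fst u)) (S (fst v))) (snd v))
      = hinner Q (snd u) (lact Q (hinner P (fst u) (fst v)) (snd v))
        - (\<Sum>\<xi>\<leftarrow>H. hinner Q (snd u) (lact Q (hinner P (fst u) \<xi> * hinner P \<xi> (fst v)) (snd v)))"
      unfolding P.frame_ip[OF fr m(1,3)]
      using m H by (simp add: Q.lact_diff Q.lact_sum_list Q.ip_diff_r Q.lact_mem Q.sum_list_mem
          Q.ip_sum_list_r)
    also have "(\<Sum>\<xi>\<leftarrow>H. hinner Q (snd u) (lact Q (hinner P (fst u) \<xi> * hinner P \<xi> (fst v)) (snd v)))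
      = (\<Sum>\<xi>\<leftarrow>H. hinner Q (lact Q (hinner P \<xi> (fst u)) (snd u)) (lact Q (hinner P \<xi> (fst v)) (snd v)))"
      using m H by (intro arg_cong[where f = sum_list] map_cong)
        (auto simp: Q.lact_ip Q.lact_mem Q.lact_mult P.star_ip)
    finally show ?thesis .
  qed
  have "hinner Z (tsum ?l) (tsum ?l)
    = (\<Sum>u\<leftarrow>l. \<Sum>v\<leftarrow>l. hinner Q (snd u) (lact Q (hinner P (S (fst u)) (S (fst v))) (snd v)))"
    unfolding tsum_ip[OF l' l'] by (simp add: comp_def)
  also have "\<dots> = (\<Sum>u\<leftarrow>l. \<Sum>v\<leftarrow>l. hinner Q (snd u) (lact Q (hinner P (fst u) (fst v)) (snd v))
     - (\<Sum>\<xi>\<leftarrow>H. hinner Q (lact Q (hinner P \<xi> (fst u)) (snd u)) (lact Q (hinner P \<xi> (fst v)) (snd v))))"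
    by (intro arg_cong[where f = sum_list] map_cong refl) (rule entry)
  also have "\<dots> = hinner Z (tsum l) (tsum l)
     - (\<Sum>u\<leftarrow>l. \<Sum>v\<leftarrow>l. \<Sum>\<xi>\<leftarrow>H. hinner Q (lact Q (hinner P \<xi> (fst u)) (snd u)) (lact Q (hinner P \<xi> (fst v)) (snd v)))"
    unfolding tsum_ip[OF l l] by (simp only: sum_list_subtractf)
  also have "(\<Sum>u\<leftarrow>l. \<Sum>v\<leftarrow>l. \<Sum>\<xi>\<leftarrow>H. hinner Q (lact Q (hinner P \<xi> (fst u)) (snd u)) (lact Q (hinner P \<xi> (fst v)) (snd v)))
     = (\<Sum>u\<leftarrow>l. \<Sum>\<xi>\<leftarrow>H. \<Sum>v\<leftarrow>l. hinner Q (lact Q (hinner P \<xi> (fst u)) (snd u)) (lact Q (hinner P \<xi> (fst v)) (snd v)))"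
    by (intro arg_cong[where f = sum_list] map_cong refl sum_list_commute)
  also have "\<dots> = (\<Sum>\<xi>\<leftarrow>H. \<Sum>u\<leftarrow>l. \<Sum>v\<leftarrow>l. hinner Q (lact Q (hinner P \<xi> (fst u)) (snd u)) (lact Q (hinner P \<xi> (fst v)) (snd v)))"
    by (rule sum_list_commute)
  also have "\<dots> = (\<Sum>\<xi>\<leftarrow>H. hinner Q (annihilate l \<xi>) (annihilate l \<xi>))"
  proof (intro arg_cong[where f = sum_list] map_cong refl)
    fix \<xi>
    have m: "\<And>u. u \<in> set l \<Longrightarrow> lact Q (hinner P \<xi> (fst u)) (snd u) \<in> hcarrier Q"
      using l by (intro Q.lact_mem pairs_mem)
    have "hinner Q (annihilate l \<xi>) (annihilate l \<xi>) = (\<Sum>u\<leftarrow>l. hinner Q (lact Q (hinner P \<xi> (fst u)) (snd u)) (annihilate l \<xi>))"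
      unfolding annihilate_def[of l] by (rule Q.ip_sum_list_l) (use m in \<open>auto intro: Q.sum_list_mem\<close>)
    also have "\<dots> = (\<Sum>u\<leftarrow>l. \<Sum>v\<leftarrow>l. hinner Q (lact Q (hinner P \<xi> (fst u)) (snd u)) (lact Q (hinner P \<xi> (fst v)) (snd v)))"
      unfolding annihilate_def[of l]
      by (intro arg_cong[where f = sum_list] map_cong refl Q.ip_sum_list_r) (use m in auto)
    finally show "(\<Sum>u\<leftarrow>l. \<Sum>v\<leftarrow>l. hinner Q (lact Q (hinner P \<xi> (fst u)) (snd u)) (lact Q (hinner P \<xi> (fst v)) (snd v)))
      = hinner Q (annihilate l \<xi>) (annihilate l \<xi>)" by simp
  qed
  finally show ?thesis .
qed

lemma frame_tsum_sq_norm: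
  assumes "frame P H S S'" "set l \<subseteq> pairs" "positive_functional \<tau>"
  shows "sq_norm \<tau> Z (tsum (map (\<lambda>u. (S (fst u), snd u)) l))
    = sq_norm \<tau> Z (tsum l) - (\<Sum>\<xi>\<leftarrow>H. sq_norm \<tau> Q (annihilate l \<xi>))"
  unfolding sq_norm_def frame_tsum[OF assms(1,2)] using assms(3)
  by (simp add: positive_functional_diff positive_functional_sum_list P.Re_sum_list)

lemma annihilate_bessel:
  assumes fr: "frame P H S S'" and l: "set l \<subseteq> pairs" and pf: "positive_functional \<tau>"
  shows "(\<Sum>\<xi>\<leftarrow>H. sq_norm \<tau> Q (annihilate l \<xi>)) \<le> sq_norm \<tau> Z (tsum l)"
proof -
  have m: "set (map (\<lambda>u. (S (fst u), snd u)) l) \<subseteq> pairs"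
    using l P.adjoint_mem[OF P.frame_adjoint[OF fr]] by auto
  then show ?thesis
    using frame_tsum_sq_norm[OF assms] Z.sq_norm_nonneg[OF pf tsum_mem[OF m]] by linarith
qed

lemma lact_tsum:
  "set l \<subseteq> pairs \<Longrightarrow> lact Z a (tsum l) = tsum (map (\<lambda>u. (lact P a (fst u), snd u)) l)"
  unfolding tsum_def
  by (subst Z.adjoint_sum_list[OF Z.lact_adjoint])
    (auto simp: t_lact pairs_mem comp_def intro!: t_mem pairs_mem arg_cong[where f = sum_list] map_cong)

lemma annihilate_lact:
  assumes "set l \<subseteq> pairs" "\<xi> \<in> hcarrier P"
  shows "annihilate (map (\<lambda>u. (lact P (star a) (fst u), snd u)) l) \<xi> = annihilate l (lact P a \<xi>)"
  unfolding annihilate_def using assms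
  by (auto simp: comp_def P.lact_ip pairs_mem intro!: arg_cong[where f = sum_list] map_cong)

text \<open>
  The seminorm of a product \<open>\<xi>\<eta>\<close> under \<open>\<tau>\<close> is that of \<open>\<xi>\<close> under the vector functional of \<open>\<eta>\<close>. The crude
  power of 2 comes from using the parallelogram law once for each summand.
\<close>

lemma sq_norm_tsum_le:
  assumes pf: "positive_functional \<tau>" and l: "set l \<subseteq> pairs"
    and small: "\<And>u. u \<in> set l \<Longrightarrow> sq_norm (\<lambda>a. \<tau> (hinner Q (snd u) (lact Q a (snd u)))) P (fst u) \<le> \<epsilon>"
  shows "sq_norm \<tau> Z (tsum l) \<le> 2 ^ length l * (real (length l) * \<epsilon>)"
  using l small
proof (induction l)
  case Nil
  then show ?case
    by (simp add: tsum_def sq_norm_def Z.ip_zero_r Z.zero_mem positive_functional_zero[OF pf])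
next
  case (Cons u l)
  have m: "fst u \<in> hcarrier P" "snd u \<in> hcarrier Q" "set l \<subseteq> pairs" using Cons.prems by auto
  have IH: "sq_norm \<tau> Z (tsum l) \<le> 2 ^ length l * (real (length l) * \<epsilon>)" using Cons by auto
  have "sq_norm \<tau> Z (t (fst u) (snd u)) = sq_norm (\<lambda>a. \<tau> (hinner Q (snd u) (lact Q a (snd u)))) P (fst u)"
    using m by (simp add: sq_norm_def t_ip)
  also have u: "\<dots> \<le> \<epsilon>" using Cons.prems by simp
  finally have t: "sq_norm \<tau> Z (t (fst u) (snd u)) \<le> \<epsilon>" .
  have "0 \<le> \<epsilon>" using t Z.sq_norm_nonneg[OF pf t_mem] m by force
  have "tsum (u # l) = t (fst u) (snd u) + tsum l" by (simp add: tsum_def)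
  then have "sq_norm \<tau> Z (tsum (u # l)) \<le> 2 * sq_norm \<tau> Z (t (fst u) (snd u)) + 2 * sq_norm \<tau> Z (tsum l)"
    using Z.sq_norm_add_le[OF pf t_mem tsum_mem] m by simp
  also have "\<dots> \<le> 2 * (2 ^ length l * \<epsilon>) + 2 * (2 ^ length l * (real (length l) * \<epsilon>))"
    using t IH \<open>0 \<le> \<epsilon>\<close> mult_right_mono[of 1 "2 ^ length l" \<epsilon>] by simp
  also have "\<dots> = 2 ^ length (u # l) * (real (length (u # l)) * \<epsilon>)"
    by (simp add: algebra_simps)
  finally show ?case .
qed

text \<open>
  Exchanging an arbitrary frame with one made of finite sums of products costs nothing in the limit, but
  turns b into its adjoint.
\<close>

lemma frame_in_products_above:
  assumes \<tau>: "schwarz_functional \<tau>" and bnd: "\<And>a. cmod (\<tau> a) \<le> norm a"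
    and tr: "\<And>a b. \<tau> (a * b) = \<tau> (b * a)"
    and y: "ereal y < induced_trace Z \<tau> (lact Z (star b * b))"
  obtains L S S' where "frame Z L S S'" "set L \<subseteq> products"
    "y < (\<Sum>\<zeta>\<leftarrow>L. sq_norm \<tau> Z (lact Z (star b) \<zeta>))"
proof -
  have pf: "positive_functional \<tau>" using \<tau> unfolding schwarz_functional_def by blast
  obtain M R R' where M: "frame Z M R R'" "y < (\<Sum>\<eta>\<leftarrow>M. sq_norm \<tau> Z (lact Z b \<eta>))"
    using Z.frame_above[OF y] Z.frame_sum_eq by metis
  have "\<not> (\<forall>L S S'. frame Z L S S' \<longrightarrow> set L \<subseteq> products \<longrightarrow>
      (\<Sum>\<zeta>\<leftarrow>L. sq_norm \<tau> Z (lact Z (star b) \<zeta>)) \<le> y)"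
    using Z.trace_exchange[OF pf tr products_exhausting[OF \<tau> bnd] M(1), of b y] M(2)
    by (metis not_le)
  then show ?thesis using that by (auto simp: not_le)
qed

definition reps :: "'x \<Rightarrow> ('x \<times> 'x) list" where
  "reps z = (SOME l. set l \<subseteq> pairs \<and> tsum l = z)"

lemma reps:
  assumes "z \<in> products"
  shows "set (reps z) \<subseteq> pairs" and "tsum (reps z) = z"
  using someI_ex[of "\<lambda>l. set l \<subseteq> pairs \<and> tsum l = z"] assms
  unfolding reps_def products_def by auto

lemma annihilate_adjoint:
  assumes "\<zeta> \<in> products" "\<xi> \<in> hcarrier P" "\<eta> \<in> hcarrier Q"
  shows "hinner Z (t \<xi> \<eta>) \<zeta> = hinner Q \<eta> (annihilate (reps \<zeta>) \<xi>)"
    and "hinner Z \<zeta> (t \<xi> \<eta>) = hinner Q (annihilate (reps \<zeta>) \<xi>) \<eta>"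
proof -
  show *: "hinner Z (t \<xi> \<eta>) \<zeta> = hinner Q \<eta> (annihilate (reps \<zeta>) \<xi>)"
    using annihilate_ip[OF reps(1)[OF assms(1)] assms(2,3)] reps(2)[OF assms(1)] by simp
  have \<zeta>: "\<zeta> \<in> hcarrier Z" using assms(1) products_submodule unfolding submodule_def by blast
  have "hinner Z \<zeta> (t \<xi> \<eta>) = star (hinner Z (t \<xi> \<eta>) \<zeta>)"
    using Z.star_ip[OF t_mem \<zeta>] assms by simp
  also have "\<dots> = hinner Q (annihilate (reps \<zeta>) \<xi>) \<eta>"
    unfolding * using Q.star_ip annihilate_mem reps assms by simp
  finally show "hinner Z \<zeta> (t \<xi> \<eta>) = hinner Q (annihilate (reps \<zeta>) \<xi>) \<eta>" .
qed

lemma sq_norm_t: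
  "\<xi> \<in> hcarrier P \<Longrightarrow> \<eta> \<in> hcarrier Q \<Longrightarrow>
    sq_norm \<tau> Z (t \<xi> \<eta>) = Re (\<tau> (hinner Q \<eta> (lact Q (hinner P \<xi> \<xi>) \<eta>)))"
  by (simp add: sq_norm_def t_ip)

text \<open>
  The trace over Z is nearly attained by a frame L of finite sums of products. Resolve these sums by
  a frame H of P, which only involves the vector functionals of their right hand factors;
  this is the smallness demanded of H. What remains is a sum over \<open>\<xi>\<close> in H of quantities that
  \<open>frame_exchange\<close> bounds by the trace over Q of \<open>\<langle>b\<xi>, b\<xi>\<rangle>\<close>. The conclusion holds for
  all frames that are small on a given finite list, so that the lists of several modules Q can be joined.
\<close>

lemma trace_in_stages_le:
  assumes \<tau>: "schwarz_functional \<tau>" and bnd: "\<And>a. cmod (\<tau> a) \<le> norm a"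
    and tr: "\<And>a b. \<tau> (a * b) = \<tau> (b * a)"
    and y: "ereal y < induced_trace Z \<tau> (lact Z (star b * b))"
    and g: "\<And>\<xi>. \<xi> \<in> hcarrier P \<Longrightarrow>
      induced_trace Q \<tau> (lact Q (hinner P (lact P b \<xi>) (lact P b \<xi>))) = ereal (g \<xi>)"
  shows "\<exists>ps \<epsilon>. 0 < \<epsilon> \<and> (\<forall>(\<sigma>, z)\<in>set ps. schwarz_functional \<sigma> \<and> z \<in> hcarrier P) \<and>
    (\<forall>H S S'. frame P H S S' \<longrightarrow> (\<forall>(\<sigma>, z)\<in>set ps. sq_norm \<sigma> P (S z) < \<epsilon>) \<longrightarrow>
      y \<le> (\<Sum>\<xi>\<leftarrow>H. g \<xi>))"
proof -
  have pf: "positive_functional \<tau>" using \<tau> unfolding schwarz_functional_def by blast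
  obtain L R R' where L: "frame Z L R R'" "set L \<subseteq> products"
    and Ly: "y < (\<Sum>\<zeta>\<leftarrow>L. sq_norm \<tau> Z (lact Z (star b) \<zeta>))"
    using frame_in_products_above[OF \<tau> bnd tr y] by blast
  define c where "c = (\<Sum>\<zeta>\<leftarrow>L. 2 ^ length (reps \<zeta>) * real (length (reps \<zeta>)))"
  have c: "0 \<le> c" unfolding c_def by (intro sum_list_nonneg) auto
  define \<epsilon> where "\<epsilon> = ((\<Sum>\<zeta>\<leftarrow>L. sq_norm \<tau> Z (lact Z (star b) \<zeta>)) - y) / (c + 1)"
  have \<epsilon>: "0 < \<epsilon>" unfolding \<epsilon>_def using Ly c by simp
  define \<sigma> where "\<sigma> = (\<lambda>\<eta> a. \<tau> (hinner Q \<eta> (lact Q a \<eta>)))"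
  define ps where
    "ps = concat (map (\<lambda>\<zeta>. map (\<lambda>u. (\<sigma> (snd u), lact P (star b) (fst u))) (reps \<zeta>)) L)"
  have repL: "set (reps \<zeta>) \<subseteq> pairs" "tsum (reps \<zeta>) = \<zeta>" if "\<zeta> \<in> set L" for \<zeta>
    using reps L(2) that by blast+
  have "\<forall>(\<sigma>, z)\<in>set ps. schwarz_functional \<sigma> \<and> z \<in> hcarrier P"
  proof (intro ballI, clarify)
    fix \<rho> z assume "(\<rho>, z) \<in> set ps"
    then obtain \<zeta> u where "\<zeta> \<in> set L" "u \<in> set (reps \<zeta>)" "\<rho> = \<sigma> (snd u)" "z = lact P (star b) (fst u)"
      by (auto simp: ps_def)
    then show "schwarz_functional \<rho> \<and> z \<in> hcarrier P"
      using pairs_mem[OF repL(1)] P.lact_mem Q.vector_functional_schwarz[OF pf]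
      unfolding \<sigma>_def by blast
  qed
  moreover have "y \<le> (\<Sum>\<xi>\<leftarrow>H. g \<xi>)"
    if fr: "frame P H S S'" and small: "\<forall>(\<sigma>, z)\<in>set ps. sq_norm \<sigma> P (S z) < \<epsilon>" for H S S'
  proof -
    have H: "\<And>\<xi>. \<xi> \<in> set H \<Longrightarrow> \<xi> \<in> hcarrier P" using P.frame_mem[OF fr] .
    have one: "sq_norm \<tau> Z (lact Z (star b) \<zeta>)
        \<le> (\<Sum>\<xi>\<leftarrow>H. sq_norm \<tau> Q (annihilate (reps \<zeta>) (lact P b \<xi>)))
          + 2 ^ length (reps \<zeta>) * real (length (reps \<zeta>)) * \<epsilon>" if \<zeta>: "\<zeta> \<in> set L" for \<zeta>
    proof -
      let ?l = "map (\<lambda>u. (lact P (star b) (fst u), snd u)) (reps \<zeta>)"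
      let ?m = "map (\<lambda>u. (S (fst u), snd u)) ?l"
      have l: "set ?l \<subseteq> pairs" using repL(1)[OF \<zeta>] P.lact_mem by auto
      have m: "set ?m \<subseteq> pairs" using l P.adjoint_mem[OF P.frame_adjoint[OF fr]] by auto
      have "sq_norm \<tau> Z (tsum ?m) \<le> 2 ^ length ?m * (real (length ?m) * \<epsilon>)"
      proof (rule sq_norm_tsum_le[OF pf m])
        fix u assume "u \<in> set ?m"
        then obtain v where v: "v \<in> set (reps \<zeta>)" "u = (S (lact P (star b) (fst v)), snd v)" by auto
        then have "(\<sigma> (snd v), lact P (star b) (fst v)) \<in> set ps" using \<zeta> by (auto simp: ps_def)
        then have "sq_norm (\<sigma> (snd v)) P (S (lact P (star b) (fst v))) < \<epsilon>" using small by blast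
        then show "sq_norm (\<lambda>a. \<tau> (hinner Q (snd u) (lact Q a (snd u)))) P (fst u) \<le> \<epsilon>"
          by (simp add: v(2) \<sigma>_def)
      qed
      moreover have "sq_norm \<tau> Z (tsum ?m)
          = sq_norm \<tau> Z (tsum ?l) - (\<Sum>\<xi>\<leftarrow>H. sq_norm \<tau> Q (annihilate ?l \<xi>))"
        by (rule frame_tsum_sq_norm[OF fr l pf])
      moreover have "tsum ?l = lact Z (star b) \<zeta>"
        using lact_tsum[OF repL(1)[OF \<zeta>], of "star b"] repL(2)[OF \<zeta>] by simp
      moreover have "(\<Sum>\<xi>\<leftarrow>H. sq_norm \<tau> Q (annihilate ?l \<xi>))
          = (\<Sum>\<xi>\<leftarrow>H. sq_norm \<tau> Q (annihilate (reps \<zeta>) (lact P b \<xi>)))"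
        using annihilate_lact[OF repL(1)[OF \<zeta>] H]
        by (intro arg_cong[where f = sum_list] map_cong) auto
      ultimately show ?thesis by (simp add: mult.assoc)
    qed
    have two: "(\<Sum>\<zeta>\<leftarrow>L. sq_norm \<tau> Q (annihilate (reps \<zeta>) (lact P b \<xi>))) \<le> g \<xi>"
      if \<xi>: "\<xi> \<in> set H" for \<xi>
    proof -
      have b\<xi>: "lact P b \<xi> \<in> hcarrier P" using H[OF \<xi>] P.lact_mem by blast
      have "(\<Sum>i\<leftarrow>[()]. \<Sum>\<zeta>\<leftarrow>L. sq_norm \<tau> Q (annihilate (reps \<zeta>) (lact P b \<xi>))) \<le> g \<xi>"
      proof (rule frame_exchange[where Y = "\<lambda>_. Z" and M = "\<lambda>_. L" and D = "hcarrier Q"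
            and V' = "\<lambda>_ \<eta>. t (lact P b \<xi>) \<eta>"])
        fix M T T' assume M: "frame Q M T T'"
        have "(\<Sum>\<eta>\<leftarrow>M. sq_norm \<tau> Z (t (lact P b \<xi>) \<eta>))
          = (\<Sum>\<eta>\<leftarrow>M. Re (\<tau> (hinner Q \<eta> (lact Q (hinner P (lact P b \<xi>) (lact P b \<xi>)) \<eta>))))"
          using Q.frame_mem[OF M] b\<xi>
          by (intro arg_cong[where f = sum_list] map_cong refl sq_norm_t) auto
        also have "\<dots> \<le> g \<xi>" using Q.lact_trace_ge[OF M pf] g[OF H[OF \<xi>]] by (metis ereal_less_eq(3))
        finally show "(\<Sum>\<eta>\<leftarrow>M. \<Sum>i\<leftarrow>[()]. sq_norm \<tau> Z (t (lact P b \<xi>) \<eta>)) \<le> g \<xi>" by simp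
      qed (use Q.hm Z.hm pf tr Q.exhausting_carrier[OF \<tau>] L repL b\<xi> in
          \<open>auto intro: annihilate_mem t_mem simp: annihilate_adjoint(2) subset_iff\<close>)
      then show ?thesis by simp
    qed
    have "(\<Sum>\<zeta>\<leftarrow>L. sq_norm \<tau> Z (lact Z (star b) \<zeta>))
      \<le> (\<Sum>\<zeta>\<leftarrow>L. (\<Sum>\<xi>\<leftarrow>H. sq_norm \<tau> Q (annihilate (reps \<zeta>) (lact P b \<xi>)))
          + 2 ^ length (reps \<zeta>) * real (length (reps \<zeta>)) * \<epsilon>)"
      by (intro sum_list_mono one)
    also have "\<dots> = (\<Sum>\<xi>\<leftarrow>H. \<Sum>\<zeta>\<leftarrow>L. sq_norm \<tau> Q (annihilate (reps \<zeta>) (lact P b \<xi>))) + c * \<epsilon>"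
      unfolding c_def sum_list_addf sum_list_mult_const by (subst sum_list_commute) simp
    also have "\<dots> \<le> (\<Sum>\<xi>\<leftarrow>H. g \<xi>) + c * \<epsilon>"
      by (intro add_right_mono sum_list_mono two)
    also have "(\<Sum>\<zeta>\<leftarrow>L. sq_norm \<tau> Z (lact Z (star b) \<zeta>)) = y + (c + 1) * \<epsilon>"
      unfolding \<epsilon>_def using c by simp
    finally show ?thesis using \<epsilon> by (simp add: algebra_simps)
  qed
  ultimately show ?thesis using \<epsilon> by blast
qed

text \<open>
  For each \<open>\<xi>\<close> in H choose a frame of Q that nearly attains the trace of \<open>\<langle>b\<xi>, b\<xi>\<rangle>\<close>, and exchange all of
  them with one frame L of Z. The resulting sum over H is bounded by Bessel's inequality for H.
\<close>

lemma trace_in_stages_ge: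
  assumes \<tau>: "schwarz_functional \<tau>" and bnd: "\<And>a. cmod (\<tau> a) \<le> norm a"
    and tr: "\<And>a b. \<tau> (a * b) = \<tau> (b * a)"
    and B: "induced_trace Z \<tau> (lact Z (star b * b)) \<le> ereal B"
    and g: "\<And>\<xi>. \<xi> \<in> hcarrier P \<Longrightarrow>
      induced_trace Q \<tau> (lact Q (hinner P (lact P b \<xi>) (lact P b \<xi>))) = ereal (g \<xi>)"
    and fr: "frame P H S S'"
  shows "(\<Sum>\<xi>\<leftarrow>H. g \<xi>) \<le> B"
proof -
  have pf: "positive_functional \<tau>" using \<tau> unfolding schwarz_functional_def by blast
  have H: "\<And>\<xi>. \<xi> \<in> set H \<Longrightarrow> \<xi> \<in> hcarrier P" using P.frame_mem[OF fr] .
  have bH: "lact P b \<xi> \<in> hcarrier P" if "\<xi> \<in> set H" for \<xi> using H[OF that] P.lact_mem by blast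
  have almost: "(\<Sum>\<xi>\<leftarrow>H. g \<xi> - \<delta>) \<le> B" if \<delta>: "0 < \<delta>" for \<delta>
  proof -
    have "\<exists>M R R'. frame Q M R R' \<and> g \<xi> - \<delta> < (\<Sum>\<eta>\<leftarrow>M. sq_norm \<tau> Z (t (lact P b \<xi>) \<eta>))"
      if \<xi>: "\<xi> \<in> set H" for \<xi>
    proof -
      have "ereal (g \<xi> - \<delta>) < induced_trace Q \<tau> (lact Q (hinner P (lact P b \<xi>) (lact P b \<xi>)))"
        using g[OF H[OF \<xi>]] \<delta> by simp
      then obtain M R R' where M: "frame Q M R R'" "g \<xi> - \<delta>
          < (\<Sum>\<eta>\<leftarrow>M. Re (\<tau> (hinner Q \<eta> (lact Q (hinner P (lact P b \<xi>) (lact P b \<xi>)) \<eta>))))"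
        using Q.frame_above by metis
      moreover have "(\<Sum>\<eta>\<leftarrow>M. sq_norm \<tau> Z (t (lact P b \<xi>) \<eta>))
          = (\<Sum>\<eta>\<leftarrow>M. Re (\<tau> (hinner Q \<eta> (lact Q (hinner P (lact P b \<xi>) (lact P b \<xi>)) \<eta>))))"
        using Q.frame_mem[OF M(1)] bH[OF \<xi>]
        by (intro arg_cong[where f = sum_list] map_cong refl sq_norm_t) auto
      ultimately show ?thesis by metis
    qed
    then obtain M R R' where M: "\<And>\<xi>. \<xi> \<in> set H \<Longrightarrow> frame Q (M \<xi>) (R \<xi>) (R' \<xi>)"
      "\<And>\<xi>. \<xi> \<in> set H \<Longrightarrow> g \<xi> - \<delta> < (\<Sum>\<eta>\<leftarrow>M \<xi>. sq_norm \<tau> Z (t (lact P b \<xi>) \<eta>))"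
      by metis
    have QM: "\<eta> \<in> hcarrier Q" if "\<xi> \<in> set H" "\<eta> \<in> set (M \<xi>)" for \<xi> \<eta>
      using Q.frame_mem[OF M(1)] that by blast
    have "(\<Sum>\<xi>\<leftarrow>H. g \<xi> - \<delta>) \<le> (\<Sum>\<xi>\<leftarrow>H. \<Sum>\<eta>\<leftarrow>M \<xi>. sq_norm \<tau> Z (t (lact P b \<xi>) \<eta>))"
      using M(2) by (intro sum_list_mono) (auto intro: less_imp_le)
    also have "\<dots> \<le> B"
    proof (rule frame_exchange[where Y = "\<lambda>_. Q" and D = products and R = R and R' = R'
          and V' = "\<lambda>\<xi> \<zeta>. annihilate (reps \<zeta>) (lact P b \<xi>)"])
      fix L T T' assume L: "frame Z L T T'" "set L \<subseteq> products"
      have "(\<Sum>\<xi>\<leftarrow>H. sq_norm \<tau> Q (annihilate (reps \<zeta>) (lact P b \<xi>))) \<le> sq_norm \<tau> Z (lact Z (star b) \<zeta>)"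
        if \<zeta>: "\<zeta> \<in> set L" for \<zeta>
      proof -
        have r: "set (reps \<zeta>) \<subseteq> pairs" "tsum (reps \<zeta>) = \<zeta>" using reps L(2) \<zeta> by blast+
        let ?l = "map (\<lambda>u. (lact P (star b) (fst u), snd u)) (reps \<zeta>)"
        have l: "set ?l \<subseteq> pairs" using r P.lact_mem by auto
        have "(\<Sum>\<xi>\<leftarrow>H. sq_norm \<tau> Q (annihilate (reps \<zeta>) (lact P b \<xi>)))
            = (\<Sum>\<xi>\<leftarrow>H. sq_norm \<tau> Q (annihilate ?l \<xi>))"
          using annihilate_lact[OF r(1) H]
          by (intro arg_cong[where f = sum_list] map_cong) auto
        also have "\<dots> \<le> sq_norm \<tau> Z (tsum ?l)" by (rule annihilate_bessel[OF fr l pf])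
        also have "tsum ?l = lact Z (star b) \<zeta>" using lact_tsum[OF r(1), of "star b"] r(2) by simp
        finally show ?thesis .
      qed
      then have "(\<Sum>\<zeta>\<leftarrow>L. \<Sum>\<xi>\<leftarrow>H. sq_norm \<tau> Q (annihilate (reps \<zeta>) (lact P b \<xi>)))
          \<le> (\<Sum>\<zeta>\<leftarrow>L. sq_norm \<tau> Z (lact Z (star b) \<zeta>))"
        by (intro sum_list_mono)
      also have "\<dots> \<le> B"
      proof (rule Z.trace_exchange[OF pf tr Z.exhausting_carrier[OF \<tau>] L(1)])
        fix K U U' assume K: "frame Z K U U'"
        have "ereal (\<Sum>\<zeta>\<leftarrow>K. sq_norm \<tau> Z (lact Z b \<zeta>)) \<le> ereal B"
          using Z.lact_trace_ge[OF K pf, of "star b * b"] B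
          unfolding Z.frame_sum_eq[OF K] by (rule order.trans)
        then show "(\<Sum>\<zeta>\<leftarrow>K. sq_norm \<tau> Z (lact Z (star (star b)) \<zeta>)) \<le> B"
          by (simp add: star_star)
      qed
      finally show "(\<Sum>\<zeta>\<leftarrow>L. \<Sum>\<xi>\<leftarrow>H. sq_norm \<tau> Q (annihilate (reps \<zeta>) (lact P b \<xi>))) \<le> B" .
    qed (use Q.hm Z.hm pf tr products_exhausting[OF \<tau> bnd] M(1) in
        \<open>auto intro: annihilate_mem[OF reps(1)] t_mem annihilate_adjoint(1) bH QM\<close>)
    finally show ?thesis .
  qed
  have *: "(\<Sum>\<xi>\<leftarrow>H. g \<xi>) \<le> B + real (length H) * \<delta>" if "0 < \<delta>" for \<delta>
    using almost[OF that] by (simp add: sum_list_subtractf sum_list_triv)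
  have "(\<Sum>\<xi>\<leftarrow>H. g \<xi>) \<le> B + \<epsilon>" if \<epsilon>: "0 < \<epsilon>" for \<epsilon>
  proof -
    have "(\<Sum>\<xi>\<leftarrow>H. g \<xi>) \<le> B + real (length H) * (\<epsilon> / (real (length H) + 1))"
      by (rule *) (use \<epsilon> in simp)
    also have "real (length H) * (\<epsilon> / (real (length H) + 1)) \<le> \<epsilon>"
      using \<epsilon> by (simp add: field_simps)
    finally show ?thesis by simp
  qed
  then show ?thesis by (rule field_le_epsilon)
qed

end

section \<open>Alternating sums over intersections\<close>

text \<open>
  The inclusion-exclusion sum over the sub-lists of the list of sets, for a function G on sets instead of a
  measure: \<open>alt_sum_subsets\<close> gives the closed form.
\<close>

fun alt_sum :: "('p set \<Rightarrow> real) \<Rightarrow> 'p set \<Rightarrow> 'p set list \<Rightarrow> real" where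
  "alt_sum G M [] = G M"
| "alt_sum G M (B # Bs) = alt_sum G M Bs - alt_sum G (M \<inter> B) Bs"

lemma alt_sum_insert:
  "alt_sum G M (As @ B # Bs) = alt_sum G M (As @ Bs) - alt_sum G (M \<inter> B) (As @ Bs)"
proof (induction As arbitrary: M)
  case (Cons A As)
  have "M \<inter> A \<inter> B = M \<inter> B \<inter> A" by blast
  then show ?case by (simp add: Cons)
qed simp

lemma alt_sum_superset:
  assumes "B \<in> set Bs" "M \<subseteq> B"
  shows "alt_sum G M Bs = 0"
proof -
  obtain Cs Ds where "Bs = Cs @ B # Ds" using split_list[OF assms(1)] by blast
  then show ?thesis using assms(2) by (simp add: alt_sum_insert Int_absorb2)
qed

text \<open>
  Inclusion-exclusion form of 1 - 1_B = (1 - 1_A) + 1_A (1 - 1_B).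
\<close>

lemma alt_sum_split:
  assumes "B \<subseteq> A"
  shows "alt_sum G M (As @ B # Bs) = alt_sum G M (As @ A # Bs) + alt_sum G (M \<inter> A) (As @ B # Bs)"
proof -
  have "M \<inter> A \<inter> B = M \<inter> B" using assms by blast
  then show ?thesis by (simp add: alt_sum_insert)
qed

lemma alt_sum_restrict: "alt_sum G (M \<inter> A) Bs = alt_sum G (M \<inter> A) (map (\<lambda>B. A \<inter> B) Bs)"
proof (induction Bs arbitrary: M)
  case (Cons B Bs)
  have "M \<inter> A \<inter> B = M \<inter> B \<inter> A" "M \<inter> A \<inter> (A \<inter> B) = M \<inter> B \<inter> A" by blast+
  then show ?case using Cons[of M] Cons[of "M \<inter> B"] by simp
qed simp

lemma alt_sum_image:
  assumes "inj f"
  shows "alt_sum G (f ` M) (map ((`) f) Bs) = alt_sum (\<lambda>S. G (f ` S)) M Bs"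
  by (induction Bs arbitrary: M) (simp_all add: image_Int[OF assms, symmetric])

lemma alt_sum_empty: "G {} = 0 \<Longrightarrow> alt_sum G {} Bs = 0"
  by (induction Bs) auto

lemma alt_sum_filter_nonempty:
  assumes "G {} = 0"
  shows "alt_sum G M (filter (\<lambda>B. B \<noteq> {}) Bs) = alt_sum G M Bs"
  by (induction Bs arbitrary: M) (auto simp: alt_sum_empty[of G, OF assms])

lemma alt_sum_remdups: "alt_sum G M (map f (remdups xs)) = alt_sum G M (map f xs)"
proof (induction xs arbitrary: M)
  case (Cons x xs)
  have "alt_sum G (M \<inter> f x) (map f xs) = 0" if "x \<in> set xs"
    using that by (intro alt_sum_superset[of "f x"]) auto
  then show ?case using Cons by simp
qed simp

lemma alt_sum_linear:
  "alt_sum (\<lambda>S. c * (\<Sum>x\<leftarrow>xs. F x S)) M Bs = c * (\<Sum>x\<leftarrow>xs. alt_sum (F x) M Bs)"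
  by (induction Bs arbitrary: M) (simp_all add: sum_list_subtractf right_diff_distrib)

text \<open>
  The sets at which G is evaluated in the alternating sum.
\<close>

fun meets :: "'p set \<Rightarrow> 'p set list \<Rightarrow> 'p set set" where
  "meets M [] = {M}"
| "meets M (B # Bs) = meets M Bs \<union> meets (M \<inter> B) Bs"

lemma finite_meets: "finite (meets M Bs)"
  by (induction Bs arbitrary: M) auto

lemma alt_sum_near:
  assumes "\<And>S. S \<in> meets M Bs \<Longrightarrow> \<bar>G S - F S\<bar> \<le> \<epsilon>"
  shows "\<bar>alt_sum G M Bs - alt_sum F M Bs\<bar> \<le> 2 ^ length Bs * \<epsilon>"
  using assms
proof (induction Bs arbitrary: M)
  case (Cons B Bs)
  have "\<bar>alt_sum G M Bs - alt_sum F M Bs\<bar> \<le> 2 ^ length Bs * \<epsilon>"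
    "\<bar>alt_sum G (M \<inter> B) Bs - alt_sum F (M \<inter> B) Bs\<bar> \<le> 2 ^ length Bs * \<epsilon>"
    using Cons by auto
  then show ?case by (simp add: algebra_simps)
qed simp

lemma alt_sum_subsets:
  assumes "distinct js"
  shows "alt_sum G M (map f js) = (\<Sum>K\<in>Pow (set js). (-1) ^ card K * G (M \<inter> \<Inter>(f ` K)))"
  using assms
proof (induction js arbitrary: M)
  case (Cons j js)
  have j: "j \<notin> set js" using Cons.prems by simp
  have inj: "inj_on (insert j) (Pow (set js))"
    using j by (auto simp: inj_on_def)
  have "(\<Sum>K\<in>Pow (set (j # js)). (-1) ^ card K * G (M \<inter> \<Inter>(f ` K)))
     = (\<Sum>K\<in>Pow (set js). (-1) ^ card K * G (M \<inter> \<Inter>(f ` K)))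
     + (\<Sum>K\<in>insert j ` Pow (set js). (-1) ^ card K * G (M \<inter> \<Inter>(f ` K)))"
    unfolding list.set Pow_insert by (rule sum.union_disjoint) (use j in auto)
  also have "(\<Sum>K\<in>insert j ` Pow (set js). (-1) ^ card K * G (M \<inter> \<Inter>(f ` K)))
     = (\<Sum>K\<in>Pow (set js). - ((-1) ^ card K * G (M \<inter> f j \<inter> \<Inter>(f ` K))))"
    unfolding sum.reindex[OF inj] comp_def
  proof (rule sum.cong[OF refl])
    fix K assume K: "K \<in> Pow (set js)"
    then have "finite K" "j \<notin> K" using j finite_subset by auto
    moreover have "M \<inter> \<Inter> (f ` insert j K) = M \<inter> f j \<inter> \<Inter> (f ` K)" by auto
    ultimately show "(-1) ^ card (insert j K) * G (M \<inter> \<Inter> (f ` insert j K))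
      = - ((-1) ^ card K * G (M \<inter> f j \<inter> \<Inter> (f ` K)))" by simp
  qed
  finally show ?case using Cons by (simp add: sum_negf)
qed simp

section \<open>Right LCM monoids\<close>

lemma right_multiples_mult: "right_multiples (p * q) = (*) p ` right_multiples (q::'p::monoid_mult)"
  unfolding right_multiples_def by (auto simp: image_image mult.assoc)

lemma right_multiples_one: "right_multiples (1::'p::monoid_mult) = UNIV"
  unfolding right_multiples_def by auto

lemma self_in_right_multiples: "r \<in> right_multiples (r::'p::monoid_mult)"
  unfolding right_multiples_def by (metis mult_1_right rangeI)

text \<open>
  Right LCMs thereby become equations between right ideals, and the choice of the LCM disappears.
\<close>

lemma is_right_lcm_iff:
  "is_right_lcm r U \<longleftrightarrow> (\<Inter>q\<in>U. right_multiples q) = right_multiples (r::'p::monoid_mult)"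
proof
  assume l: "is_right_lcm r U"
  have "right_multiples r \<subseteq> right_multiples q" if "q \<in> U" for q
  proof -
    have "r \<in> right_multiples q" using l that unfolding is_right_lcm_def by blast
    then obtain x where "r = q * x" unfolding right_multiples_def by blast
    then show ?thesis unfolding right_multiples_def by (auto simp: mult.assoc)
  qed
  then show "(\<Inter>q\<in>U. right_multiples q) = right_multiples r"
    using l unfolding is_right_lcm_def by blast
next
  assume "(\<Inter>q\<in>U. right_multiples q) = right_multiples r"
  then show "is_right_lcm r U" unfolding is_right_lcm_def using self_in_right_multiples by blast
qed

locale left_cancellative_monoid =
  fixes ty :: "'p::monoid_mult itself"
  assumes lc: "left_cancellative TYPE('p)"
begin

lemma cancel_left: "(p::'p) * q = p * r \<Longrightarrow> q = r"
  using lc unfolding left_cancellative_def by blast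

lemma inj_mult: "inj ((*) (p::'p))"
  using cancel_left by (auto simp: inj_def)

text \<open>
  In a left cancellative monoid one-sided inverses are two-sided.
\<close>

lemma invertible_factors:
  assumes "(x::'p) * y \<in> invertibles"
  shows "x \<in> invertibles" "y \<in> invertibles"
proof -
  obtain v where v: "x * y * v = 1" "v * (x * y) = 1"
    using assms unfolding invertibles_def by blast
  have "x * (y * v * x) = x * 1" using v(1) by (simp flip: mult.assoc)
  then have "y * v * x = 1" by (rule cancel_left)
  moreover have "x * (y * v) = 1" using v(1) by (simp add: mult.assoc)
  ultimately show "x \<in> invertibles" unfolding invertibles_def by blast
  have "y * (v * x * y) = y * 1"
    using \<open>y * v * x = 1\<close> by (simp flip: mult.assoc)
  then have "v * x * y = 1" by (rule cancel_left)
  moreover have "y * (v * x) = 1" using \<open>y * v * x = 1\<close> by (simp add: mult.assoc)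
  ultimately show "y \<in> invertibles" unfolding invertibles_def by blast
qed

lemma right_multiples_eqD:
  assumes "right_multiples r = right_multiples (r'::'p)"
  obtains u where "u \<in> invertibles" "r' = r * u"
proof -
  obtain u where u: "r' = r * u"
    using assms self_in_right_multiples[of r'] unfolding right_multiples_def by blast
  obtain v where v: "r = r' * v"
    using assms self_in_right_multiples[of r] unfolding right_multiples_def by blast
  have "r * (u * v) = r * 1" using u v by (simp flip: mult.assoc)
  then have "u * v = 1" by (rule cancel_left)
  moreover have "r' * (v * u) = r' * 1" using u v by (simp flip: mult.assoc)
  then have "v * u = 1" by (rule cancel_left)
  ultimately show ?thesis using that u unfolding invertibles_def by blast
qed

lemma right_multiples_invertible:
  assumes "(u::'p) \<in> invertibles" shows "right_multiples u = UNIV"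
proof -
  obtain v where "u * v = 1" using assms unfolding invertibles_def by blast
  then have "x = u * (v * x)" for x by (simp flip: mult.assoc)
  then show ?thesis unfolding right_multiples_def by blast
qed

lemma product_of_two_noninvertibles:
  assumes "2 \<le> length (filter (\<lambda>p. p \<notin> invertibles) (ps::'p list))"
  shows "\<exists>x y. x \<notin> invertibles \<and> y \<notin> invertibles \<and> prod_list ps = x * y"
  using assms
proof (induction ps)
  case (Cons a ps)
  show ?case
  proof (cases "a \<in> invertibles")
    case True
    then obtain x y where xy: "x \<notin> invertibles" "y \<notin> invertibles" "prod_list ps = x * y"
      using Cons by auto
    have "a * x \<notin> invertibles" using xy(1) invertible_factors(2) by blast
    then show ?thesis using xy by (intro exI[of _ "a * x"] exI[of _ y]) (simp add: mult.assoc)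
  next
    case False
    then have "filter (\<lambda>p. p \<notin> invertibles) ps \<noteq> []" using Cons.prems by auto
    then obtain q where q: "q \<in> set ps" "q \<notin> invertibles" by (auto simp: filter_empty_conv)
    have "r \<in> invertibles" if "prod_list qs \<in> invertibles" "r \<in> set qs" for qs and r :: 'p
      using that by (induction qs) (auto dest: invertible_factors)
    then have "prod_list ps \<notin> invertibles" using q by blast
    then show ?thesis using False by auto
  qed
qed simp

lemma atom_left_factor:
  assumes noeth: "noetherian_monoid TYPE('p)" and "(p::'p) \<notin> invertibles"
  shows "\<exists>s q. s \<in> atoms \<and> p = s * q"
proof -
  have wf: "wf {(p, q :: 'p). proper_factor p q}"
    using noeth unfolding noetherian_monoid_def wf_iff_no_infinite_down_chain by simp
  show ?thesis using assms(2)
  proof (induction p rule: wf_induct_rule[OF wf])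
    case (1 p)
    show ?case
    proof (cases "p \<in> atoms")
      case True then show ?thesis by (intro exI[of _ p] exI[of _ 1]) simp
    next
      case False
      then obtain ps where "prod_list ps = p" "2 \<le> length (filter (\<lambda>p. p \<notin> invertibles) ps)"
        using 1(2) unfolding atoms_def by auto
      then obtain x y where xy: "x \<notin> invertibles" "y \<notin> invertibles" "p = x * y"
        using product_of_two_noninvertibles by metis
      have "proper_factor x p" unfolding proper_factor_def
        using xy by (intro exI[of _ 1] exI[of _ y]) simp
      then obtain s q where "s \<in> atoms" "x = s * q" using 1(1) xy(1) by blast
      then show ?thesis using xy(3) by (intro exI[of _ s] exI[of _ "q * y"]) (simp add: mult.assoc)
    qed
  qed
qed

lemma atoms_induct [consumes 1, case_names invertible atom_mult]:
  assumes noeth: "noetherian_monoid TYPE('p)"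
    and inv: "\<And>p. p \<in> invertibles \<Longrightarrow> R p"
    and step: "\<And>s q. s \<in> atoms \<Longrightarrow> R q \<Longrightarrow> R (s * q)"
  shows "R (p::'p)"
proof -
  have wf: "wf {(p, q :: 'p). proper_factor p q}"
    using noeth unfolding noetherian_monoid_def wf_iff_no_infinite_down_chain by simp
  show ?thesis
  proof (induction p rule: wf_induct_rule[OF wf])
    case (1 p)
    show ?case
    proof (cases "p \<in> invertibles")
      case False
      then obtain s q where sq: "s \<in> atoms" "p = s * q" using atom_left_factor[OF noeth] by blast
      then have "proper_factor q p" unfolding proper_factor_def atoms_def
        by (intro exI[of _ s] exI[of _ 1]) simp
      then show ?thesis using 1 step sq by blast
    qed (rule inv)
  qed
qed

end

text \<open>
  The entry \<open>\<infinity>\<close> of a list stands for the empty ideal.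
\<close>

fun ideal :: "'p::monoid_mult option \<Rightarrow> 'p set" where
  "ideal None = {}"
| "ideal (Some r) = right_multiples r"

text \<open>
  With the entry pq replaced by p one gets the first child. The remainder is the alternating sum inside
  the ideal \<open>pP\<close>, where the ideals of the list become p times the ideals of the second child.
\<close>

lemma alt_sum_children:
  assumes lcm: "right_LCM_monoid TYPE('p::monoid_mult)" and ch: "children (\<Lambda>::'p option list) \<Lambda>1 \<Lambda>2"
  obtains p where "p \<in> atoms" "\<And>G. alt_sum G UNIV (map ideal \<Lambda>)
    = alt_sum G UNIV (map ideal \<Lambda>1) + alt_sum (\<lambda>S. G ((*) p ` S)) UNIV (map ideal \<Lambda>2)"
proof -
  interpret left_cancellative_monoid "TYPE('p)" using lcm unfolding right_LCM_monoid_def by unfold_locales blast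
  obtain i p q where i: "i < length \<Lambda>" and p: "p \<in> atoms" and L: "\<Lambda> ! i = Some (p * q)"
    and L1: "\<Lambda>1 = \<Lambda>[i := Some p]" and len: "length \<Lambda>2 = length \<Lambda>" and L2i: "\<Lambda>2 ! i = Some q"
    and L2: "\<And>j. j < length \<Lambda> \<Longrightarrow> j \<noteq> i \<Longrightarrow>
           (case \<Lambda> ! j of
              None \<Rightarrow> \<Lambda>2 ! j = None
            | Some r \<Rightarrow>
                (if \<exists>m. is_right_lcm m {p, r}
                 then \<exists>s. \<Lambda>2 ! j = Some s \<and> is_right_lcm (p * s) {p, r}
                 else \<Lambda>2 ! j = None))"
    using ch unfolding children_def splittable_def by blast
  have "(\<lambda>B. right_multiples p \<inter> B) (ideal (\<Lambda> ! j)) = (*) p ` ideal (\<Lambda>2 ! j)" if j: "j < length \<Lambda>" for j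
  proof (cases "j = i")
    case True
    have "(*) p ` right_multiples q \<subseteq> right_multiples p" unfolding right_multiples_def by auto
    then show ?thesis using True by (auto simp: L L2i right_multiples_mult)
  next
    case False
    show ?thesis
    proof (cases "\<Lambda> ! j")
      case None then show ?thesis using L2[OF j False] by simp
    next
      case (Some r)
      show ?thesis
      proof (cases "\<exists>m. is_right_lcm m {p, r}")
        case True
        then obtain s where "\<Lambda>2 ! j = Some s" "is_right_lcm (p * s) {p, r}"
          using L2[OF j False] Some by auto
        then show ?thesis using Some by (simp add: is_right_lcm_iff right_multiples_mult)
      next
        case no: False
        then have "\<Lambda>2 ! j = None" using L2[OF j False] Some by simp
        moreover have "right_multiples p \<inter> right_multiples r = {}"
          using no lcm unfolding right_LCM_monoid_def by blast
        ultimately show ?thesis using Some by simp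
      qed
    qed
  qed
  then have meet: "map (\<lambda>B. right_multiples p \<inter> B) (map ideal \<Lambda>) = map ((`) ((*) p)) (map ideal \<Lambda>2)"
    using len by (intro nth_equalityI) auto
  have sub: "right_multiples (p * q) \<subseteq> right_multiples p"
    unfolding right_multiples_def by (auto simp: mult.assoc)
  have "alt_sum G UNIV (map ideal \<Lambda>)
    = alt_sum G UNIV (map ideal \<Lambda>1) + alt_sum (\<lambda>S. G ((*) p ` S)) UNIV (map ideal \<Lambda>2)" for G
  proof -
    have \<Lambda>: "\<Lambda> = take i \<Lambda> @ Some (p * q) # drop (Suc i) \<Lambda>"
      using id_take_nth_drop[OF i] L by simp
    have \<Lambda>1: "\<Lambda>1 = take i \<Lambda> @ Some p # drop (Suc i) \<Lambda>"
      unfolding L1 using i by (simp add: upd_conv_take_nth_drop)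
    have split: "alt_sum G UNIV (map ideal \<Lambda>)
      = alt_sum G UNIV (map ideal \<Lambda>1) + alt_sum G (UNIV \<inter> right_multiples p) (map ideal \<Lambda>)"
      unfolding \<Lambda>1 using alt_sum_split[OF sub, of G UNIV "map ideal (take i \<Lambda>)" "map ideal (drop (Suc i) \<Lambda>)"]
      by (subst (1 4) \<Lambda>) simp
    have "alt_sum G (UNIV \<inter> right_multiples p) (map ideal \<Lambda>)
        = alt_sum G (UNIV \<inter> right_multiples p) (map ((`) ((*) p)) (map ideal \<Lambda>2))"
      unfolding meet[symmetric] by (rule alt_sum_restrict)
    also have "UNIV \<inter> right_multiples p = (*) p ` UNIV" by (simp add: right_multiples_def)
    also have "alt_sum G ((*) p ` UNIV) (map ((`) ((*) p)) (map ideal \<Lambda>2))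
        = alt_sum (\<lambda>S. G ((*) p ` S)) UNIV (map ideal \<Lambda>2)"
      by (rule alt_sum_image[OF inj_mult])
    finally show ?thesis using split by (simp add: right_multiples_def)
  qed
  then show ?thesis using that p by blast
qed

text \<open>
  Induction on the distance of a node from the bottom of the tree.
\<close>

lemma finite_tree_induct:
  assumes "has_finite_tree \<Lambda>"
    and leaf: "\<And>M. leaf M \<Longrightarrow> R M"
    and step: "\<And>M M1 M2. children M M1 M2 \<Longrightarrow> R M1 \<Longrightarrow> R M2 \<Longrightarrow> R M"
  shows "R \<Lambda>"
proof -
  obtain T where T: "is_tree_of \<Lambda> T" and fin: "finite (dom T)"
    using assms(1) unfolding has_finite_tree_def by blast
  obtain n where n: "\<And>\<omega>. \<omega> \<in> dom T \<Longrightarrow> length \<omega> \<le> n"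
    using finite_imageI[OF fin, of length] unfolding finite_nat_set_iff_bounded_le by auto
  have "R M" if "T \<omega> = Some M" for \<omega> M
    using that
  proof (induction "Suc n - length \<omega>" arbitrary: \<omega> M rule: less_induct)
    case less
    show ?case
    proof (cases "leaf M")
      case False
      then obtain M1 M2 where M: "children M M1 M2" "T (\<omega> @ [1]) = Some M1" "T (\<omega> @ [2]) = Some M2"
        using T less.prems unfolding is_tree_of_def by metis
      have "length \<omega> \<le> n" using n less.prems by blast
      then have "R M1" "R M2" using less.hyps[OF _ M(2)] less.hyps[OF _ M(3)] by simp_all
      then show ?thesis using step M(1) by blast
    qed (rule leaf)
  qed
  then show ?thesis using T unfolding is_tree_of_def by blast
qed

section \<open>Scaled traces on the fibres of a product system\<close>

locale trace_setup =
  fixes X :: "('p::monoid_mult, 'a::cstar_algebra, 'x::complex_vec) product_system"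
    and N :: "'p \<Rightarrow> real" and \<beta> :: real and \<tau> :: "'a \<Rightarrow> complex"
  assumes right_lcm: "right_LCM_monoid TYPE('p)"
    and noetherian: "noetherian_monoid TYPE('p)"
    and prod_sys: "is_product_system X"
    and N_pos: "\<And>p. 0 < N p"
    and N_mult: "\<And>p q. N (p * q) = N p * N q"
    and N_inv: "\<And>u. u \<in> invertibles \<Longrightarrow> N u = 1"
    and tracial: "tracial_state \<tau>"
    and wd: "lcm_traces_well_defined X \<tau>"
begin

sublocale left_cancellative_monoid "TYPE('p)"
  using right_lcm unfolding right_LCM_monoid_def by unfold_locales blast

lemma \<tau>_schwarz: "schwarz_functional \<tau>"
  using tracial by (rule tracial_state_schwarz)

lemma \<tau>_pos: "positive_functional \<tau>"
  using tracial by (rule tracial_state_positive_functional)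

lemma \<tau>_trace: "\<tau> (a * b) = \<tau> (b * a)"
  using tracial unfolding tracial_state_def by blast

lemma \<tau>_bound: "cmod (\<tau> a) \<le> norm a"
  using tracial by (rule tracial_state_norm_le)

lemma fibre_correspondence: "correspondence_mod (fibre X p)"
proof -
  have "cstar_correspondence (fibre X p)" using prod_sys[unfolded is_product_system_def, THEN conjunct1] by blast
  then show ?thesis by unfold_locales (auto simp: cstar_correspondence_def)
qed

lemma fibre_tensor: "p \<noteq> 1 \<Longrightarrow> tensor_mod (fibre X p) (fibre X q) (fibre X (p * q)) (pmul X p q)"
proof -
  assume "p \<noteq> 1"
  then have iso: "extends_to_tensor_iso (fibre X p) (fibre X q) (fibre X (p * q)) (pmul X p q)"
    using prod_sys unfolding is_product_system_def by blast
  show ?thesis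
    by (intro tensor_mod.intro tensor_mod_axioms.intro fibre_correspondence iso)
qed

lemma one_invertible: "(1::'p) \<in> invertibles"
  unfolding invertibles_def by (simp add: exI[of _ 1])

lemma atom_not_one: "p \<in> atoms \<Longrightarrow> p \<noteq> (1::'p)"
  using one_invertible unfolding atoms_def by auto

text \<open>
  \<open>X\<^sub>e\<close> is A itself, and for a = b* b the sum over a frame is the part of \<open>\<tau>(b b*)\<close> that the frame
  resolves in the vector b*.
\<close>

lemma Tr_one:
  assumes "a \<in> A\<^sub>+"
  shows "Tr X \<tau> 1 a = ereal (Re (\<tau> a))"
proof -
  obtain b where a: "a = star b * b" using assms unfolding pos_elements_def by blast
  interpret E: correspondence_mod "fibre X 1" by (rule fibre_correspondence)
  let ?u = "unit_map X"
  have carrier: "?u ` UNIV = hcarrier (fibre X 1)"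
    and ip: "\<And>a b. hinner (fibre X 1) (?u a) (?u b) = star a * b"
    and act: "\<And>a b. lact (fibre X 1) a (?u b) = ?u (a * b)"
    using prod_sys unfolding is_product_system_def bij_betw_def by blast+
  let ?v = "?u (star b)"
  have v: "?v \<in> hcarrier (fibre X 1)" using carrier by blast
  have sqv: "sq_norm \<tau> (fibre X 1) ?v = Re (\<tau> a)"
    unfolding sq_norm_def ip a star_star using \<tau>_trace[of b "star b"] by simp
  have coeff: "Re (\<tau> (hinner (fibre X 1) ?v \<eta> * hinner (fibre X 1) \<eta> ?v))
      = Re (\<tau> (hinner (fibre X 1) \<eta> (lact (fibre X 1) a \<eta>)))"
    if \<eta>: "\<eta> \<in> hcarrier (fibre X 1)" for \<eta>
  proof -
    obtain c where c: "\<eta> = ?u c" using \<eta> carrier by blast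
    show ?thesis unfolding c ip act a star_star
      using \<tau>_trace[of "b * c" "star c * star b"] by (simp add: mult.assoc)
  qed
  have sum: "(\<Sum>\<eta>\<leftarrow>H. Re (\<tau> (hinner (fibre X 1) \<eta> (lact (fibre X 1) a \<eta>))))
      = (\<Sum>\<eta>\<leftarrow>H. Re (\<tau> (hinner (fibre X 1) ?v \<eta> * hinner (fibre X 1) \<eta> ?v)))"
    if "frame (fibre X 1) H S S'" for H S S'
    using E.frame_mem[OF that] coeff by (intro arg_cong[where f = sum_list] map_cong) auto
  show ?thesis unfolding Tr_def
  proof (rule antisym)
    show "induced_trace (fibre X 1) \<tau> (lact (fibre X 1) a) \<le> ereal (Re (\<tau> a))"
    proof (rule E.induced_trace_le)
      fix H S S' assume H: "frame (fibre X 1) H S S'"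
      show "ereal (\<Sum>\<eta>\<leftarrow>H. Re (\<tau> (hinner (fibre X 1) \<eta> (lact (fibre X 1) a \<eta>)))) \<le> ereal (Re (\<tau> a))"
        unfolding sum[OF H] using E.frame_bessel[OF H v \<tau>_pos] sqv by simp
    qed
    show "ereal (Re (\<tau> a)) \<le> induced_trace (fibre X 1) \<tau> (lact (fibre X 1) a)"
    proof (rule ereal_le_epsilon2)
      fix \<epsilon> :: real assume \<epsilon>: "0 < \<epsilon>"
      obtain H S S' where H: "frame (fibre X 1) H S S'" "sq_norm \<tau> (fibre X 1) (S ?v) < \<epsilon>"
        using E.exhausting_carrier[OF \<tau>_schwarz] v \<epsilon> unfolding exhausting_def
        by (metis empty_iff insert_iff list.set(1) list.set(2) subsetI)
      have "ereal (Re (\<tau> a))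
          \<le> ereal (\<Sum>\<eta>\<leftarrow>H. Re (\<tau> (hinner (fibre X 1) \<eta> (lact (fibre X 1) a \<eta>)))) + ereal \<epsilon>"
        unfolding sum[OF H(1)] using E.frame_sq_norm[OF H(1) v \<tau>_pos] H(2) sqv by simp
      also have "\<dots> \<le> induced_trace (fibre X 1) \<tau> (lact (fibre X 1) a) + ereal \<epsilon>"
        by (intro add_right_mono E.lact_trace_ge[OF H(1) \<tau>_pos])
      finally show "ereal (Re (\<tau> a)) \<le> induced_trace (fibre X 1) \<tau> (lact (fibre X 1) a) + ereal \<epsilon>" .
    qed
  qed
qed

lemma Tr_nonneg: "0 \<le> Tr X \<tau> p a"
proof -
  interpret E: correspondence_mod "fibre X p" by (rule fibre_correspondence)
  show ?thesis using E.lact_trace_ge[OF E.frame_id \<tau>_pos, of a] by (simp add: Tr_def zero_ereal_def)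
qed

text \<open>
  Two generators of the same ideal are right LCMs of a common singleton, and one of the two may serve
  as its element. That element must differ from 1, which holds for at least one of them if they differ.
\<close>

lemma Tr_cong:
  assumes "right_multiples r = right_multiples r'" "a \<in> A\<^sub>+"
  shows "Tr X \<tau> r a = Tr X \<tau> r' a"
proof (cases "r = r'")
  case False
  define k where "k = (if r = 1 then r' else r)"
  have k: "k \<in> {r, r'}" "k \<noteq> 1" using False by (auto simp: k_def)
  then have "is_right_lcm r {k}" "is_right_lcm r' {k}"
    using assms(1) by (auto simp: is_right_lcm_iff)
  then show ?thesis using wd k(2) assms(2) unfolding lcm_traces_well_defined_def
    by (metis Diff_iff UNIV_I empty_iff finite.emptyI finite_insert insert_not_empty singletonD subsetI)
qed simp

lemma N_cong: "right_multiples r = right_multiples r' \<Longrightarrow> N r = N r'"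
  using right_multiples_eqD[of r r'] N_mult N_inv by (metis mult_1_right)

lemma trace_sum_singleton:
  assumes "a \<in> A\<^sub>+"
  shows "trace_sum X N \<beta> \<tau> {p} a
    = ereal (Re (\<tau> a)) + ereal (- (N p powr (- \<beta>))) * Tr X \<tau> p a"
proof -
  have sets: "{K. K \<subseteq> {p} \<and> K \<noteq> {}} = {{p}}" by auto
  have ex: "\<exists>r. is_right_lcm r {p}" by (auto simp: is_right_lcm_iff)
  define r where "r = (SOME r. is_right_lcm r {p})"
  have "is_right_lcm r {p}" unfolding r_def using ex by (rule someI_ex)
  then have r: "right_multiples r = right_multiples p" by (simp add: is_right_lcm_iff)
  have "\<Or> {p} = Some r" using ex by (simp add: right_lcm_def r_def)
  then show ?thesis
    unfolding trace_sum_def sets using Tr_cong[OF r assms] N_cong[OF r] by simp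
qed

lemma Tr_atom_le:
  assumes nn: "0 \<le> trace_sum X N \<beta> \<tau> {s} a" and a: "a \<in> A\<^sub>+"
  shows "Tr X \<tau> s a \<le> ereal (N s powr \<beta> * Re (\<tau> a))"
proof (cases "Tr X \<tau> s a")
  case (real r)
  have Np: "0 < N s powr (- \<beta>)" using N_pos[of s] by simp
  have "0 \<le> Re (\<tau> a) - N s powr (- \<beta>) * r"
    using nn unfolding trace_sum_singleton[OF a] real by simp
  then have "r \<le> N s powr \<beta> * Re (\<tau> a)" using N_pos[of s]
    by (simp add: powr_minus field_simps)
  then show ?thesis using real by simp
next
  case PInf
  then show ?thesis
    using nn N_pos[of s] unfolding trace_sum_singleton[OF a] by simp
next
  case MInf
  then show ?thesis by simp
qed

text \<open>
  Write the element as sq with s an atom. By stages its trace is at most c times \<open>Tr\<^sup>s\<close> if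
  \<open>Tr\<^sup>q \<le> c \<tau>\<close>, and \<open>Tr\<^sup>s\<close> is dominated by \<open>\<tau>\<close> because of the set {s}.
\<close>

lemma Tr_dominated:
  assumes atom: "\<And>s a. s \<in> atoms \<Longrightarrow> a \<in> A\<^sub>+ \<Longrightarrow> 0 \<le> trace_sum X N \<beta> \<tau> {s} a"
  shows "\<exists>c\<ge>0. \<forall>a\<in>A\<^sub>+. Tr X \<tau> p a \<le> ereal (c * Re (\<tau> a))"
  using noetherian
proof (induction p rule: atoms_induct)
  case (invertible p)
  then have p: "right_multiples p = right_multiples 1"
    by (simp add: right_multiples_invertible right_multiples_one)
  have "Tr X \<tau> p a = ereal (Re (\<tau> a))" if "a \<in> A\<^sub>+" for a
    unfolding Tr_cong[OF p that] by (rule Tr_one[OF that])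
  then show ?case by (intro exI[of _ 1]) simp
next
  case (atom_mult s q)
  obtain c where c: "0 \<le> c" "\<And>a. a \<in> A\<^sub>+ \<Longrightarrow> Tr X \<tau> q a \<le> ereal (c * Re (\<tau> a))"
    using atom_mult.IH by blast
  interpret T: tensor_mod "fibre X s" "fibre X q" "fibre X (s * q)" "pmul X s q"
    by (rule fibre_tensor[OF atom_not_one[OF atom_mult.hyps(1)]])
  have "Tr X \<tau> (s * q) a \<le> ereal (c * N s powr \<beta> * Re (\<tau> a))" if a: "a \<in> A\<^sub>+" for a
  proof (rule ccontr)
    assume "\<not> ?thesis"
    then obtain y where y: "c * N s powr \<beta> * Re (\<tau> a) < y" "ereal y < Tr X \<tau> (s * q) a"
      using ereal_dense2[of "ereal (c * N s powr \<beta> * Re (\<tau> a))"] by (auto simp: not_le)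
    obtain b where b: "a = star b * b" using a unfolding pos_elements_def by blast
    define g where "g = (\<lambda>\<xi>. real_of_ereal (Tr X \<tau> q
      (hinner (fibre X s) (lact (fibre X s) b \<xi>) (lact (fibre X s) b \<xi>))))"
    have b\<xi>: "hinner (fibre X s) (lact (fibre X s) b \<xi>) (lact (fibre X s) b \<xi>) \<in> A\<^sub>+"
      if "\<xi> \<in> hcarrier (fibre X s)" for \<xi>
      using T.P.ip_pos T.P.lact_mem that by blast
    have g: "Tr X \<tau> q (hinner (fibre X s) (lact (fibre X s) b \<xi>) (lact (fibre X s) b \<xi>)) = ereal (g \<xi>)"
      if "\<xi> \<in> hcarrier (fibre X s)" for \<xi>
      using c(2)[OF b\<xi>[OF that]] Tr_nonneg unfolding g_def
      by (metis ereal_infty_less_eq(1) ereal_real' abs_ereal_ge0 PInfty_neq_ereal(1))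
    obtain ps \<epsilon> where ps: "0 < \<epsilon>" "\<forall>(\<sigma>, z)\<in>set ps. schwarz_functional \<sigma> \<and> z \<in> hcarrier (fibre X s)"
      "\<And>H S S'. frame (fibre X s) H S S' \<Longrightarrow> \<forall>(\<sigma>, z)\<in>set ps. sq_norm \<sigma> (fibre X s) (S z) < \<epsilon>
        \<Longrightarrow> y \<le> (\<Sum>\<xi>\<leftarrow>H. g \<xi>)"
      using T.trace_in_stages_le[OF \<tau>_schwarz \<tau>_bound \<tau>_trace, of y b g] y(2) g
      unfolding Tr_def b by metis
    obtain H S S' where H: "frame (fibre X s) H S S'"
      "\<forall>(\<sigma>, z)\<in>set ps. sq_norm \<sigma> (fibre X s) (S z) < \<epsilon>"
      using T.P.frame_small_on_vectors[OF T.P.submodule_carrier ps(1), of ps] ps(2) by fast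
    have "y \<le> (\<Sum>\<xi>\<leftarrow>H. g \<xi>)" by (rule ps(3)[OF H])
    also have "\<dots> \<le> (\<Sum>\<xi>\<leftarrow>H. c * Re (\<tau> (hinner (fibre X s) \<xi> (lact (fibre X s) a \<xi>))))"
    proof (rule sum_list_mono)
      fix \<xi> assume "\<xi> \<in> set H"
      then have \<xi>: "\<xi> \<in> hcarrier (fibre X s)" using T.P.frame_mem[OF H(1)] by blast
      show "g \<xi> \<le> c * Re (\<tau> (hinner (fibre X s) \<xi> (lact (fibre X s) a \<xi>)))"
        using c(2)[OF b\<xi>[OF \<xi>]] g[OF \<xi>] T.P.sq_norm_lact[OF \<xi>, of \<tau> b]
        by (simp add: sq_norm_def b)
    qed
    also have "\<dots> = c * (\<Sum>\<xi>\<leftarrow>H. Re (\<tau> (hinner (fibre X s) \<xi> (lact (fibre X s) a \<xi>))))"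
      by (rule sum_list_const_mult)
    also have "\<dots> \<le> c * (N s powr \<beta> * Re (\<tau> a))"
    proof (rule mult_left_mono[OF _ c(1)])
      have "ereal (\<Sum>\<xi>\<leftarrow>H. Re (\<tau> (hinner (fibre X s) \<xi> (lact (fibre X s) a \<xi>)))) \<le> Tr X \<tau> s a"
        unfolding Tr_def by (rule T.P.lact_trace_ge[OF H(1) \<tau>_pos])
      also have "\<dots> \<le> ereal (N s powr \<beta> * Re (\<tau> a))"
        by (rule Tr_atom_le[OF atom[OF atom_mult.hyps(1) a] a])
      finally show "(\<Sum>\<xi>\<leftarrow>H. Re (\<tau> (hinner (fibre X s) \<xi> (lact (fibre X s) a \<xi>)))) \<le> N s powr \<beta> * Re (\<tau> a)"
        by simp
    qed
    finally show False using y(1) by (simp add: mult.assoc)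
  qed
  moreover have "0 \<le> c * N s powr \<beta>" using c(1) by simp
  ultimately show ?case by blast
qed

text \<open>
  The value of F_r on a, as a function of the right ideal generated by r; ideals that are not principal
  correspond to missing LCMs and get the value 0.
\<close>

definition weight :: "'a \<Rightarrow> 'p set \<Rightarrow> real" where
  "weight a S = (if \<exists>r. S = right_multiples r
     then (let r = SOME r. S = right_multiples r in N r powr (- \<beta>) * real_of_ereal (Tr X \<tau> r a))
     else 0)"

lemma weight_principal:
  assumes "a \<in> A\<^sub>+"
  shows "weight a (right_multiples r) = N r powr (- \<beta>) * real_of_ereal (Tr X \<tau> r a)"
proof -
  define r' where "r' = (SOME r'. right_multiples r = right_multiples r')"
  have r': "right_multiples r = right_multiples r'"
    unfolding r'_def by (rule someI[of _ r]) simp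
  have "weight a (right_multiples r) = N r' powr (- \<beta>) * real_of_ereal (Tr X \<tau> r' a)"
    unfolding weight_def r'_def Let_def by auto
  then show ?thesis using Tr_cong[OF r' assms] N_cong[OF r'] by simp
qed

lemma weight_empty: "weight a {} = 0"
  unfolding weight_def using self_in_right_multiples by auto

end

locale finite_traces = trace_setup X N \<beta> \<tau>
  for X :: "('p::monoid_mult, 'a::cstar_algebra, 'x::complex_vec) product_system"
    and N :: "'p \<Rightarrow> real" and \<beta> :: real and \<tau> :: "'a \<Rightarrow> complex" +
  assumes finite_Tr: "\<And>p a. a \<in> A\<^sub>+ \<Longrightarrow> Tr X \<tau> p a \<noteq> \<infinity>"
begin

definition real_Tr :: "'p \<Rightarrow> 'a \<Rightarrow> real" where
  "real_Tr p a = real_of_ereal (Tr X \<tau> p a)"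

lemma Tr_eq: "a \<in> A\<^sub>+ \<Longrightarrow> Tr X \<tau> p a = ereal (real_Tr p a)"
  using finite_Tr[of a p] Tr_nonneg[of p a] unfolding real_Tr_def by (cases "Tr X \<tau> p a") auto

lemma weight_right_multiples:
  "a \<in> A\<^sub>+ \<Longrightarrow> weight a (right_multiples r) = N r powr (- \<beta>) * real_Tr r a"
  unfolding real_Tr_def by (rule weight_principal)

lemma real_Tr_one: "a \<in> A\<^sub>+ \<Longrightarrow> real_Tr 1 a = Re (\<tau> a)"
  unfolding real_Tr_def by (simp add: Tr_one)

text \<open>
  The empty set contributes the ideal P generated by 1, hence \<open>\<tau>(a)\<close>.
\<close>

lemma trace_sum_eq_alt_sum:
  assumes a: "a \<in> A\<^sub>+" and js: "distinct js"
  shows "trace_sum X N \<beta> \<tau> (set js) a = ereal (alt_sum (weight a) UNIV (map right_multiples js))"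
proof -
  let ?f = "\<lambda>K. (-1) ^ card K * weight a (\<Inter>q\<in>K. right_multiples q)"
  have one: "?f {} = Re (\<tau> a)"
    using weight_right_multiples[OF a, of 1] real_Tr_one[OF a] N_inv[OF one_invertible]
    by (simp add: right_multiples_one)
  have "(case \<Or> K of None \<Rightarrow> 0
        | Some r \<Rightarrow> ereal ((- 1) ^ card K * N r powr (- \<beta>)) * Tr X \<tau> r a) = ereal (?f K)" for K
  proof (cases "\<exists>r. is_right_lcm r K")
    case True
    define r where "r = (SOME r. is_right_lcm r K)"
    have "is_right_lcm r K" unfolding r_def using True by (rule someI_ex)
    then have "(\<Inter>q\<in>K. right_multiples q) = right_multiples r" by (simp add: is_right_lcm_iff)
    moreover have "\<Or> K = Some r" using True by (simp add: right_lcm_def r_def)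
    ultimately show ?thesis
      using weight_right_multiples[OF a, of r] Tr_eq[OF a, of r] by simp
  next
    case False
    then have "weight a (\<Inter>q\<in>K. right_multiples q) = 0"
      unfolding weight_def is_right_lcm_iff by auto
    moreover have "\<Or> K = None" using False by (simp add: right_lcm_def)
    ultimately show ?thesis by (simp add: zero_ereal_def)
  qed
  then have "trace_sum X N \<beta> \<tau> (set js) a
      = ereal (Re (\<tau> a)) + (\<Sum>K\<in>{K. K \<subseteq> set js \<and> K \<noteq> {}}. ereal (?f K))"
    unfolding trace_sum_def by simp
  also have "\<dots> = ereal (?f {} + (\<Sum>K\<in>Pow (set js) - {{}}. ?f K))"
    unfolding one by (simp add: Pow_def set_diff_eq sum_ereal)
  also have "?f {} + (\<Sum>K\<in>Pow (set js) - {{}}. ?f K) = (\<Sum>K\<in>Pow (set js). ?f K)"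
    by (rule sum.remove[symmetric]) auto
  also have "\<dots> = alt_sum (weight a) UNIV (map right_multiples js)"
    unfolding alt_sum_subsets[OF js] by simp
  finally show ?thesis .
qed

text \<open>
  One frame H serves all r in R: join the finite lists of vectors on which it has to be small.
\<close>

lemma stage_frame:
  assumes s: "s \<noteq> 1" and \<epsilon>: "0 < \<epsilon>" and R: "finite R"
  shows "\<exists>H. set H \<subseteq> hcarrier (fibre X s) \<and> (\<forall>r\<in>R. \<bar>real_Tr (s * r) (star b * b)
    - (\<Sum>\<xi>\<leftarrow>H. real_Tr r (hinner (fibre X s) (lact (fibre X s) b \<xi>) (lact (fibre X s) b \<xi>)))\<bar> \<le> \<epsilon>)"
proof -
  interpret P: correspondence_mod "fibre X s" by (rule fibre_correspondence)
  let ?a = "star b * b" and ?h = "\<lambda>\<xi>. hinner (fibre X s) (lact (fibre X s) b \<xi>) (lact (fibre X s) b \<xi>)"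
  have a: "?a \<in> A\<^sub>+" unfolding pos_elements_def by blast
  have h: "?h \<xi> \<in> A\<^sub>+" if "\<xi> \<in> hcarrier (fibre X s)" for \<xi> using P.ip_pos P.lact_mem that by blast
  have Tz: "induced_trace (fibre X (s * r)) \<tau> (lact (fibre X (s * r)) ?a) = ereal (real_Tr (s * r) ?a)" for r
    using Tr_eq[OF a, of "s * r"] unfolding Tr_def .
  have Tq: "induced_trace (fibre X r) \<tau> (lact (fibre X r) (?h \<xi>)) = ereal (real_Tr r (?h \<xi>))"
    if "\<xi> \<in> hcarrier (fibre X s)" for r \<xi>
    using Tr_eq[OF h[OF that], of r] unfolding Tr_def .
  have lower: "\<exists>ps \<epsilon>'. 0 < \<epsilon>' \<and> (\<forall>(\<sigma>, z)\<in>set ps. schwarz_functional \<sigma> \<and> z \<in> hcarrier (fibre X s)) \<and>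
    (\<forall>H S S'. frame (fibre X s) H S S' \<longrightarrow> (\<forall>(\<sigma>, z)\<in>set ps. sq_norm \<sigma> (fibre X s) (S z) < \<epsilon>') \<longrightarrow>
      real_Tr (s * r) ?a - \<epsilon> \<le> (\<Sum>\<xi>\<leftarrow>H. real_Tr r (?h \<xi>)))" for r
  proof -
    interpret T: tensor_mod "fibre X s" "fibre X r" "fibre X (s * r)" "pmul X s r"
      by (rule fibre_tensor[OF s])
    have "ereal (real_Tr (s * r) ?a - \<epsilon>) < induced_trace (fibre X (s * r)) \<tau> (lact (fibre X (s * r)) ?a)"
      unfolding Tz using \<epsilon> by simp
    then show ?thesis by (rule T.trace_in_stages_le[OF \<tau>_schwarz \<tau>_bound \<tau>_trace _ Tq])
  qed
  have upper: "(\<Sum>\<xi>\<leftarrow>H. real_Tr r (?h \<xi>)) \<le> real_Tr (s * r) ?a" if "frame (fibre X s) H S S'" for H S S' r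
  proof -
    interpret T: tensor_mod "fibre X s" "fibre X r" "fibre X (s * r)" "pmul X s r"
      by (rule fibre_tensor[OF s])
    show ?thesis
      by (rule T.trace_in_stages_ge[OF \<tau>_schwarz \<tau>_bound \<tau>_trace _ Tq that]) (simp add: Tz)
  qed
  define good where "good = (\<lambda>r ps \<epsilon>'. 0 < \<epsilon>' \<and>
    (\<forall>(\<sigma>, z)\<in>set ps. schwarz_functional \<sigma> \<and> z \<in> hcarrier (fibre X s)) \<and>
    (\<forall>H S S'. frame (fibre X s) H S S' \<longrightarrow> (\<forall>(\<sigma>, z)\<in>set ps. sq_norm \<sigma> (fibre X s) (S z) < \<epsilon>') \<longrightarrow>
      real_Tr (s * r) ?a - \<epsilon> \<le> (\<Sum>\<xi>\<leftarrow>H. real_Tr r (?h \<xi>))))"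
  have "\<forall>r. \<exists>x. good r (fst x) (snd x)"
    using lower unfolding good_def by simp
  from choice[OF this] obtain f where f: "\<forall>r. good r (fst (f r)) (snd (f r))" ..
  define ps \<delta> where "ps = (\<lambda>r. fst (f r))" and "\<delta> = (\<lambda>r. snd (f r))"
  have g: "good r (ps r) (\<delta> r)" for r unfolding ps_def \<delta>_def by (rule spec[OF f])
  have ps: "0 < \<delta> r" "(\<sigma>, z) \<in> set (ps r) \<Longrightarrow> schwarz_functional \<sigma> \<and> z \<in> hcarrier (fibre X s)"
    "frame (fibre X s) H S S' \<Longrightarrow> (\<And>\<sigma> z. (\<sigma>, z) \<in> set (ps r) \<Longrightarrow> sq_norm \<sigma> (fibre X s) (S z) < \<delta> r)
      \<Longrightarrow> real_Tr (s * r) ?a - \<epsilon> \<le> (\<Sum>\<xi>\<leftarrow>H. real_Tr r (?h \<xi>))" for r \<sigma> z H S S'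
    using g[of r] unfolding good_def by blast+
  obtain rs where rs: "set rs = R" using finite_list[OF R] by blast
  define d where "d = Min (insert 1 (\<delta> ` R))"
  have d: "0 < d" "\<And>r. r \<in> R \<Longrightarrow> d \<le> \<delta> r" unfolding d_def using ps(1) R by auto
  have "schwarz_functional \<sigma> \<and> z \<in> hcarrier (fibre X s)" if "(\<sigma>, z) \<in> set (concat (map ps rs))" for \<sigma> z
    using that ps(2) by auto
  from P.frame_small_on_vectors[OF P.submodule_carrier d(1) this]
  obtain H S S' where H: "frame (fibre X s) H S S'"
    "\<forall>(\<sigma>, z)\<in>set (concat (map ps rs)). sq_norm \<sigma> (fibre X s) (S z) < d"
    by blast
  have "\<bar>real_Tr (s * r) ?a - (\<Sum>\<xi>\<leftarrow>H. real_Tr r (?h \<xi>))\<bar> \<le> \<epsilon>" if r: "r \<in> R" for r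
  proof -
    have "sq_norm \<sigma> (fibre X s) (S z) < \<delta> r" if "(\<sigma>, z) \<in> set (ps r)" for \<sigma> z
    proof -
      have "(\<sigma>, z) \<in> set (concat (map ps rs))" using r rs that by auto
      then have "sq_norm \<sigma> (fibre X s) (S z) < d" using H(2) by blast
      then show ?thesis using d(2)[OF r] by simp
    qed
    then have "real_Tr (s * r) ?a - \<epsilon> \<le> (\<Sum>\<xi>\<leftarrow>H. real_Tr r (?h \<xi>))" by (rule ps(3)[OF H(1)])
    then show ?thesis using upper[OF H(1), of r] by simp
  qed
  then show ?thesis using P.frame_mem[OF H(1)] by blast
qed

text \<open>
  The left hand side is F_s of the positive combination given by Bs. On finitely many ideals F_s
  is approximated by sums over \<open>\<xi>\<close> in H of weights at \<open>\<langle>b\<xi>, b\<xi>\<rangle>\<close>, and those combine to nonnegative sums.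
\<close>

lemma alt_sum_translate_nonneg:
  assumes s: "s \<noteq> 1" and a: "a \<in> A\<^sub>+" and nn: "\<And>a. a \<in> A\<^sub>+ \<Longrightarrow> 0 \<le> alt_sum (weight a) UNIV Bs"
  shows "0 \<le> alt_sum (\<lambda>S. weight a ((*) s ` S)) UNIV Bs"
proof -
  interpret P: correspondence_mod "fibre X s" by (rule fibre_correspondence)
  obtain b where b: "a = star b * b" using a unfolding pos_elements_def by blast
  let ?h = "\<lambda>\<xi>. hinner (fibre X s) (lact (fibre X s) b \<xi>) (lact (fibre X s) b \<xi>)"
  have h: "?h \<xi> \<in> A\<^sub>+" if "\<xi> \<in> hcarrier (fibre X s)" for \<xi> using P.ip_pos P.lact_mem that by blast
  define gen where "gen = (\<lambda>S. SOME r. S = right_multiples (r::'p))"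
  have gen: "S = right_multiples (gen S)" if "\<exists>r. S = right_multiples r" for S
    unfolding gen_def using that by (rule someI_ex)
  define R where "R = gen ` meets UNIV Bs"
  have R: "finite R" unfolding R_def using finite_meets by blast
  define c where "c = Max (insert 1 ((\<lambda>r. N (s * r) powr (- \<beta>)) ` R))"
  have c: "0 < c" "\<And>r. r \<in> R \<Longrightarrow> N (s * r) powr (- \<beta>) \<le> c"
  proof -
    have "1 \<le> c" unfolding c_def using R by (intro Max_ge) auto
    then show "0 < c" by simp
    show "\<And>r. r \<in> R \<Longrightarrow> N (s * r) powr (- \<beta>) \<le> c" unfolding c_def using R by (intro Max_ge) auto
  qed
  have "0 \<le> alt_sum (\<lambda>S. weight a ((*) s ` S)) UNIV Bs + \<epsilon>" if \<epsilon>: "0 < \<epsilon>" for \<epsilon>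
  proof -
    define \<delta> where "\<delta> = \<epsilon> / (2 ^ length Bs * c)"
    have \<delta>: "0 < \<delta>" unfolding \<delta>_def using \<epsilon> c(1) by simp
    obtain H where H: "set H \<subseteq> hcarrier (fibre X s)"
      "\<And>r. r \<in> R \<Longrightarrow> \<bar>real_Tr (s * r) a - (\<Sum>\<xi>\<leftarrow>H. real_Tr r (?h \<xi>))\<bar> \<le> \<delta>"
      using stage_frame[OF s \<delta> R, of b] unfolding b by blast
    let ?F = "\<lambda>S. N s powr (- \<beta>) * (\<Sum>\<xi>\<leftarrow>H. weight (?h \<xi>) S)"
    have near: "\<bar>weight a ((*) s ` S) - ?F S\<bar> \<le> c * \<delta>" if S: "S \<in> meets UNIV Bs" for S
    proof (cases "\<exists>r. S = right_multiples r")
      case True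
      define r where "r = gen S"
      have r: "S = right_multiples r" "r \<in> R" using gen[OF True] S by (auto simp: r_def R_def)
      have "(\<Sum>\<xi>\<leftarrow>H. weight (?h \<xi>) S) = (\<Sum>\<xi>\<leftarrow>H. N r powr (- \<beta>) * real_Tr r (?h \<xi>))"
        using H(1) h unfolding r(1)
        by (intro arg_cong[where f = sum_list] map_cong) (auto simp: weight_right_multiples)
      then have "?F S = N (s * r) powr (- \<beta>) * (\<Sum>\<xi>\<leftarrow>H. real_Tr r (?h \<xi>))"
        using N_pos[of s] N_pos[of r] by (simp add: sum_list_const_mult N_mult powr_mult)
      moreover have "weight a ((*) s ` S) = N (s * r) powr (- \<beta>) * real_Tr (s * r) a"
        unfolding r(1) right_multiples_mult[symmetric] weight_right_multiples[OF a] by simp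
      ultimately have "\<bar>weight a ((*) s ` S) - ?F S\<bar>
          = N (s * r) powr (- \<beta>) * \<bar>real_Tr (s * r) a - (\<Sum>\<xi>\<leftarrow>H. real_Tr r (?h \<xi>))\<bar>"
        by (simp add: abs_mult flip: right_diff_distrib)
      also have "\<dots> \<le> c * \<delta>" using c H(2)[OF r(2)] r(2) by (intro mult_mono) auto
      finally show ?thesis .
    next
      case False
      have "\<nexists>r. (*) s ` S = right_multiples r"
      proof
        assume "\<exists>r. (*) s ` S = right_multiples r"
        then obtain r where r: "(*) s ` S = right_multiples r" by blast
        then obtain q where "r = s * q" using self_in_right_multiples[of r] by auto
        then have "(*) s ` S = (*) s ` right_multiples q" using r right_multiples_mult by metis
        then have "S = right_multiples q" using inj_image_eq_iff[OF inj_mult] by blast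
        then show False using False by blast
      qed
      moreover have "(\<Sum>\<xi>\<leftarrow>H. weight (?h \<xi>) S) = 0"
        using False unfolding weight_def by (simp add: sum_list_0)
      ultimately have "\<bar>weight a ((*) s ` S) - ?F S\<bar> = 0"
        unfolding weight_def by simp
      then show ?thesis using c(1) \<delta> by simp
    qed
    have "0 \<le> N s powr (- \<beta>) * (\<Sum>\<xi>\<leftarrow>H. alt_sum (weight (?h \<xi>)) UNIV Bs)"
      using H(1) h nn by (intro mult_nonneg_nonneg sum_list_nonneg) auto
    also have "\<dots> = alt_sum ?F UNIV Bs" by (rule alt_sum_linear[symmetric])
    also have "\<dots> \<le> alt_sum (\<lambda>S. weight a ((*) s ` S)) UNIV Bs + 2 ^ length Bs * (c * \<delta>)"
      using alt_sum_near[of UNIV Bs "\<lambda>S. weight a ((*) s ` S)" ?F, OF near] by (simp add: abs_le_iff)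
    also have "2 ^ length Bs * (c * \<delta>) = \<epsilon>" unfolding \<delta>_def using c(1) by simp
    finally show ?thesis .
  qed
  then show ?thesis by (rule field_le_epsilon)
qed

lemma alt_sum_nonneg:
  assumes tree: "has_finite_tree \<Lambda>"
    and atoms_nonneg: "\<And>J a. finite J \<Longrightarrow> J \<subseteq> atoms \<Longrightarrow> a \<in> A\<^sub>+ \<Longrightarrow> 0 \<le> trace_sum X N \<beta> \<tau> J a"
  shows "\<forall>a\<in>A\<^sub>+. 0 \<le> alt_sum (weight a) UNIV (map ideal \<Lambda>)"
  using tree
proof (rule finite_tree_induct)
  fix M :: "'p option list"
  assume leaf: "leaf M"
  show "\<forall>a\<in>A\<^sub>+. 0 \<le> alt_sum (weight a) UNIV (map ideal M)"
  proof (cases "set M \<inter> Some ` invertibles = {}")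
    case False
    then obtain u where "u \<in> invertibles" "Some u \<in> set M" by blast
    then have "UNIV \<in> set (map ideal M)" using right_multiples_invertible by force
    then show ?thesis by (simp add: alt_sum_superset[OF _ subset_UNIV])
  next
    case True
    then have atomic: "set M \<subseteq> Some ` atoms \<union> {None}" using leaf unfolding leaf_def by blast
    define js where "js = map the (filter (\<lambda>x. x \<noteq> None) M)"
    have js: "set js \<subseteq> atoms" using atomic by (auto simp: js_def)
    have ne: "right_multiples r \<noteq> {}" for r :: 'p using self_in_right_multiples[of r] by blast
    have "filter (\<lambda>B. B \<noteq> {}) (map ideal M) = map right_multiples js"
      unfolding js_def
      by (induction M) (auto simp: ne)
    then have "alt_sum (weight a) UNIV (map ideal M)
        = alt_sum (weight a) UNIV (map right_multiples (remdups js))" for a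
      using alt_sum_filter_nonempty[of "weight a", OF weight_empty] alt_sum_remdups by metis
    moreover have "0 \<le> alt_sum (weight a) UNIV (map right_multiples (remdups js))" if "a \<in> A\<^sub>+" for a
      using trace_sum_eq_alt_sum[OF that, of "remdups js"] atoms_nonneg[of "set js" a] js that by simp
    ultimately show ?thesis by simp
  qed
next
  fix M M1 M2 :: "'p option list"
  assume ch: "children M M1 M2"
    and 1: "\<forall>a\<in>A\<^sub>+. 0 \<le> alt_sum (weight a) UNIV (map ideal M1)"
    and 2: "\<forall>a\<in>A\<^sub>+. 0 \<le> alt_sum (weight a) UNIV (map ideal M2)"
  obtain s where s: "s \<in> atoms" and split: "\<And>G. alt_sum G UNIV (map ideal M)
    = alt_sum G UNIV (map ideal M1) + alt_sum (\<lambda>S. G ((*) s ` S)) UNIV (map ideal M2)"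
    using alt_sum_children[OF right_lcm ch] by blast
  have "0 \<le> alt_sum (\<lambda>S. weight a ((*) s ` S)) UNIV (map ideal M2)" if "a \<in> A\<^sub>+" for a
    using alt_sum_translate_nonneg[OF atom_not_one[OF s] that] 2 by blast
  then show "\<forall>a\<in>A\<^sub>+. 0 \<le> alt_sum (weight a) UNIV (map ideal M)"
    unfolding split using 1 by (simp add: add_nonneg_nonneg)
qed

end

section \<open>Reduction to atoms\<close>

theorem theorem4p8:
  fixes X :: "('p::monoid_mult, 'a::cstar_algebra, 'x::complex_vec) product_system"
    and N :: "'p \<Rightarrow> real" and \<beta> :: real and \<tau> :: "'a \<Rightarrow> complex"
  assumes "right_LCM_monoid TYPE('p)"
    and "noetherian_monoid TYPE('p)"
    and "is_product_system X"
    and "\<And>p. essential (fibre X p)"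
    and "compactly_aligned X"
    and "\<And>p. 0 < N p"
    and "\<And>p q. N (p * q) = N p * N q"
    and "\<And>u. u \<in> invertibles \<Longrightarrow> N u = 1"
    and "\<And>\<Lambda>::'p option list. has_finite_tree \<Lambda>"
    and "tracial_state \<tau>"
    and "lcm_traces_well_defined X \<tau>"
  shows "(\<forall>a\<in>A\<^sub>+. \<forall>J. finite J \<and> J \<subseteq> UNIV - {1} \<longrightarrow> 0 \<le> trace_sum X N \<beta> \<tau> J a) \<longleftrightarrow>
         (\<forall>a\<in>A\<^sub>+. \<forall>J. finite J \<and> J \<subseteq> atoms \<longrightarrow> 0 \<le> trace_sum X N \<beta> \<tau> J a)"
proof -
  interpret trace_setup X N \<beta> \<tau>
    by unfold_locales (use assms in auto)
  show ?thesis
  proof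
    assume "\<forall>a\<in>A\<^sub>+. \<forall>J. finite J \<and> J \<subseteq> UNIV - {1} \<longrightarrow> 0 \<le> trace_sum X N \<beta> \<tau> J a"
    moreover have "(atoms :: 'p set) \<subseteq> UNIV - {1}" using atom_not_one by blast
    ultimately show "\<forall>a\<in>A\<^sub>+. \<forall>J. finite J \<and> J \<subseteq> atoms \<longrightarrow> 0 \<le> trace_sum X N \<beta> \<tau> J a" by blast
  next
    assume nn: "\<forall>a\<in>A\<^sub>+. \<forall>J. finite J \<and> J \<subseteq> atoms \<longrightarrow> 0 \<le> trace_sum X N \<beta> \<tau> J a"
    have dom: "\<exists>c\<ge>0. \<forall>a\<in>A\<^sub>+. Tr X \<tau> p a \<le> ereal (c * Re (\<tau> a))" for p
      by (rule Tr_dominated) (use nn in auto)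
    interpret finite_traces X N \<beta> \<tau>
    proof unfold_locales
      fix p a assume "a \<in> (A\<^sub>+ :: 'a set)"
      then show "Tr X \<tau> p a \<noteq> \<infinity>" using dom[of p] by force
    qed
    show "\<forall>a\<in>A\<^sub>+. \<forall>J. finite J \<and> J \<subseteq> UNIV - {1} \<longrightarrow> 0 \<le> trace_sum X N \<beta> \<tau> J a"
    proof (intro ballI allI impI)
      fix a J assume a: "a \<in> (A\<^sub>+ :: 'a set)" and J: "finite J \<and> J \<subseteq> UNIV - {1::'p}"
      obtain js where js: "set js = J" "distinct js" using J finite_distinct_list by blast
      have "0 \<le> alt_sum (weight a) UNIV (map ideal (map Some js))"
        using alt_sum_nonneg[OF assms(9)[of "map Some js"]] nn a by blast
      then show "0 \<le> trace_sum X N \<beta> \<tau> J a"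
        using trace_sum_eq_alt_sum[OF a js(2)] js(1) by (simp add: comp_def)
    qed
  qed
qed

end
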